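(* Let $\mathcal{C}$ be a triangulated category with a twin cotorsion pair $((\mathcal{S},\mathcal{T}),(\mathcal{U},\mathcal{V}))$. If $\mathcal{U}\subseteq\mathcal{T}$ or $\mathcal{T}\subseteq\mathcal{U}$, then the additive quotient category $\overline{\mathcal{H}}=\mathcal{H}/[\mathcal{W}]$ is quasi-abelian.
   Context: $\Sigma$ denotes the suspension functor of $\mathcal{C}$, "triangle" means distinguished triangle, and $\operatorname{Ext}^{1}_{\mathcal{C}}(X,Y)=\operatorname{Hom}_{\mathcal{C}}(X,\Sigma Y)$. For full subcategories $\mathcal{X},\mathcal{Y}$ of $\mathcal{C}$, $\mathcal{X}*\mathcal{Y}$ is the full subcategory of objects $C$ for which there is a triangle $X\to C\to Y\to\Sigma X$ with $X\in\mathcal{X}$, $Y\in\mathcal{Y}$. A cotorsion pair on $\mathcal{C}$ is a pair $(\mathcal{U},\mathcal{V})$ of full, additive subcategories closed under isomorphisms and direct summands such that $\operatorname{Ext}^{1}_{\mathcal{C}}(U,V)=0$ for all $U\in\mathcal{U}$, $V\in\mathcal{V}$, and $\mathcal{C}=\mathcal{U}*\Sigma\mathcal{V}$. A twin cotorsion pair $((\mathcal{S},\mathcal{T}),(\mathcal{U},\mathcal{V}))$ is a pair of cotorsion pairs on $\mathcal{C}$ with $\operatorname{Ext}^{1}_{\mathcal{C}}(\mathcal{S},\mathcal{V})=0$ (equivalently $\mathcal{S}\subseteq\mathcal{U}$, equivalently $\mathcal{V}\subseteq\mathcal{T}$). Given a twin cotorsion pair, define full subcategories $\mathcal{W}=\mathcal{T}\cap\mathcal{U}$,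 $\mathcal{C}^{-}=\Sigma^{-1}\mathcal{S}*\mathcal{W}$, $\mathcal{C}^{+}=\mathcal{W}*\Sigma\mathcal{V}$, $\mathcal{H}=\mathcal{C}^{-}\cap\mathcal{C}^{+}$. $[\mathcal{W}]$ is the ideal of morphisms factoring through an object of $\mathcal{W}$, and $\overline{\mathcal{H}}=\mathcal{H}/[\mathcal{W}]$ is called the heart of the twin cotorsion pair. A preabelian category is an additive category in which every morphism has a kernel and a cokernel. A preabelian category is quasi-abelian if cokernels (morphisms that are a cokernel of some morphism) are stable under pullback and kernels (morphisms that are a kernel of some morphism) are stable under pushout. *)

theory Defs
  imports "HOL-Algebra.Coset"
begin

section \<open>Preadditive and additive categories\<close>

text \<open>
  Composition is written in the usual order: \<open>g \<cdot> f\<close> is first \<open>f\<close>, then \<open>g\<close>.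
  All operations are only meaningful on \<open>Ob\<close> and on arrows of the \<open>Hom\<close>-sets between
  elements of \<open>Ob\<close>; their values elsewhere are irrelevant.
\<close>

record ('o, 'm) precat =
  Ob :: "'o set"
  Hom :: "'o \<Rightarrow> 'o \<Rightarrow> 'm set"
  Comp :: "'m \<Rightarrow> 'm \<Rightarrow> 'm"  (infixr "\<cdot>\<index>" 70)
  Idn :: "'o \<Rightarrow> 'm"
  Zero :: "'o \<Rightarrow> 'o \<Rightarrow> 'm"
  Plus :: "'m \<Rightarrow> 'm \<Rightarrow> 'm"  (infixl "\<boxplus>\<index>" 65)

definition hom_group :: "('o, 'm, 'x) precat_scheme \<Rightarrow> 'o \<Rightarrow> 'o \<Rightarrow> 'm monoid"
  where "hom_group C X Y = \<lparr>carrier = Hom C X Y, mult = Plus C, one = Zero C X Y\<rparr>"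

text \<open>Disjointness of the \<open>Hom\<close>-sets lets an arrow determine its source and target.\<close>

locale preadditive_category =
  fixes C :: "('o, 'm, 'x) precat_scheme" (structure)
  assumes hom_disjoint:
      "\<lbrakk>X \<in> Ob C; Y \<in> Ob C; X' \<in> Ob C; Y' \<in> Ob C; f \<in> Hom C X Y; f \<in> Hom C X' Y'\<rbrakk>
        \<Longrightarrow> X = X' \<and> Y = Y'"
    and idn_in_hom: "X \<in> Ob C \<Longrightarrow> Idn C X \<in> Hom C X X"
    and comp_in_hom:
      "\<lbrakk>X \<in> Ob C; Y \<in> Ob C; Z \<in> Ob C; f \<in> Hom C X Y; g \<in> Hom C Y Z\<rbrakk> \<Longrightarrow> g \<cdot> f \<in> Hom C X Z"
    and comp_idn: "\<lbrakk>X \<in> Ob C; Y \<in> Ob C; f \<in> Hom C X Y\<rbrakk> \<Longrightarrow> f \<cdot> Idn C X = f"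
    and idn_comp: "\<lbrakk>X \<in> Ob C; Y \<in> Ob C; f \<in> Hom C X Y\<rbrakk> \<Longrightarrow> Idn C Y \<cdot> f = f"
    and comp_assoc:
      "\<lbrakk>X \<in> Ob C; Y \<in> Ob C; Z \<in> Ob C; A \<in> Ob C; f \<in> Hom C X Y; g \<in> Hom C Y Z; h \<in> Hom C Z A\<rbrakk>
        \<Longrightarrow> (h \<cdot> g) \<cdot> f = h \<cdot> (g \<cdot> f)"
    and hom_comm_group: "\<lbrakk>X \<in> Ob C; Y \<in> Ob C\<rbrakk> \<Longrightarrow> comm_group (hom_group C X Y)"
    and comp_plus:
      "\<lbrakk>X \<in> Ob C; Y \<in> Ob C; Z \<in> Ob C; f \<in> Hom C X Y; f' \<in> Hom C X Y; g \<in> Hom C Y Z\<rbrakk>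
        \<Longrightarrow> g \<cdot> (f \<boxplus> f') = (g \<cdot> f) \<boxplus> (g \<cdot> f')"
    and plus_comp:
      "\<lbrakk>X \<in> Ob C; Y \<in> Ob C; Z \<in> Ob C; f \<in> Hom C X Y; g \<in> Hom C Y Z; g' \<in> Hom C Y Z\<rbrakk>
        \<Longrightarrow> (g \<boxplus> g') \<cdot> f = (g \<cdot> f) \<boxplus> (g' \<cdot> f)"

definition zero_object :: "('o, 'm, 'x) precat_scheme \<Rightarrow> 'o \<Rightarrow> bool"
  where "zero_object C Z \<longleftrightarrow> Z \<in> Ob C \<and>
    (\<forall>X \<in> Ob C. (\<exists>!f. f \<in> Hom C X Z) \<and> (\<exists>!f. f \<in> Hom C Z X))"

definition is_iso :: "('o, 'm, 'x) precat_scheme \<Rightarrow> 'o \<Rightarrow> 'o \<Rightarrow> 'm \<Rightarrow> bool"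
  where "is_iso C X Y f \<longleftrightarrow> f \<in> Hom C X Y \<and>
    (\<exists>g \<in> Hom C Y X. g \<cdot>\<^bsub>C\<^esub> f = Idn C X \<and> f \<cdot>\<^bsub>C\<^esub> g = Idn C Y)"

definition isomorphic :: "('o, 'm, 'x) precat_scheme \<Rightarrow> 'o \<Rightarrow> 'o \<Rightarrow> bool"
  where "isomorphic C X Y \<longleftrightarrow> (\<exists>f. is_iso C X Y f)"

definition direct_sum :: "('o, 'm, 'x) precat_scheme \<Rightarrow> 'o \<Rightarrow> 'o \<Rightarrow> 'o \<Rightarrow> bool"
  where "direct_sum C A B P \<longleftrightarrow> A \<in> Ob C \<and> B \<in> Ob C \<and> P \<in> Ob C \<and>
    (\<exists>i \<in> Hom C A P. \<exists>j \<in> Hom C B P. \<exists>p \<in> Hom C P A. \<exists>q \<in> Hom C P B.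
      p \<cdot>\<^bsub>C\<^esub> i = Idn C A \<and> q \<cdot>\<^bsub>C\<^esub> j = Idn C B \<and>
      p \<cdot>\<^bsub>C\<^esub> j = Zero C B A \<and> q \<cdot>\<^bsub>C\<^esub> i = Zero C A B \<and>
      (i \<cdot>\<^bsub>C\<^esub> p) \<boxplus>\<^bsub>C\<^esub> (j \<cdot>\<^bsub>C\<^esub> q) = Idn C P)"

locale additive_category = preadditive_category +
  assumes ex_zero_object: "\<exists>Z. zero_object C Z"
    and ex_direct_sum: "\<lbrakk>A \<in> Ob C; B \<in> Ob C\<rbrakk> \<Longrightarrow> \<exists>P. direct_sum C A B P"


section \<open>Preabelian and quasi-abelian categories\<close>

text \<open>\<open>is_kernel C K X Y k f\<close>: the arrow \<open>k : K \<rightarrow> X\<close> is a kernel of \<open>f : X \<rightarrow> Y\<close>.\<close>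

definition is_kernel :: "('o, 'm, 'x) precat_scheme \<Rightarrow> 'o \<Rightarrow> 'o \<Rightarrow> 'o \<Rightarrow> 'm \<Rightarrow> 'm \<Rightarrow> bool"
  where "is_kernel C K X Y k f \<longleftrightarrow> K \<in> Ob C \<and> X \<in> Ob C \<and> Y \<in> Ob C \<and>
    k \<in> Hom C K X \<and> f \<in> Hom C X Y \<and> f \<cdot>\<^bsub>C\<^esub> k = Zero C K Y \<and>
    (\<forall>A \<in> Ob C. \<forall>g \<in> Hom C A X. f \<cdot>\<^bsub>C\<^esub> g = Zero C A Y \<longrightarrow>
      (\<exists>!u. u \<in> Hom C A K \<and> k \<cdot>\<^bsub>C\<^esub> u = g))"

text \<open>\<open>is_cokernel C X Y Q f c\<close>: the arrow \<open>c : Y \<rightarrow> Q\<close> is a cokernel of \<open>f : X \<rightarrow> Y\<close>.\<close>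

definition is_cokernel :: "('o, 'm, 'x) precat_scheme \<Rightarrow> 'o \<Rightarrow> 'o \<Rightarrow> 'o \<Rightarrow> 'm \<Rightarrow> 'm \<Rightarrow> bool"
  where "is_cokernel C X Y Q f c \<longleftrightarrow> X \<in> Ob C \<and> Y \<in> Ob C \<and> Q \<in> Ob C \<and>
    f \<in> Hom C X Y \<and> c \<in> Hom C Y Q \<and> c \<cdot>\<^bsub>C\<^esub> f = Zero C X Q \<and>
    (\<forall>A \<in> Ob C. \<forall>g \<in> Hom C Y A. g \<cdot>\<^bsub>C\<^esub> f = Zero C X A \<longrightarrow>
      (\<exists>!u. u \<in> Hom C Q A \<and> u \<cdot>\<^bsub>C\<^esub> c = g))"

definition kernel_arrow :: "('o, 'm, 'x) precat_scheme \<Rightarrow> 'o \<Rightarrow> 'o \<Rightarrow> 'm \<Rightarrow> bool"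
  where "kernel_arrow C K X k \<longleftrightarrow> (\<exists>Y f. is_kernel C K X Y k f)"

definition cokernel_arrow :: "('o, 'm, 'x) precat_scheme \<Rightarrow> 'o \<Rightarrow> 'o \<Rightarrow> 'm \<Rightarrow> bool"
  where "cokernel_arrow C Y Q c \<longleftrightarrow> (\<exists>X f. is_cokernel C X Y Q f c)"

text \<open>
  \<open>is_pullback C P A B D p q f g\<close>: the square
  \<open>p : P \<rightarrow> A\<close>, \<open>q : P \<rightarrow> B\<close>, \<open>f : A \<rightarrow> D\<close>, \<open>g : B \<rightarrow> D\<close> is cartesian.
\<close>

definition is_pullback ::
    "('o, 'm, 'x) precat_scheme \<Rightarrow> 'o \<Rightarrow> 'o \<Rightarrow> 'o \<Rightarrow> 'o \<Rightarrow> 'm \<Rightarrow> 'm \<Rightarrow> 'm \<Rightarrow> 'm \<Rightarrow> bool"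
  where "is_pullback C P A B D p q f g \<longleftrightarrow> P \<in> Ob C \<and> A \<in> Ob C \<and> B \<in> Ob C \<and> D \<in> Ob C \<and>
    p \<in> Hom C P A \<and> q \<in> Hom C P B \<and> f \<in> Hom C A D \<and> g \<in> Hom C B D \<and>
    f \<cdot>\<^bsub>C\<^esub> p = g \<cdot>\<^bsub>C\<^esub> q \<and>
    (\<forall>X \<in> Ob C. \<forall>a \<in> Hom C X A. \<forall>b \<in> Hom C X B. f \<cdot>\<^bsub>C\<^esub> a = g \<cdot>\<^bsub>C\<^esub> b \<longrightarrow>
      (\<exists>!u. u \<in> Hom C X P \<and> p \<cdot>\<^bsub>C\<^esub> u = a \<and> q \<cdot>\<^bsub>C\<^esub> u = b))"

text \<open>
  \<open>is_pushout C D A B P f g p q\<close>: the square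
  \<open>f : D \<rightarrow> A\<close>, \<open>g : D \<rightarrow> B\<close>, \<open>p : A \<rightarrow> P\<close>, \<open>q : B \<rightarrow> P\<close> is cocartesian.
\<close>

definition is_pushout ::
    "('o, 'm, 'x) precat_scheme \<Rightarrow> 'o \<Rightarrow> 'o \<Rightarrow> 'o \<Rightarrow> 'o \<Rightarrow> 'm \<Rightarrow> 'm \<Rightarrow> 'm \<Rightarrow> 'm \<Rightarrow> bool"
  where "is_pushout C D A B P f g p q \<longleftrightarrow> D \<in> Ob C \<and> A \<in> Ob C \<and> B \<in> Ob C \<and> P \<in> Ob C \<and>
    f \<in> Hom C D A \<and> g \<in> Hom C D B \<and> p \<in> Hom C A P \<and> q \<in> Hom C B P \<and>
    p \<cdot>\<^bsub>C\<^esub> f = q \<cdot>\<^bsub>C\<^esub> g \<and>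
    (\<forall>X \<in> Ob C. \<forall>a \<in> Hom C A X. \<forall>b \<in> Hom C B X. a \<cdot>\<^bsub>C\<^esub> f = b \<cdot>\<^bsub>C\<^esub> g \<longrightarrow>
      (\<exists>!u. u \<in> Hom C P X \<and> u \<cdot>\<^bsub>C\<^esub> p = a \<and> u \<cdot>\<^bsub>C\<^esub> q = b))"

locale preabelian_category = additive_category +
  assumes ex_kernel:
      "\<lbrakk>X \<in> Ob C; Y \<in> Ob C; f \<in> Hom C X Y\<rbrakk> \<Longrightarrow> \<exists>K k. is_kernel C K X Y k f"
    and ex_cokernel:
      "\<lbrakk>X \<in> Ob C; Y \<in> Ob C; f \<in> Hom C X Y\<rbrakk> \<Longrightarrow> \<exists>Q c. is_cokernel C X Y Q f c"

locale quasi_abelian_category = preabelian_category +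
  assumes cokernels_stable_under_pullback:
      "\<lbrakk>is_pullback C P A B D p q f g; cokernel_arrow C A D f\<rbrakk> \<Longrightarrow> cokernel_arrow C P B q"
    and kernels_stable_under_pushout:
      "\<lbrakk>is_pushout C D A B P f g p q; kernel_arrow C D A f\<rbrakk> \<Longrightarrow> kernel_arrow C B P q"


section \<open>Full subcategories and additive quotients\<close>

definition full_subcategory :: "('o, 'm, 'x) precat_scheme \<Rightarrow> 'o set \<Rightarrow> ('o, 'm) precat"
  where "full_subcategory C \<X> =
    \<lparr>Ob = \<X>, Hom = Hom C, Comp = Comp C, Idn = Idn C, Zero = Zero C, Plus = Plus C\<rparr>"

definition factor_ideal :: "('o, 'm, 'x) precat_scheme \<Rightarrow> 'o set \<Rightarrow> 'o \<Rightarrow> 'o \<Rightarrow> 'm set"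
  where "factor_ideal C \<W> X Y =
    {f \<in> Hom C X Y. \<exists>W \<in> \<W>. \<exists>g \<in> Hom C X W. \<exists>h \<in> Hom C W Y. f = h \<cdot>\<^bsub>C\<^esub> g}"

text \<open>
  The quotient by a two-sided ideal \<open>J\<close>: arrows are the cosets of the groups \<open>J X Y\<close>.
  A coset lies in a single \<open>Hom\<close>-set, so the union defining the composite of two cosets
  is over equal sets (the coset of \<open>g \<cdot> f\<close>, for any choice of representatives).
\<close>

definition quotient_category ::
    "('o, 'm, 'x) precat_scheme \<Rightarrow> ('o \<Rightarrow> 'o \<Rightarrow> 'm set) \<Rightarrow> ('o, 'm set) precat"
  where "quotient_category C J =
    \<lparr>Ob = Ob C,
     Hom = (\<lambda>X Y. rcosets\<^bsub>hom_group C X Y\<^esub> (J X Y)),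
     Comp = (\<lambda>G F. \<Union> {J X Z #>\<^bsub>hom_group C X Z\<^esub> (g \<cdot>\<^bsub>C\<^esub> f) | X Y Z f g.
        X \<in> Ob C \<and> Y \<in> Ob C \<and> Z \<in> Ob C \<and> f \<in> F \<inter> Hom C X Y \<and> g \<in> G \<inter> Hom C Y Z}),
     Idn = (\<lambda>X. J X X #>\<^bsub>hom_group C X X\<^esub> Idn C X),
     Zero = J,
     Plus = (\<lambda>F G. {f \<boxplus>\<^bsub>C\<^esub> g | f g. f \<in> F \<and> g \<in> G})\<rparr>"


section \<open>Triangulated categories\<close>

record ('o, 'm) tricat = "('o, 'm) precat" +
  SOb :: "'o \<Rightarrow> 'o"
  SArr :: "'m \<Rightarrow> 'm"
  Triangles :: "('m \<times> 'm \<times> 'm) set"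

text \<open>\<open>triangle C X Y Z f g h\<close>: a distinguished triangle \<open>X \<rightarrow> Y \<rightarrow> Z \<rightarrow> \<Sigma> X\<close> with maps \<open>f, g, h\<close>.\<close>

definition triangle ::
    "('o, 'm, 'x) tricat_scheme \<Rightarrow> 'o \<Rightarrow> 'o \<Rightarrow> 'o \<Rightarrow> 'm \<Rightarrow> 'm \<Rightarrow> 'm \<Rightarrow> bool"
  where "triangle C X Y Z f g h \<longleftrightarrow> X \<in> Ob C \<and> Y \<in> Ob C \<and> Z \<in> Ob C \<and>
    f \<in> Hom C X Y \<and> g \<in> Hom C Y Z \<and> h \<in> Hom C Z (SOb C X) \<and> (f, g, h) \<in> Triangles C"

text \<open>The suspension is an additive automorphism of the category, not merely an autoequivalence.\<close>

locale triangulated_category = additive_category C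
  for C :: "('o, 'm, 'x) tricat_scheme" (structure) +
  assumes S_bij_ob: "bij_betw (SOb C) (Ob C) (Ob C)"
    and S_bij_hom:
      "\<lbrakk>X \<in> Ob C; Y \<in> Ob C\<rbrakk> \<Longrightarrow> bij_betw (SArr C) (Hom C X Y) (Hom C (SOb C X) (SOb C Y))"
    and S_idn: "X \<in> Ob C \<Longrightarrow> SArr C (Idn C X) = Idn C (SOb C X)"
    and S_comp:
      "\<lbrakk>X \<in> Ob C; Y \<in> Ob C; Z \<in> Ob C; f \<in> Hom C X Y; g \<in> Hom C Y Z\<rbrakk>
        \<Longrightarrow> SArr C (g \<cdot> f) = SArr C g \<cdot> SArr C f"
    and S_plus:
      "\<lbrakk>X \<in> Ob C; Y \<in> Ob C; f \<in> Hom C X Y; g \<in> Hom C X Y\<rbrakk>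
        \<Longrightarrow> SArr C (f \<boxplus> g) = SArr C f \<boxplus> SArr C g"
    and triangle_iso:
      "\<lbrakk>triangle C X Y Z f g h; X' \<in> Ob C; Y' \<in> Ob C; Z' \<in> Ob C;
        f' \<in> Hom C X' Y'; g' \<in> Hom C Y' Z'; h' \<in> Hom C Z' (SOb C X');
        is_iso C X X' a; is_iso C Y Y' b; is_iso C Z Z' c;
        f' \<cdot> a = b \<cdot> f; g' \<cdot> b = c \<cdot> g; h' \<cdot> c = SArr C a \<cdot> h\<rbrakk>
        \<Longrightarrow> triangle C X' Y' Z' f' g' h'"
    and triangle_idn:
      "\<lbrakk>X \<in> Ob C; zero_object C Z\<rbrakk>
        \<Longrightarrow> triangle C X X Z (Idn C X) (Zero C X Z) (Zero C Z (SOb C X))"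
    and triangle_ex:
      "\<lbrakk>X \<in> Ob C; Y \<in> Ob C; f \<in> Hom C X Y\<rbrakk> \<Longrightarrow> \<exists>Z g h. triangle C X Y Z f g h"
    and triangle_rotate:
      "\<lbrakk>X \<in> Ob C; Y \<in> Ob C; Z \<in> Ob C; f \<in> Hom C X Y; g \<in> Hom C Y Z; h \<in> Hom C Z (SOb C X)\<rbrakk>
        \<Longrightarrow> triangle C X Y Z f g h \<longleftrightarrow>
          triangle C Y Z (SOb C X) g h (inv\<^bsub>hom_group C (SOb C X) (SOb C Y)\<^esub> (SArr C f))"
    and triangle_morphism:
      "\<lbrakk>triangle C X Y Z f g h; triangle C X' Y' Z' f' g' h';
        a \<in> Hom C X X'; b \<in> Hom C Y Y'; f' \<cdot> a = b \<cdot> f\<rbrakk>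
        \<Longrightarrow> \<exists>c \<in> Hom C Z Z'. g' \<cdot> b = c \<cdot> g \<and> h' \<cdot> c = SArr C a \<cdot> h"
    and octahedral:
      "\<lbrakk>triangle C X Y A f a a'; triangle C Y Z B g b b'; triangle C X Z D (g \<cdot> f) d d'\<rbrakk>
        \<Longrightarrow> \<exists>u v. triangle C A D B u v (SArr C a \<cdot> b') \<and>
          u \<cdot> a = d \<cdot> g \<and> d' \<cdot> u = a' \<and> v \<cdot> d = b \<and> b' \<cdot> v = SArr C f \<cdot> d'"


section \<open>Twin cotorsion pairs and their hearts\<close>

text \<open>Full subcategories are represented by their sets of objects.\<close>

definition star :: "('o, 'm, 'x) tricat_scheme \<Rightarrow> 'o set \<Rightarrow> 'o set \<Rightarrow> 'o set"
  where "star C \<X> \<Y> = {M. \<exists>X \<in> \<X>. \<exists>Y \<in> \<Y>. \<exists>f g h. triangle C X M Y f g h}"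

definition desuspension :: "('o, 'm, 'x) tricat_scheme \<Rightarrow> 'o set \<Rightarrow> 'o set"
  where "desuspension C \<X> = {X \<in> Ob C. SOb C X \<in> \<X>}"

definition Ext1_vanishes :: "('o, 'm, 'x) tricat_scheme \<Rightarrow> 'o set \<Rightarrow> 'o set \<Rightarrow> bool"
  where "Ext1_vanishes C \<X> \<Y> \<longleftrightarrow>
    (\<forall>X \<in> \<X>. \<forall>Y \<in> \<Y>. Hom C X (SOb C Y) = {Zero C X (SOb C Y)})"

definition additive_subcategory :: "('o, 'm, 'x) precat_scheme \<Rightarrow> 'o set \<Rightarrow> bool"
  where "additive_subcategory C \<X> \<longleftrightarrow> \<X> \<subseteq> Ob C \<and> (\<exists>Z \<in> \<X>. zero_object C Z) \<and>
    (\<forall>A \<in> \<X>. \<forall>B \<in> \<X>. \<exists>P \<in> \<X>. direct_sum C A B P)"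

definition iso_closed :: "('o, 'm, 'x) precat_scheme \<Rightarrow> 'o set \<Rightarrow> bool"
  where "iso_closed C \<X> \<longleftrightarrow> (\<forall>X \<in> \<X>. \<forall>Y \<in> Ob C. isomorphic C X Y \<longrightarrow> Y \<in> \<X>)"

definition summand_closed :: "('o, 'm, 'x) precat_scheme \<Rightarrow> 'o set \<Rightarrow> bool"
  where "summand_closed C \<X> \<longleftrightarrow> (\<forall>P \<in> \<X>. \<forall>A B. direct_sum C A B P \<longrightarrow> A \<in> \<X> \<and> B \<in> \<X>)"

definition cotorsion_pair :: "('o, 'm, 'x) tricat_scheme \<Rightarrow> 'o set \<Rightarrow> 'o set \<Rightarrow> bool"
  where "cotorsion_pair C \<U> \<V> \<longleftrightarrow>
    additive_subcategory C \<U> \<and> iso_closed C \<U> \<and> summand_closed C \<U> \<and>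
    additive_subcategory C \<V> \<and> iso_closed C \<V> \<and> summand_closed C \<V> \<and>
    Ext1_vanishes C \<U> \<V> \<and> Ob C = star C \<U> (SOb C ` \<V>)"

definition twin_cotorsion_pair ::
    "('o, 'm, 'x) tricat_scheme \<Rightarrow> 'o set \<Rightarrow> 'o set \<Rightarrow> 'o set \<Rightarrow> 'o set \<Rightarrow> bool"
  where "twin_cotorsion_pair C \<S> \<T> \<U> \<V> \<longleftrightarrow>
    cotorsion_pair C \<S> \<T> \<and> cotorsion_pair C \<U> \<V> \<and> Ext1_vanishes C \<S> \<V>"

definition twin_W :: "'o set \<Rightarrow> 'o set \<Rightarrow> 'o set"
  where "twin_W \<T> \<U> = \<T> \<inter> \<U>"

definition twin_minus ::
    "('o, 'm, 'x) tricat_scheme \<Rightarrow> 'o set \<Rightarrow> 'o set \<Rightarrow> 'o set \<Rightarrow> 'o set"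
  where "twin_minus C \<S> \<T> \<U> = star C (desuspension C \<S>) (twin_W \<T> \<U>)"

definition twin_plus ::
    "('o, 'm, 'x) tricat_scheme \<Rightarrow> 'o set \<Rightarrow> 'o set \<Rightarrow> 'o set \<Rightarrow> 'o set"
  where "twin_plus C \<T> \<U> \<V> = star C (twin_W \<T> \<U>) (SOb C ` \<V>)"

definition twin_H ::
    "('o, 'm, 'x) tricat_scheme \<Rightarrow> 'o set \<Rightarrow> 'o set \<Rightarrow> 'o set \<Rightarrow> 'o set \<Rightarrow> 'o set"
  where "twin_H C \<S> \<T> \<U> \<V> = twin_minus C \<S> \<T> \<U> \<inter> twin_plus C \<T> \<U> \<V>"

definition heart ::
    "('o, 'm, 'x) tricat_scheme \<Rightarrow> 'o set \<Rightarrow> 'o set \<Rightarrow> 'o set \<Rightarrow> 'o set \<Rightarrow> ('o, 'm set) precat"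
  where "heart C \<S> \<T> \<U> \<V> =
    quotient_category (full_subcategory C (twin_H C \<S> \<T> \<U> \<V>)) (factor_ideal C (twin_W \<T> \<U>))"

end

theory Submission
  imports Defs
begin

text \<open>
  Both hypotheses are exchanged by passing to the opposite category: there triangles are read
  backwards, \<open>((\<S>, \<T>), (\<U>, \<V>))\<close> becomes \<open>((\<V>, \<U>), (\<T>, \<S>))\<close>, and \<open>\<T> \<subseteq> \<U>\<close> becomes \<open>\<U> \<subseteq> \<T>\<close>.
  Quasi-abelian is a self-dual notion, so assume \<open>\<U> \<subseteq> \<T>\<close>. Then \<open>\<W> = \<U>\<close> and \<open>\<C>\<^sup>+ = \<U> * \<Sigma>\<V>\<close> is everything,
  so the heart is \<open>\<H> = \<P> * \<U>\<close> modulo the maps that factor through \<open>\<U>\<close>, where \<open>\<P> = \<Sigma>\<inverse>\<S>\<close>. Put \<open>\<N> = \<Sigma>\<V>\<close>.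

  Two kinds of triangles are visible in the heart. If \<open>p \<rightarrow> Y \<rightarrow> Q \<rightarrow> \<Sigma>p\<close> has \<open>p \<in> \<P>\<close>, then \<open>Y \<rightarrow> Q\<close> is
  epic modulo \<open>\<U>\<close>, because maps from \<open>p\<close> to \<open>\<U> \<subseteq> \<T>\<close> vanish and \<open>\<Sigma>p \<in> \<S> \<subseteq> \<U>\<close>. If \<open>v \<rightarrow> K \<rightarrow> X \<rightarrow> n\<close>
  has \<open>n \<in> \<N>\<close>, then \<open>K \<rightarrow> X\<close> is monic modulo \<open>\<U>\<close> against maps out of \<open>\<H>\<close>, because maps from \<open>\<U>\<close> to
  \<open>n\<close> vanish and maps from \<open>\<P>\<close> to \<open>v \<in> \<V> \<subseteq> \<T>\<close> vanish. A cokernel of \<open>f : X \<rightarrow> Y\<close>, where \<open>p \<rightarrow> X \<rightarrow> u\<close> presents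
  \<open>X\<close>, is the cone of \<open>p \<rightarrow> X \<rightarrow> Y\<close>. A kernel of \<open>f\<close> is the fibre of \<open>X \<rightarrow> Y \<rightarrow> n\<close>, where \<open>Y \<rightarrow> n\<close> has fibre in
  \<open>\<U>\<close>, followed by a coreflection into \<open>\<H>\<close> (lemma \<open>coreflection\<close>), which again has cone in \<open>\<N>\<close>.

  Such maps can be moved along arbitrary maps by completing triangles: given \<open>B \<rightarrow> Q\<close>, the composite
  \<open>B \<rightarrow> Q \<rightarrow> \<Sigma>p\<close> has a fibre \<open>P\<close>, so that \<open>p \<rightarrow> P \<rightarrow> B\<close> is again of the first kind; and given \<open>K \<rightarrow> B\<close>, the
  cone of \<open>v \<rightarrow> K \<rightarrow> B\<close> receives \<open>B\<close> by a map of the second kind. The squares obtained are only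
  commutative, not cartesian or cocartesian. This is enough: an additive category with kernels
  and cokernels is quasi-abelian if every cokernel can be completed, along every map into its
  target, to a commutative square whose opposite side is a cokernel, and every kernel, along every
  map out of its source, to a commutative square whose opposite side is monic
  (locale \<open>weak_exact_squares\<close>). The last step is Rump's argument that, once
  maps out of coimages are monic, stability of cokernels implies stability of kernels.

  To use the opposite category without constructing a triangulated structure on it, the argument is
  carried out for an additive category with a self-dual class of four-term sequences
  \<open>X \<rightarrow> Y \<rightarrow> Z \<rightarrow> \<Sigma>X\<close> (locale \<open>exact_quadruples\<close>) that records only what the proof needs from triangles.
\<close>

section \<open>Calculus of arrows in a preadditive category\<close>

context preadditive_category
begin

text \<open>
  By disjointness of the \<open>Hom\<close>-sets every arrow has a source and a target. Equations
  between those can be discharged by the simplifier, in contrast to the quantified endpoints of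
  \<open>f \<in> Hom C X Y\<close>.
\<close>

definition Arr :: "'m \<Rightarrow> bool"
  where "Arr f \<longleftrightarrow> (\<exists>X \<in> Ob C. \<exists>Y \<in> Ob C. f \<in> Hom C X Y)"

definition src :: "'m \<Rightarrow> 'o"
  where "src f = (THE X. X \<in> Ob C \<and> (\<exists>Y \<in> Ob C. f \<in> Hom C X Y))"

definition trg :: "'m \<Rightarrow> 'o"
  where "trg f = (THE Y. Y \<in> Ob C \<and> (\<exists>X \<in> Ob C. f \<in> Hom C X Y))"

definition arr :: "'m \<Rightarrow> 'o \<Rightarrow> 'o \<Rightarrow> bool"  ("\<guillemotleft>_ : _ \<rightarrow> _\<guillemotright>")
  where "\<guillemotleft>f : X \<rightarrow> Y\<guillemotright> \<longleftrightarrow> X \<in> Ob C \<and> Y \<in> Ob C \<and> f \<in> Hom C X Y"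

definition neg :: "'m \<Rightarrow> 'm"
  where "neg f = inv\<^bsub>hom_group C (src f) (trg f)\<^esub> f"

definition diff :: "'m \<Rightarrow> 'm \<Rightarrow> 'm"  (infixl "\<boxminus>" 65)
  where "f \<boxminus> g = f \<boxplus> neg g"

lemma src_eq:
  assumes "X \<in> Ob C" "Y \<in> Ob C" "f \<in> Hom C X Y"
  shows "src f = X"
  unfolding src_def by (rule the_equality) (use assms hom_disjoint in blast)+

lemma trg_eq:
  assumes "X \<in> Ob C" "Y \<in> Ob C" "f \<in> Hom C X Y"
  shows "trg f = Y"
  unfolding trg_def by (rule the_equality) (use assms hom_disjoint in blast)+

text \<open>
  As a rewrite rule this turns every typing statement into equations for source and target; the side
  conditions of the rules below are phrased in the same form.
\<close>

lemma arr_iff [simp]: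
  "\<guillemotleft>f : X \<rightarrow> Y\<guillemotright> \<longleftrightarrow> Arr f \<and> src f = X \<and> trg f = Y \<and> X \<in> Ob C \<and> Y \<in> Ob C"
  by (auto simp: arr_def Arr_def src_eq trg_eq)

lemma hom_iff_arr: "X \<in> Ob C \<Longrightarrow> Y \<in> Ob C \<Longrightarrow> f \<in> Hom C X Y \<longleftrightarrow> \<guillemotleft>f : X \<rightarrow> Y\<guillemotright>"
  by (simp add: arr_def del: arr_iff)

lemma Arr_hom: "Arr f \<Longrightarrow> f \<in> Hom C (src f) (trg f)"
  by (auto simp: Arr_def src_eq trg_eq)

lemma src_Ob [simp]: "Arr f \<Longrightarrow> src f \<in> Ob C"
  and trg_Ob [simp]: "Arr f \<Longrightarrow> trg f \<in> Ob C"
  by (auto simp: Arr_def src_eq trg_eq)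

lemma comp_arr:
  assumes "Arr f" "Arr g" "trg f = src g"
  shows "\<guillemotleft>g \<cdot> f : src f \<rightarrow> trg g\<guillemotright>"
  unfolding arr_def
  using comp_in_hom[OF _ _ _ Arr_hom[OF assms(1)], of "trg g" g] Arr_hom[OF assms(2)] assms
  by (simp add: src_Ob trg_Ob)

lemma comp_type [simp]:
  assumes "Arr f" "Arr g" "trg f = src g"
  shows "Arr (g \<cdot> f)" "src (g \<cdot> f) = src f" "trg (g \<cdot> f) = trg g"
  using comp_arr[OF assms] by simp_all

lemma Idn_type [simp]:
  assumes "X \<in> Ob C"
  shows "Arr (Idn C X)" "src (Idn C X) = X" "trg (Idn C X) = X"
  using assms idn_in_hom[OF assms] by (auto simp: hom_iff_arr)

lemma comp_Idn [simp]: "Arr f \<Longrightarrow> X = src f \<Longrightarrow> f \<cdot> Idn C X = f"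
  and Idn_comp [simp]: "Arr f \<Longrightarrow> Y = trg f \<Longrightarrow> Idn C Y \<cdot> f = f"
  using comp_idn idn_comp Arr_hom src_Ob trg_Ob by blast+

lemma assoc [simp]:
  assumes "Arr f" "Arr g" "Arr h" "trg f = src g" "trg g = src h"
  shows "(h \<cdot> g) \<cdot> f = h \<cdot> (g \<cdot> f)"
  using comp_assoc[of "src f" "src g" "src h" "trg h" f g h] assms
    Arr_hom[OF assms(1)] Arr_hom[OF assms(2)] Arr_hom[OF assms(3)]
  by (simp add: src_Ob trg_Ob)

lemma Zero_type [simp]:
  assumes "X \<in> Ob C" "Y \<in> Ob C"
  shows "Arr (Zero C X Y)" "src (Zero C X Y) = X" "trg (Zero C X Y) = Y"
proof -
  interpret G: comm_group "hom_group C X Y" by (rule hom_comm_group[OF assms])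
  have "Zero C X Y \<in> Hom C X Y" using G.one_closed by (simp add: hom_group_def)
  then show "Arr (Zero C X Y)" "src (Zero C X Y) = X" "trg (Zero C X Y) = Y"
    using assms by (simp_all add: hom_iff_arr)
qed

lemma plus_type [simp]:
  assumes "Arr f" "Arr g" "src f = src g" "trg f = trg g"
  shows "Arr (f \<boxplus> g)" "src (f \<boxplus> g) = src g" "trg (f \<boxplus> g) = trg g"
proof -
  interpret G: comm_group "hom_group C (src g) (trg g)" using assms by (intro hom_comm_group) simp_all
  have "f \<boxplus> g \<in> Hom C (src g) (trg g)"
    using G.m_closed[of f g] assms Arr_hom by (metis hom_group_def monoid.select_convs(1) partial_object.select_convs(1))
  then show "Arr (f \<boxplus> g)" "src (f \<boxplus> g) = src g" "trg (f \<boxplus> g) = trg g"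
    using assms by (simp_all add: hom_iff_arr)
qed

lemma neg_type [simp]:
  assumes "Arr f"
  shows "Arr (neg f)" "src (neg f) = src f" "trg (neg f) = trg f"
proof -
  interpret G: comm_group "hom_group C (src f) (trg f)" using assms by (intro hom_comm_group) simp_all
  have "neg f \<in> Hom C (src f) (trg f)"
    using G.inv_closed[of f] Arr_hom[OF assms] by (simp add: neg_def hom_group_def)
  then show "Arr (neg f)" "src (neg f) = src f" "trg (neg f) = trg f"
    using assms by (simp_all add: hom_iff_arr)
qed

lemma diff_type [simp]:
  assumes "Arr f" "Arr g" "src f = src g" "trg f = trg g"
  shows "Arr (f \<boxminus> g)" "src (f \<boxminus> g) = src g" "trg (f \<boxminus> g) = trg g"
  using assms by (simp_all add: diff_def)

lemma plus_assoc:
  assumes "Arr f" "Arr g" "Arr h" "src f = src g" "trg f = trg g" "src g = src h" "trg g = trg h"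
  shows "(f \<boxplus> g) \<boxplus> h = f \<boxplus> (g \<boxplus> h)"
proof -
  interpret G: comm_group "hom_group C (src h) (trg h)" using assms by (intro hom_comm_group) simp_all
  show ?thesis
    using G.m_assoc[of f g h] assms Arr_hom[of f] Arr_hom[of g] Arr_hom[of h] by (simp add: hom_group_def)
qed

lemma plus_comm:
  assumes "Arr f" "Arr g" "src f = src g" "trg f = trg g"
  shows "f \<boxplus> g = g \<boxplus> f"
proof -
  interpret G: comm_group "hom_group C (src g) (trg g)" using assms by (intro hom_comm_group) simp_all
  show ?thesis
    using G.m_comm[of f g] assms Arr_hom[of f] Arr_hom[of g] by (simp add: hom_group_def)
qed

lemma Zero_plus [simp]:
  assumes "Arr f" "src f = X" "trg f = Y"
  shows "Zero C X Y \<boxplus> f = f"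
proof -
  interpret G: comm_group "hom_group C X Y" using assms by (intro hom_comm_group) auto
  show ?thesis
    using G.l_one[of f] assms Arr_hom[of f] by (simp add: hom_group_def)
qed

lemma plus_Zero [simp]:
  assumes "Arr f" "src f = X" "trg f = Y"
  shows "f \<boxplus> Zero C X Y = f"
  using assms plus_comm[of f "Zero C X Y"] by auto

lemma plus_neg [simp]:
  assumes "Arr f"
  shows "f \<boxplus> neg f = Zero C (src f) (trg f)" "neg f \<boxplus> f = Zero C (src f) (trg f)"
proof -
  interpret G: comm_group "hom_group C (src f) (trg f)" using assms by (intro hom_comm_group) simp_all
  show "f \<boxplus> neg f = Zero C (src f) (trg f)" "neg f \<boxplus> f = Zero C (src f) (trg f)"
    using G.r_inv[of f] G.l_inv[of f] Arr_hom[OF assms] by (simp_all add: neg_def hom_group_def)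
qed

lemma plus_neg_cancel [simp]:
  assumes "Arr f" "Arr g" "src f = src g" "trg f = trg g"
  shows "f \<boxplus> (neg f \<boxplus> g) = g" "neg f \<boxplus> (f \<boxplus> g) = g"
  using assms plus_assoc[of f "neg f" g] plus_assoc[of "neg f" f g] by simp_all

lemma comp_plus_dist:
  assumes "Arr f" "Arr f'" "Arr g" "src f = src f'" "trg f = trg f'" "trg f' = src g"
  shows "g \<cdot> (f \<boxplus> f') = (g \<cdot> f) \<boxplus> (g \<cdot> f')"
  using comp_plus[of "src f'" "trg f'" "trg g" f f' g] Arr_hom[of f] Arr_hom[of f'] Arr_hom[of g] assms
  by simp

lemma plus_comp_dist:
  assumes "Arr f" "Arr g" "Arr g'" "src g = src g'" "trg g = trg g'" "trg f = src g'"
  shows "(g \<boxplus> g') \<cdot> f = (g \<cdot> f) \<boxplus> (g' \<cdot> f)"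
  using plus_comp[of "src f" "src g'" "trg g'" f g g'] Arr_hom[of f] Arr_hom[of g'] Arr_hom[of g] assms
  by simp

lemma plus_self_zero:
  assumes "Arr f" "f \<boxplus> f = f"
  shows "f = Zero C (src f) (trg f)"
  using plus_neg_cancel(2)[of f f] assms by simp

lemma comp_Zero [simp]:
  assumes "Arr g" "X \<in> Ob C" "Y = src g"
  shows "g \<cdot> Zero C X Y = Zero C X (trg g)"
proof -
  have "(g \<cdot> Zero C X Y) \<boxplus> (g \<cdot> Zero C X Y) = g \<cdot> Zero C X Y"
    using assms comp_plus_dist[of "Zero C X Y" "Zero C X Y" g] by simp
  from plus_self_zero[OF _ this] show ?thesis using assms by simp
qed

lemma Zero_comp [simp]:
  assumes "Arr f" "Z \<in> Ob C" "Y = trg f"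
  shows "Zero C Y Z \<cdot> f = Zero C (src f) Z"
proof -
  have "(Zero C Y Z \<boxplus> Zero C Y Z) \<cdot> f = (Zero C Y Z \<cdot> f) \<boxplus> (Zero C Y Z \<cdot> f)"
    by (rule plus_comp_dist) (use assms in simp_all)
  then have "(Zero C Y Z \<cdot> f) \<boxplus> (Zero C Y Z \<cdot> f) = Zero C Y Z \<cdot> f"
    using assms by simp
  from plus_self_zero[OF _ this] show ?thesis using assms by simp
qed

lemma neg_unique:
  assumes "Arr f" "Arr g" "src f = src g" "trg f = trg g" "f \<boxplus> g = Zero C (src g) (trg g)"
  shows "g = neg f"
  using plus_neg_cancel(2)[of f g] assms by simp

lemma comp_neg:
  assumes "Arr f" "Arr g" "trg f = src g"
  shows "g \<cdot> neg f = neg (g \<cdot> f)"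
proof -
  have "(g \<cdot> f) \<boxplus> (g \<cdot> neg f) = g \<cdot> (f \<boxplus> neg f)"
    by (rule comp_plus_dist[symmetric]) (use assms in simp_all)
  then show ?thesis
    using assms by (intro neg_unique) simp_all
qed

lemma neg_comp:
  assumes "Arr f" "Arr g" "trg f = src g"
  shows "neg g \<cdot> f = neg (g \<cdot> f)"
proof -
  have "(g \<cdot> f) \<boxplus> (neg g \<cdot> f) = (g \<boxplus> neg g) \<cdot> f"
    by (rule plus_comp_dist[symmetric]) (use assms in simp_all)
  then show ?thesis
    using assms by (intro neg_unique) simp_all
qed

lemma neg_neg [simp]: "Arr f \<Longrightarrow> neg (neg f) = f"
  by (rule neg_unique[symmetric]) simp_all

lemma neg_Zero [simp]: "X \<in> Ob C \<Longrightarrow> Y \<in> Ob C \<Longrightarrow> neg (Zero C X Y) = Zero C X Y"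
  by (rule neg_unique[symmetric]) simp_all

lemma diff_eq_Zero [simp]:
  assumes "Arr f" "Arr g" "src f = src g" "trg f = trg g" "X = src g" "Y = trg g"
  shows "f \<boxminus> g = Zero C X Y \<longleftrightarrow> f = g"
proof
  assume "f \<boxminus> g = Zero C X Y"
  then have "neg g = neg f" using assms by (intro neg_unique) (simp_all add: diff_def)
  from arg_cong[OF this, of neg] show "f = g" using assms by simp
qed (use assms in \<open>simp add: diff_def\<close>)

lemma comp_diff:
  assumes "Arr f" "Arr f'" "Arr g" "src f = src f'" "trg f = trg f'" "trg f' = src g"
  shows "g \<cdot> (f \<boxminus> f') = (g \<cdot> f) \<boxminus> (g \<cdot> f')"
  using assms by (simp add: diff_def comp_plus_dist comp_neg)

lemma diff_comp:
  assumes "Arr f" "Arr g" "Arr g'" "src g = src g'" "trg g = trg g'" "trg f = src g'"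
  shows "(g \<boxminus> g') \<cdot> f = (g \<cdot> f) \<boxminus> (g' \<cdot> f)"
  using assms by (simp add: diff_def plus_comp_dist neg_comp)

lemma diff_Zero [simp]:
  assumes "Arr f" "src f = X" "trg f = Y"
  shows "f \<boxminus> Zero C X Y = f"
  using assms by (auto simp: diff_def)

lemma diff_plus_cancel [simp]:
  assumes "Arr f" "Arr g" "src f = src g" "trg f = trg g"
  shows "(f \<boxminus> g) \<boxplus> g = f"
  using assms by (simp add: diff_def plus_assoc)

end

section \<open>A criterion for quasi-abelian categories\<close>

context preadditive_category
begin

lemma is_kernelI:
  assumes "\<guillemotleft>k : K \<rightarrow> X\<guillemotright>" "\<guillemotleft>f : X \<rightarrow> Y\<guillemotright>" "f \<cdot> k = Zero C K Y"
    and lift: "\<And>A g. \<guillemotleft>g : A \<rightarrow> X\<guillemotright> \<Longrightarrow> f \<cdot> g = Zero C A Y \<Longrightarrow> \<exists>u. \<guillemotleft>u : A \<rightarrow> K\<guillemotright> \<and> k \<cdot> u = g"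
    and monic: "\<And>A u. \<guillemotleft>u : A \<rightarrow> K\<guillemotright> \<Longrightarrow> k \<cdot> u = Zero C A X \<Longrightarrow> u = Zero C A K"
  shows "is_kernel C K X Y k f"
  unfolding is_kernel_def
proof (intro conjI ballI impI)
  fix A g assume A: "A \<in> Ob C" "g \<in> Hom C A X" "f \<cdot> g = Zero C A Y"
  then have g: "\<guillemotleft>g : A \<rightarrow> X\<guillemotright>" using assms(1) by (simp add: hom_iff_arr)
  obtain u where u: "\<guillemotleft>u : A \<rightarrow> K\<guillemotright>" "k \<cdot> u = g" using lift[OF g A(3)] by blast
  have "v = u" if v: "\<guillemotleft>v : A \<rightarrow> K\<guillemotright>" "k \<cdot> v = g" for v
  proof -
    have "k \<cdot> (v \<boxminus> u) = Zero C A X" using u v g assms(1) by (simp add: comp_diff)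
    then have "v \<boxminus> u = Zero C A K" using u v by (intro monic) simp_all
    then show ?thesis using u v by simp
  qed
  then show "\<exists>!u. u \<in> Hom C A K \<and> k \<cdot> u = g"
    using u A(1) assms(1) by (intro ex1I[of _ u]) (simp_all add: hom_iff_arr)
qed (use assms in \<open>simp_all add: hom_iff_arr\<close>)

lemma is_kernelD:
  assumes "is_kernel C K X Y k f"
  shows "\<guillemotleft>k : K \<rightarrow> X\<guillemotright>" "\<guillemotleft>f : X \<rightarrow> Y\<guillemotright>" "f \<cdot> k = Zero C K Y"
  using assms unfolding is_kernel_def arr_def by blast+

lemma kernel_lift:
  assumes "is_kernel C K X Y k f" "\<guillemotleft>g : A \<rightarrow> X\<guillemotright>" "f \<cdot> g = Zero C A Y"
  obtains u where "\<guillemotleft>u : A \<rightarrow> K\<guillemotright>" "k \<cdot> u = g"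
  using assms unfolding is_kernel_def arr_def by blast

lemma kernel_monic:
  assumes "is_kernel C K X Y k f" "\<guillemotleft>u : A \<rightarrow> K\<guillemotright>" "\<guillemotleft>v : A \<rightarrow> K\<guillemotright>" "k \<cdot> u = k \<cdot> v"
  shows "u = v"
proof -
  have "f \<cdot> (k \<cdot> u) = Zero C A Y"
    using assms(2) is_kernelD[OF assms(1)] assoc[of u k f, symmetric] by simp
  moreover have "\<guillemotleft>k \<cdot> u : A \<rightarrow> X\<guillemotright>" using assms(2) is_kernelD[OF assms(1)] by simp
  ultimately show ?thesis using assms unfolding is_kernel_def arr_def by metis
qed

lemma is_cokernelI:
  assumes "\<guillemotleft>f : X \<rightarrow> Y\<guillemotright>" "\<guillemotleft>c : Y \<rightarrow> Q\<guillemotright>" "c \<cdot> f = Zero C X Q"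
    and desc: "\<And>A g. \<guillemotleft>g : Y \<rightarrow> A\<guillemotright> \<Longrightarrow> g \<cdot> f = Zero C X A \<Longrightarrow> \<exists>u. \<guillemotleft>u : Q \<rightarrow> A\<guillemotright> \<and> u \<cdot> c = g"
    and epic: "\<And>A u. \<guillemotleft>u : Q \<rightarrow> A\<guillemotright> \<Longrightarrow> u \<cdot> c = Zero C Y A \<Longrightarrow> u = Zero C Q A"
  shows "is_cokernel C X Y Q f c"
  unfolding is_cokernel_def
proof (intro conjI ballI impI)
  fix A g assume A: "A \<in> Ob C" "g \<in> Hom C Y A" "g \<cdot> f = Zero C X A"
  then have g: "\<guillemotleft>g : Y \<rightarrow> A\<guillemotright>" using assms(2) by (simp add: hom_iff_arr)
  obtain u where u: "\<guillemotleft>u : Q \<rightarrow> A\<guillemotright>" "u \<cdot> c = g" using desc[OF g A(3)] by blast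
  have "v = u" if v: "\<guillemotleft>v : Q \<rightarrow> A\<guillemotright>" "v \<cdot> c = g" for v
  proof -
    have "(v \<boxminus> u) \<cdot> c = Zero C Y A" using u v g assms(2) by (simp add: diff_comp)
    then have "v \<boxminus> u = Zero C Q A" using u v by (intro epic) simp_all
    then show ?thesis using u v by simp
  qed
  then show "\<exists>!u. u \<in> Hom C Q A \<and> u \<cdot> c = g"
    using u A(1) assms(2) by (intro ex1I[of _ u]) (simp_all add: hom_iff_arr)
qed (use assms in \<open>simp_all add: hom_iff_arr\<close>)

lemma is_cokernelD:
  assumes "is_cokernel C X Y Q f c"
  shows "\<guillemotleft>f : X \<rightarrow> Y\<guillemotright>" "\<guillemotleft>c : Y \<rightarrow> Q\<guillemotright>" "c \<cdot> f = Zero C X Q"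
  using assms unfolding is_cokernel_def arr_def by blast+

lemma cokernel_desc:
  assumes "is_cokernel C X Y Q f c" "\<guillemotleft>g : Y \<rightarrow> A\<guillemotright>" "g \<cdot> f = Zero C X A"
  obtains u where "\<guillemotleft>u : Q \<rightarrow> A\<guillemotright>" "u \<cdot> c = g"
  using assms unfolding is_cokernel_def arr_def by blast

lemma cokernel_epic:
  assumes "is_cokernel C X Y Q f c" "\<guillemotleft>u : Q \<rightarrow> A\<guillemotright>" "\<guillemotleft>v : Q \<rightarrow> A\<guillemotright>" "u \<cdot> c = v \<cdot> c"
  shows "u = v"
proof -
  have "(u \<cdot> c) \<cdot> f = Zero C X A"
    using assms(2) is_cokernelD[OF assms(1)] by simp
  moreover have "\<guillemotleft>u \<cdot> c : Y \<rightarrow> A\<guillemotright>" using assms(2) is_cokernelD[OF assms(1)] by simp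
  ultimately show ?thesis using assms unfolding is_cokernel_def arr_def by metis
qed

text \<open>Cancellation on the left is tested on zero only, which is equivalent in a preadditive category.\<close>

definition monic :: "'m \<Rightarrow> bool"
  where "monic f \<longleftrightarrow> Arr f \<and>
    (\<forall>g. Arr g \<and> trg g = src f \<and> f \<cdot> g = Zero C (src g) (trg f) \<longrightarrow> g = Zero C (src g) (trg g))"

lemma monicI:
  assumes "\<guillemotleft>f : X \<rightarrow> Y\<guillemotright>" "\<And>A g. \<guillemotleft>g : A \<rightarrow> X\<guillemotright> \<Longrightarrow> f \<cdot> g = Zero C A Y \<Longrightarrow> g = Zero C A X"
  shows "monic f"
  using assms by (auto simp: monic_def)

lemma monicD:
  assumes "monic f" "\<guillemotleft>f : X \<rightarrow> Y\<guillemotright>" "\<guillemotleft>g : A \<rightarrow> X\<guillemotright>" "f \<cdot> g = Zero C A Y"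
  shows "g = Zero C A X"
  using assms by (auto simp: monic_def)

lemma monic_cancel:
  assumes "monic f" "\<guillemotleft>f : X \<rightarrow> Y\<guillemotright>" "\<guillemotleft>g : A \<rightarrow> X\<guillemotright>" "\<guillemotleft>h : A \<rightarrow> X\<guillemotright>" "f \<cdot> g = f \<cdot> h"
  shows "g = h"
proof -
  have "g \<boxminus> h = Zero C A X"
    by (rule monicD[OF assms(1,2)]) (use assms in \<open>simp_all add: comp_diff\<close>)
  then show ?thesis using assms by simp
qed

end

text \<open>
  Neither square is required to be cartesian or cocartesian. The cokernel or kernel may be chosen:
  the two extraction lemmas below transport the squares to every other one along the
  comparison isomorphism.
\<close>

locale weak_exact_squares = additive_category +
  assumes ex_cokernel_weak_pullback: "\<guillemotleft>f : X \<rightarrow> A\<guillemotright> \<Longrightarrow> \<exists>D c. is_cokernel C X A D f c \<and>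
      (\<forall>B g. \<guillemotleft>g : B \<rightarrow> D\<guillemotright> \<longrightarrow>
        (\<exists>P a q. cokernel_arrow C P B q \<and> \<guillemotleft>q : P \<rightarrow> B\<guillemotright> \<and> \<guillemotleft>a : P \<rightarrow> A\<guillemotright> \<and> c \<cdot> a = g \<cdot> q))"
    and ex_kernel_weak_pushout: "\<guillemotleft>f : A \<rightarrow> Y\<guillemotright> \<Longrightarrow> \<exists>K k. is_kernel C K A Y k f \<and>
      (\<forall>B g. \<guillemotleft>g : K \<rightarrow> B\<guillemotright> \<longrightarrow>
        (\<exists>P a q. monic q \<and> \<guillemotleft>q : B \<rightarrow> P\<guillemotright> \<and> \<guillemotleft>a : A \<rightarrow> P\<guillemotright> \<and> a \<cdot> k = q \<cdot> g))"
begin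

lemma cokernel_weak_pullback:
  assumes "cokernel_arrow C A D c" "\<guillemotleft>g : B \<rightarrow> D\<guillemotright>"
  obtains P a q where "cokernel_arrow C P B q" "\<guillemotleft>q : P \<rightarrow> B\<guillemotright>" "\<guillemotleft>a : P \<rightarrow> A\<guillemotright>" "c \<cdot> a = g \<cdot> q"
proof -
  obtain X f where c: "is_cokernel C X A D f c" using assms(1) by (auto simp: cokernel_arrow_def)
  note c' = is_cokernelD[OF c]
  obtain D0 c0 where c0: "is_cokernel C X A D0 f c0"
    and sq: "\<And>B g. \<guillemotleft>g : B \<rightarrow> D0\<guillemotright> \<Longrightarrow>
      \<exists>P a q. cokernel_arrow C P B q \<and> \<guillemotleft>q : P \<rightarrow> B\<guillemotright> \<and> \<guillemotleft>a : P \<rightarrow> A\<guillemotright> \<and> c0 \<cdot> a = g \<cdot> q"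
    using ex_cokernel_weak_pullback[OF c'(1)] by blast
  note c0' = is_cokernelD[OF c0]
  obtain i where i: "\<guillemotleft>i : D \<rightarrow> D0\<guillemotright>" "i \<cdot> c = c0" using cokernel_desc[OF c c0'(2,3)] by blast
  obtain j where j: "\<guillemotleft>j : D0 \<rightarrow> D\<guillemotright>" "j \<cdot> c0 = c" using cokernel_desc[OF c0 c'(2,3)] by blast
  have ji: "j \<cdot> i = Idn C D"
    by (rule cokernel_epic[OF c, where A = D]) (use i j c' c0' in simp_all)
  obtain P a q where *: "cokernel_arrow C P B q" "\<guillemotleft>q : P \<rightarrow> B\<guillemotright>" "\<guillemotleft>a : P \<rightarrow> A\<guillemotright>" "c0 \<cdot> a = (i \<cdot> g) \<cdot> q"
    using sq[of "i \<cdot> g" B] assms(2) i by auto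
  have "c \<cdot> a = j \<cdot> (c0 \<cdot> a)" using *(3) c' c0' assoc[of a c0 j] j by simp
  also have "\<dots> = (j \<cdot> i) \<cdot> (g \<cdot> q)" unfolding *(4) using i j assms(2) *(2) by (simp del: assoc add: assoc)
  also have "\<dots> = g \<cdot> q" unfolding ji using assms(2) *(2) by simp
  finally show thesis using that * by blast
qed

lemma kernel_weak_pushout:
  assumes "kernel_arrow C K A k" "\<guillemotleft>g : K \<rightarrow> B\<guillemotright>"
  obtains P a q where "monic q" "\<guillemotleft>q : B \<rightarrow> P\<guillemotright>" "\<guillemotleft>a : A \<rightarrow> P\<guillemotright>" "a \<cdot> k = q \<cdot> g"
proof -
  obtain Y f where k: "is_kernel C K A Y k f" using assms(1) by (auto simp: kernel_arrow_def)
  note k' = is_kernelD[OF k]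
  obtain K0 k0 where k0: "is_kernel C K0 A Y k0 f"
    and sq: "\<And>B g. \<guillemotleft>g : K0 \<rightarrow> B\<guillemotright> \<Longrightarrow>
      \<exists>P a q. monic q \<and> \<guillemotleft>q : B \<rightarrow> P\<guillemotright> \<and> \<guillemotleft>a : A \<rightarrow> P\<guillemotright> \<and> a \<cdot> k0 = q \<cdot> g"
    using ex_kernel_weak_pushout[OF k'(2)] by blast
  note k0' = is_kernelD[OF k0]
  obtain i where i: "\<guillemotleft>i : K0 \<rightarrow> K\<guillemotright>" "k \<cdot> i = k0" using kernel_lift[OF k k0'(1,3)] by blast
  obtain j where j: "\<guillemotleft>j : K \<rightarrow> K0\<guillemotright>" "k0 \<cdot> j = k" using kernel_lift[OF k0 k'(1,3)] by blast
  have ij: "i \<cdot> j = Idn C K"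
    by (rule kernel_monic[OF k, where A = K]) (use i j k' k0' assoc[of j i k] in simp_all)
  obtain P a q where *: "monic q" "\<guillemotleft>q : B \<rightarrow> P\<guillemotright>" "\<guillemotleft>a : A \<rightarrow> P\<guillemotright>" "a \<cdot> k0 = q \<cdot> (g \<cdot> i)"
    using sq[of "g \<cdot> i" B] assms(2) i by auto
  have "a \<cdot> k = (a \<cdot> k0) \<cdot> j" using *(3) k' k0' j by simp
  also have "\<dots> = q \<cdot> (g \<cdot> (i \<cdot> j))" unfolding *(4) using i j assms(2) *(2) by simp
  also have "\<dots> = q \<cdot> g" unfolding ij using assms(2) *(2) by simp
  finally show thesis using that * by blast
qed

text \<open>
  The map \<open>m\<close> out of the coimage is monic: if \<open>m \<cdot> g = 0\<close>, move the cokernel \<open>e\<close> along \<open>g\<close> to an epic \<open>q\<close>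
  with \<open>e \<cdot> a = g \<cdot> q\<close>. Then \<open>f \<cdot> a = 0\<close>, so \<open>a\<close> factors through the kernel \<open>k\<close>, \<open>e\<close> kills it, and
  \<open>g \<cdot> q = 0\<close>.
\<close>

lemma coimage_factorisation:
  assumes "\<guillemotleft>f : X \<rightarrow> Y\<guillemotright>"
  obtains K k I e m where "is_kernel C K X Y k f" "is_cokernel C K X I k e"
    "\<guillemotleft>m : I \<rightarrow> Y\<guillemotright>" "monic m" "m \<cdot> e = f"
proof -
  obtain K k where k: "is_kernel C K X Y k f" using ex_kernel_weak_pushout[OF assms] by blast
  note k' = is_kernelD[OF k]
  obtain I e where e: "is_cokernel C K X I k e" using ex_cokernel_weak_pullback[OF k'(1)] by blast
  note e' = is_cokernelD[OF e]
  obtain m where m: "\<guillemotleft>m : I \<rightarrow> Y\<guillemotright>" "m \<cdot> e = f" using cokernel_desc[OF e k'(2,3)] by blast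
  have "monic m"
  proof (rule monicI[OF m(1)])
    fix A g assume g: "\<guillemotleft>g : A \<rightarrow> I\<guillemotright>" "m \<cdot> g = Zero C A Y"
    obtain P a q where *: "cokernel_arrow C P A q" "\<guillemotleft>q : P \<rightarrow> A\<guillemotright>" "\<guillemotleft>a : P \<rightarrow> X\<guillemotright>" "e \<cdot> a = g \<cdot> q"
      by (rule cokernel_weak_pullback[OF _ g(1)]) (use e in \<open>auto simp: cokernel_arrow_def\<close>)
    have "f \<cdot> a = m \<cdot> (e \<cdot> a)" using m e' *(3) assoc[of a e m] by simp
    also have "\<dots> = (m \<cdot> g) \<cdot> q" unfolding *(4) using *(2) m(1) g(1) by simp
    also have "\<dots> = Zero C P Y" unfolding g(2) using * g k' by simp
    finally obtain t where t: "\<guillemotleft>t : P \<rightarrow> K\<guillemotright>" "k \<cdot> t = a" using kernel_lift[OF k *(3)] by blast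
    have "g \<cdot> q = (e \<cdot> k) \<cdot> t"
      unfolding *(4)[symmetric] t(2)[symmetric] using t(1) e'(2) k'(1) by simp
    also have "\<dots> = Zero C A I \<cdot> q" unfolding e'(3) using t e' g *(2) by simp
    finally have gq: "g \<cdot> q = Zero C A I \<cdot> q" .
    obtain Z z where z: "is_cokernel C Z P A z q" using *(1) by (auto simp: cokernel_arrow_def)
    show "g = Zero C A I" by (rule cokernel_epic[OF z g(1) _ gq]) (use g in simp)
  qed
  from that[OF k e m(1) this m(2)] show thesis .
qed

text \<open>
  Factor \<open>q = m \<cdot> e\<close> through its coimage. The monic \<open>m\<close> is a left factor of the cokernel \<open>q \<cdot> u\<close>, which
  makes it invertible, and so \<open>q\<close> is a cokernel together with \<open>e\<close>.
\<close>

lemma cokernel_arrow_left_factor: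
  assumes "cokernel_arrow C P' B (q \<cdot> u)" "\<guillemotleft>u : P' \<rightarrow> P\<guillemotright>" "\<guillemotleft>q : P \<rightarrow> B\<guillemotright>"
  shows "cokernel_arrow C P B q"
proof -
  obtain K k I e m where k: "is_kernel C K P B k q" and e: "is_cokernel C K P I k e"
    and m: "\<guillemotleft>m : I \<rightarrow> B\<guillemotright>" "monic m" "m \<cdot> e = q"
    using coimage_factorisation[OF assms(3)] by blast
  note k' = is_kernelD[OF k] and e' = is_cokernelD[OF e]
  obtain Z s where s: "is_cokernel C Z P' B s (q \<cdot> u)" using assms(1) by (auto simp: cokernel_arrow_def)
  note s' = is_cokernelD[OF s]
  have qu: "m \<cdot> (e \<cdot> u) = q \<cdot> u" using m e' assms(2) assoc[of u e m] by simp
  have "(e \<cdot> u) \<cdot> s = Zero C Z I"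
  proof (rule monicD[OF m(2,1)])
    have "m \<cdot> ((e \<cdot> u) \<cdot> s) = (m \<cdot> (e \<cdot> u)) \<cdot> s" using m e' assms s'(1) by simp
    then show "m \<cdot> ((e \<cdot> u) \<cdot> s) = Zero C Z B" unfolding qu s'(3) .
  qed (use assms e' s' in simp)
  then obtain t where t: "\<guillemotleft>t : B \<rightarrow> I\<guillemotright>" "t \<cdot> (q \<cdot> u) = e \<cdot> u"
    using cokernel_desc[OF s, of "e \<cdot> u" I] assms e' by auto
  have mt: "m \<cdot> t = Idn C B"
    by (rule cokernel_epic[OF s, where A = B]) (use m t s' qu in simp_all)
  have tm: "t \<cdot> m = Idn C I"
    by (rule monic_cancel[OF m(2,1), where A = I]) (use m t mt assoc[of m t m] in simp_all)
  have "is_cokernel C K P B k q"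
  proof (rule is_cokernelI[OF k'(1) assms(3) k'(3)])
    fix A g assume g: "\<guillemotleft>g : P \<rightarrow> A\<guillemotright>" "g \<cdot> k = Zero C K A"
    obtain v where v: "\<guillemotleft>v : I \<rightarrow> A\<guillemotright>" "v \<cdot> e = g" using cokernel_desc[OF e g] by blast
    have "(v \<cdot> t) \<cdot> q = v \<cdot> ((t \<cdot> m) \<cdot> e)" unfolding m(3)[symmetric] using v(1) t(1) m(1) e'(2) by simp
    then have "(v \<cdot> t) \<cdot> q = g" unfolding tm using v e' by simp
    then show "\<exists>u. \<guillemotleft>u : B \<rightarrow> A\<guillemotright> \<and> u \<cdot> q = g" using v t by (intro exI[of _ "v \<cdot> t"]) simp
  next
    fix A v assume v: "\<guillemotleft>v : B \<rightarrow> A\<guillemotright>" "v \<cdot> q = Zero C P A"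
    have "v \<cdot> m = Zero C I A"
    proof (rule cokernel_epic[OF e, where A = A])
      have "(v \<cdot> m) \<cdot> e = v \<cdot> q" unfolding m(3)[symmetric] using v m e' by simp
      then show "(v \<cdot> m) \<cdot> e = Zero C I A \<cdot> e" using v e' by simp
    qed (use v m in simp_all)
    then have "v \<cdot> (m \<cdot> t) = Zero C B A" using v(1) m t assoc[of t m v] by simp
    then show "v = Zero C B A" unfolding mt using v by simp
  qed
  then show ?thesis by (auto simp: cokernel_arrow_def)
qed

lemma pushoutD:
  assumes "is_pushout C D A B P f g p q"
  shows "\<guillemotleft>f : D \<rightarrow> A\<guillemotright>" "\<guillemotleft>g : D \<rightarrow> B\<guillemotright>" "\<guillemotleft>p : A \<rightarrow> P\<guillemotright>" "\<guillemotleft>q : B \<rightarrow> P\<guillemotright>" "p \<cdot> f = q \<cdot> g"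
  using assms unfolding is_pushout_def arr_def by - (elim conjE, (intro conjI)?; assumption)+

lemma pushout_univ:
  assumes "is_pushout C D A B P f g p q" "\<guillemotleft>a : A \<rightarrow> X\<guillemotright>" "\<guillemotleft>b : B \<rightarrow> X\<guillemotright>" "a \<cdot> f = b \<cdot> g"
  shows "\<exists>!u. \<guillemotleft>u : P \<rightarrow> X\<guillemotright> \<and> u \<cdot> p = a \<and> u \<cdot> q = b"
proof -
  have "\<exists>!u. u \<in> Hom C P X \<and> u \<cdot> p = a \<and> u \<cdot> q = b"
    using assms unfolding is_pushout_def arr_def by blast
  moreover have "P \<in> Ob C" "X \<in> Ob C" using assms unfolding is_pushout_def arr_def by blast+
  ultimately show ?thesis unfolding arr_def by simp
qed

text \<open>
  The monic side of a weak pushout factors through \<open>q\<close>, so \<open>q\<close> is monic. Let \<open>e\<close> be the cokernel of \<open>q\<close> and \<open>k1\<close> the kernel of \<open>e\<close>, so that \<open>q = k1 \<cdot> j\<close>; the claim is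
  that \<open>j\<close> is invertible. The map \<open>R = (r, q) : A \<oplus> B \<rightarrow> Q\<close> is a cokernel, since \<open>Q\<close> is a pushout, and
  its weak pullback along \<open>k1\<close> is a cokernel \<open>q0\<close> that turns out to factor through \<open>j\<close>. Hence \<open>j\<close>
  is a cokernel, and being monic as well it is an isomorphism.
\<close>

lemma pushout_of_kernel:
  assumes po: "is_pushout C D A B Q k g r q" and kern: "kernel_arrow C D A k"
  shows "kernel_arrow C B Q q"
proof -
  note po' = pushoutD[OF po]
  obtain Y f where k: "is_kernel C D A Y k f" using kern by (auto simp: kernel_arrow_def)
  note k' = is_kernelD[OF k]
  have q_monic: "monic q"
  proof (rule monicI[OF po'(4)])
    fix Z x assume x: "\<guillemotleft>x : Z \<rightarrow> B\<guillemotright>" "q \<cdot> x = Zero C Z Q"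
    obtain P a q' where *: "monic q'" "\<guillemotleft>q' : B \<rightarrow> P\<guillemotright>" "\<guillemotleft>a : A \<rightarrow> P\<guillemotright>" "a \<cdot> k = q' \<cdot> g"
      using kernel_weak_pushout[OF kern po'(2)] by blast
    obtain t where t: "\<guillemotleft>t : Q \<rightarrow> P\<guillemotright>" "t \<cdot> q = q'" using pushout_univ[OF po *(3,2,4)] by blast
    have "q' \<cdot> x = t \<cdot> (q \<cdot> x)" using t x(1) po'(4) assoc[of x q t] by simp
    then have "q' \<cdot> x = Zero C Z P" unfolding x(2) using t x by simp
    then show "x = Zero C Z B" by (rule monicD[OF *(1,2) x(1)])
  qed
  obtain E e where e: "is_cokernel C B Q E q e" using ex_cokernel_weak_pullback[OF po'(4)] by blast
  note e' = is_cokernelD[OF e]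
  obtain B' k1 where k1: "is_kernel C B' Q E k1 e" using ex_kernel_weak_pushout[OF e'(2)] by blast
  note k1' = is_kernelD[OF k1]
  obtain j where j: "\<guillemotleft>j : B \<rightarrow> B'\<guillemotright>" "k1 \<cdot> j = q" using kernel_lift[OF k1 po'(4) e'(3)] by blast
  \<comment> \<open>the composite \<open>e \<cdot> r\<close> has the same kernel \<open>k\<close> as \<open>f\<close>, because \<open>f\<close> factors through it\<close>
  have ker_er: "\<exists>d. \<guillemotleft>d : Z \<rightarrow> D\<guillemotright> \<and> k \<cdot> d = a" if a: "\<guillemotleft>a : Z \<rightarrow> A\<guillemotright>" "e \<cdot> (r \<cdot> a) = Zero C Z E" for Z a
  proof -
    obtain w where w: "\<guillemotleft>w : Q \<rightarrow> Y\<guillemotright>" "w \<cdot> r = f" "w \<cdot> q = Zero C B Y"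
      using pushout_univ[OF po, of f Y "Zero C B Y"] po'(1-4) k' by auto
    obtain w' where w': "\<guillemotleft>w' : E \<rightarrow> Y\<guillemotright>" "w' \<cdot> e = w" using cokernel_desc[OF e w(1,3)] by blast
    have "f \<cdot> a = w' \<cdot> (e \<cdot> (r \<cdot> a))"
      unfolding w(2)[symmetric] w'(2)[symmetric] using w'(1) e' po'(3) a(1) by simp
    then have "f \<cdot> a = Zero C Z Y" unfolding a(2) using w' a by simp
    then show ?thesis using kernel_lift[OF k a(1)] by blast
  qed
  obtain M i1 i2 p1 p2 where M: "\<guillemotleft>i1 : A \<rightarrow> M\<guillemotright>" "\<guillemotleft>i2 : B \<rightarrow> M\<guillemotright>" "\<guillemotleft>p1 : M \<rightarrow> A\<guillemotright>" "\<guillemotleft>p2 : M \<rightarrow> B\<guillemotright>"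
      "p1 \<cdot> i1 = Idn C A" "p2 \<cdot> i2 = Idn C B" "p1 \<cdot> i2 = Zero C B A" "p2 \<cdot> i1 = Zero C A B"
      "(i1 \<cdot> p1) \<boxplus> (i2 \<cdot> p2) = Idn C M"
  proof -
    from po'(1,2) have "A \<in> Ob C" "B \<in> Ob C" by simp_all
    then obtain M where "direct_sum C A B M" using ex_direct_sum by blast
    then show thesis unfolding direct_sum_def by (elim conjE bexE) (rule that; simp add: arr_def del: arr_iff)
  qed
  \<comment> \<open>the pushout, written as the cokernel of \<open>(k, - g) : D \<rightarrow> A \<oplus> B\<close>\<close>
  define R where "R = (r \<cdot> p1) \<boxplus> (q \<cdot> p2)"
  have R: "\<guillemotleft>R : M \<rightarrow> Q\<guillemotright>" using M po' by (simp add: R_def)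
  have Ri1: "R \<cdot> i1 = r" and Ri2: "R \<cdot> i2 = q"
    unfolding R_def using M po'(1-4) by (simp_all add: plus_comp_dist)
  have "is_cokernel C D M Q ((i1 \<cdot> k) \<boxminus> (i2 \<cdot> g)) R"
  proof (rule is_cokernelI)
    have "R \<cdot> (i1 \<cdot> k) = r \<cdot> k" "R \<cdot> (i2 \<cdot> g) = q \<cdot> g"
      using Ri1 Ri2 M(1,2) po'(1,2) R assoc[of k i1 R] assoc[of g i2 R] by simp_all
    then show "R \<cdot> ((i1 \<cdot> k) \<boxminus> (i2 \<cdot> g)) = Zero C D Q"
      using M(1,2) po'(1-5) R by (simp add: comp_diff)
  next
    fix Z h assume h: "\<guillemotleft>h : M \<rightarrow> Z\<guillemotright>" "h \<cdot> ((i1 \<cdot> k) \<boxminus> (i2 \<cdot> g)) = Zero C D Z"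
    have "(h \<cdot> i1) \<cdot> k \<boxminus> (h \<cdot> i2) \<cdot> g = Zero C D Z"
      using h M(1,2) po'(1,2) by (simp add: comp_diff)
    then have "(h \<cdot> i1) \<cdot> k = (h \<cdot> i2) \<cdot> g"
      using h(1) M(1,2) po'(1,2) by (subst (asm) diff_eq_Zero) simp_all
    then obtain u where u: "\<guillemotleft>u : Q \<rightarrow> Z\<guillemotright>" "u \<cdot> r = h \<cdot> i1" "u \<cdot> q = h \<cdot> i2"
      using pushout_univ[OF po, of "h \<cdot> i1" Z "h \<cdot> i2"] h(1) M(1,2) po'(1,2) by auto
    have "u \<cdot> R = (u \<cdot> r) \<cdot> p1 \<boxplus> (u \<cdot> q) \<cdot> p2"
      unfolding R_def using u(1) po'(3,4) M(3,4) by (simp add: comp_plus_dist)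
    also have "\<dots> = h \<cdot> ((i1 \<cdot> p1) \<boxplus> (i2 \<cdot> p2))"
      unfolding u(2,3) using h(1) M(1-4) by (simp add: comp_plus_dist)
    also have "\<dots> = h" unfolding M(9) using h by simp
    finally show "\<exists>u. \<guillemotleft>u : Q \<rightarrow> Z\<guillemotright> \<and> u \<cdot> R = h" using u by blast
  next
    fix Z u assume u: "\<guillemotleft>u : Q \<rightarrow> Z\<guillemotright>" "u \<cdot> R = Zero C M Z"
    have "u \<cdot> r = (u \<cdot> R) \<cdot> i1" "u \<cdot> q = (u \<cdot> R) \<cdot> i2" using Ri1 Ri2 u(1) R M(1,2) by simp_all
    then have "u \<cdot> r = Zero C A Z" "u \<cdot> q = Zero C B Z" unfolding u(2) using M(1,2) u(1) by simp_all
    moreover have "\<exists>!v. \<guillemotleft>v : Q \<rightarrow> Z\<guillemotright> \<and> v \<cdot> r = Zero C A Z \<and> v \<cdot> q = Zero C B Z"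
      using u(1) po'(1-4) by (intro pushout_univ[OF po]) simp_all
    moreover have "\<guillemotleft>Zero C Q Z : Q \<rightarrow> Z\<guillemotright>" "Zero C Q Z \<cdot> r = Zero C A Z" "Zero C Q Z \<cdot> q = Zero C B Z"
      using u(1) po'(1-4) by simp_all
    ultimately show "u = Zero C Q Z" using u(1) by blast
  qed (use M po' R in simp_all)
  then have "cokernel_arrow C M Q R" by (auto simp: cokernel_arrow_def)
  then obtain P w q0 where q0: "cokernel_arrow C P B' q0" "\<guillemotleft>q0 : P \<rightarrow> B'\<guillemotright>"
      and w: "\<guillemotleft>w : P \<rightarrow> M\<guillemotright>" "R \<cdot> w = k1 \<cdot> q0"
    using cokernel_weak_pullback[OF _ k1'(1)] by blast
  have Rw: "R \<cdot> w = (r \<cdot> (p1 \<cdot> w)) \<boxplus> (q \<cdot> (p2 \<cdot> w))"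
    unfolding R_def using w(1) M(3,4) po'(3,4) by (simp add: plus_comp_dist)
  have "e \<cdot> (R \<cdot> w) = (e \<cdot> (r \<cdot> (p1 \<cdot> w))) \<boxplus> ((e \<cdot> q) \<cdot> (p2 \<cdot> w))"
    unfolding Rw using w(1) M(3,4) po'(3,4) e'(2) by (simp add: comp_plus_dist)
  then have "e \<cdot> (R \<cdot> w) = e \<cdot> (r \<cdot> (p1 \<cdot> w))"
    unfolding e'(3) using w(1) M(3,4) po'(3,4) e'(2) by simp
  moreover have "e \<cdot> (R \<cdot> w) = (e \<cdot> k1) \<cdot> q0" unfolding w(2) using k1'(1,2) q0(2) by simp
  ultimately have "e \<cdot> (r \<cdot> (p1 \<cdot> w)) = Zero C P E" unfolding k1'(3) using q0(2) k1' by simp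
  then obtain d where d: "\<guillemotleft>d : P \<rightarrow> D\<guillemotright>" "k \<cdot> d = p1 \<cdot> w"
    using ker_er[of "p1 \<cdot> w" P] w(1) M(3) by auto
  \<comment> \<open>\<open>q0\<close> factors through \<open>j\<close>: its first component comes from \<open>D\<close> and can be moved to \<open>B\<close> by \<open>r \<cdot> k = q \<cdot> g\<close>\<close>
  define y where "y = (g \<cdot> d) \<boxplus> (p2 \<cdot> w)"
  have y: "\<guillemotleft>y : P \<rightarrow> B\<guillemotright>" using d(1) w(1) M(4) po'(2) by (simp add: y_def)
  have "k1 \<cdot> q0 = ((r \<cdot> k) \<cdot> d) \<boxplus> (q \<cdot> (p2 \<cdot> w))"
    unfolding w(2)[symmetric] Rw d(2)[symmetric] using d(1) po'(1,3) by simp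
  also have "\<dots> = q \<cdot> y"
    unfolding po'(5) y_def using d(1) w(1) M(4) po'(2,4) by (simp add: comp_plus_dist)
  also have "\<dots> = k1 \<cdot> (j \<cdot> y)" unfolding j(2)[symmetric] using j(1) k1'(1) y by simp
  finally have "k1 \<cdot> q0 = k1 \<cdot> (j \<cdot> y)" .
  then have "q0 = j \<cdot> y"
    using kernel_monic[OF k1, of q0 P "j \<cdot> y"] q0(2) j(1) y by simp
  then have "cokernel_arrow C B B' j"
    using cokernel_arrow_left_factor[of P B' j y B] q0(1) y j(1) by simp
  then obtain Z s where s: "is_cokernel C Z B B' s j" by (auto simp: cokernel_arrow_def)
  note s' = is_cokernelD[OF s]
  \<comment> \<open>\<open>j\<close> is both monic and a cokernel, hence invertible\<close>
  have "s = Zero C Z B"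
  proof (rule monicD[OF q_monic po'(4) s'(1)])
    have "q \<cdot> s = k1 \<cdot> (j \<cdot> s)" unfolding j(2)[symmetric] using j(1) s'(1) k1'(1) by simp
    then show "q \<cdot> s = Zero C Z Q" unfolding s'(3) using k1' s'(1) by simp
  qed
  then obtain t where t: "\<guillemotleft>t : B' \<rightarrow> B\<guillemotright>" "t \<cdot> j = Idn C B"
    using cokernel_desc[OF s, of "Idn C B" B] s'(1) by auto
  have jt: "j \<cdot> t = Idn C B'"
    by (rule cokernel_epic[OF s, where A = B']) (use j(1) t in simp_all)
  have "is_kernel C B Q E q e"
  proof (rule is_kernelI[OF po'(4) e'(2,3)])
    fix A x assume x: "\<guillemotleft>x : A \<rightarrow> Q\<guillemotright>" "e \<cdot> x = Zero C A E"
    obtain v where v: "\<guillemotleft>v : A \<rightarrow> B'\<guillemotright>" "k1 \<cdot> v = x" using kernel_lift[OF k1 x] by blast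
    have "q \<cdot> (t \<cdot> v) = k1 \<cdot> ((j \<cdot> t) \<cdot> v)" unfolding j(2)[symmetric] using j(1) t(1) v(1) k1'(1) by simp
    then have "q \<cdot> (t \<cdot> v) = x" unfolding jt using v by simp
    then show "\<exists>u. \<guillemotleft>u : A \<rightarrow> B\<guillemotright> \<and> q \<cdot> u = x" using v(1) t(1) by (intro exI[of _ "t \<cdot> v"]) simp
  qed (rule monicD[OF q_monic po'(4)])
  then show ?thesis by (auto simp: kernel_arrow_def)
qed

theorem quasi_abelian: "quasi_abelian_category C"
proof
  fix X Y f assume "X \<in> Ob C" "Y \<in> Ob C" "f \<in> Hom C X Y"
  then have "\<guillemotleft>f : X \<rightarrow> Y\<guillemotright>" by (simp add: hom_iff_arr)
  then show "\<exists>K k. is_kernel C K X Y k f" "\<exists>Q c. is_cokernel C X Y Q f c"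
    using ex_kernel_weak_pushout ex_cokernel_weak_pullback by blast+
next
  fix P A B D p q f g
  assume pb: "is_pullback C P A B D p q f g" and c: "cokernel_arrow C A D f"
  have t: "\<guillemotleft>q : P \<rightarrow> B\<guillemotright>" "\<guillemotleft>g : B \<rightarrow> D\<guillemotright>" using pb unfolding is_pullback_def arr_def by simp_all
  obtain P' a q' where *: "cokernel_arrow C P' B q'" "\<guillemotleft>q' : P' \<rightarrow> B\<guillemotright>" "\<guillemotleft>a : P' \<rightarrow> A\<guillemotright>" "f \<cdot> a = g \<cdot> q'"
    using cokernel_weak_pullback[OF c t(2)] by blast
  then obtain u where "\<guillemotleft>u : P' \<rightarrow> P\<guillemotright>" "q \<cdot> u = q'"
    using pb unfolding is_pullback_def arr_def by blast
  then show "cokernel_arrow C P B q"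
    using cokernel_arrow_left_factor[of P' B q u P] * t by simp
next
  fix D A B P f g p q
  assume "is_pushout C D A B P f g p q" "kernel_arrow C D A f"
  then show "kernel_arrow C B P q" by (rule pushout_of_kernel)
qed

end

section \<open>Additive quotients of full subcategories\<close>

lemma hom_group_full: "hom_group (full_subcategory C \<X>) X Y = hom_group C X Y"
  by (simp add: hom_group_def full_subcategory_def)

text \<open>
  Only the groups \<open>J X Y\<close> with \<open>X, Y \<in> \<H>\<close> are constrained, so that \<open>J\<close> may be the ideal of maps
  factoring through objects outside \<open>\<H>\<close>.
\<close>

locale ideal_on_subcategory = preadditive_category C
  for C :: "('o, 'm, 'x) precat_scheme" (structure) +
  fixes \<H> :: "'o set" and J :: "'o \<Rightarrow> 'o \<Rightarrow> 'm set"
  assumes subcategory: "\<H> \<subseteq> Ob C"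
    and ideal_arr: "X \<in> \<H> \<Longrightarrow> Y \<in> \<H> \<Longrightarrow> f \<in> J X Y \<Longrightarrow> \<guillemotleft>f : X \<rightarrow> Y\<guillemotright>"
    and ideal_Zero: "X \<in> \<H> \<Longrightarrow> Y \<in> \<H> \<Longrightarrow> Zero C X Y \<in> J X Y"
    and ideal_diff: "X \<in> \<H> \<Longrightarrow> Y \<in> \<H> \<Longrightarrow> f \<in> J X Y \<Longrightarrow> g \<in> J X Y \<Longrightarrow> f \<boxminus> g \<in> J X Y"
    and ideal_comp_left: "X \<in> \<H> \<Longrightarrow> Y \<in> \<H> \<Longrightarrow> Z \<in> \<H> \<Longrightarrow> f \<in> J X Y \<Longrightarrow> \<guillemotleft>g : Y \<rightarrow> Z\<guillemotright> \<Longrightarrow> g \<cdot> f \<in> J X Z"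
    and ideal_comp_right: "X \<in> \<H> \<Longrightarrow> Y \<in> \<H> \<Longrightarrow> Z \<in> \<H> \<Longrightarrow> \<guillemotleft>f : X \<rightarrow> Y\<guillemotright> \<Longrightarrow> g \<in> J Y Z \<Longrightarrow> g \<cdot> f \<in> J X Z"
begin

abbreviation \<Q> :: "('o, 'm set) precat"
  where "\<Q> \<equiv> quotient_category (full_subcategory C \<H>) J"

definition cls :: "'m \<Rightarrow> 'm set"
  where "cls f = J (src f) (trg f) #>\<^bsub>hom_group C (src f) (trg f)\<^esub> f"

lemma in_Ob [simp]: "X \<in> \<H> \<Longrightarrow> X \<in> Ob C"
  using subcategory by blast

lemma ideal_type [simp]:
  assumes "f \<in> J X Y" "X \<in> \<H>" "Y \<in> \<H>"
  shows "Arr f" "src f = X" "trg f = Y"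
  using ideal_arr[OF assms(2,3,1)] by simp_all

lemma ideal_neg:
  assumes "X \<in> \<H>" "Y \<in> \<H>" "f \<in> J X Y"
  shows "neg f \<in> J X Y"
  using ideal_diff[OF assms(1,2) ideal_Zero[OF assms(1,2)] assms(3)] ideal_arr[OF assms] assms
  by (simp add: diff_def)

lemma ideal_plus:
  assumes "X \<in> \<H>" "Y \<in> \<H>" "f \<in> J X Y" "g \<in> J X Y"
  shows "f \<boxplus> g \<in> J X Y"
  using ideal_diff[OF assms(1-3) ideal_neg[OF assms(1,2,4)]] ideal_arr[OF assms(1,2,4)]
  by (simp add: diff_def)

lemma ideal_subgroup:
  assumes "X \<in> \<H>" "Y \<in> \<H>"
  shows "subgroup (J X Y) (hom_group C X Y)"
proof -
  have XY: "X \<in> Ob C" "Y \<in> Ob C" using assms by simp_all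
  interpret G: comm_group "hom_group C X Y" using XY by (rule hom_comm_group)
  have inv: "inv\<^bsub>hom_group C X Y\<^esub> f = neg f" if "f \<in> J X Y" for f
    using ideal_arr[OF assms that] by (simp add: neg_def)
  show ?thesis
  proof (rule G.subgroupI)
    show "J X Y \<subseteq> carrier (hom_group C X Y)"
      using ideal_arr[OF assms] XY by (auto simp: hom_group_def hom_iff_arr)
    show "J X Y \<noteq> {}" using ideal_Zero[OF assms] by blast
    show "inv\<^bsub>hom_group C X Y\<^esub> f \<in> J X Y" if "f \<in> J X Y" for f
      using inv[OF that] ideal_neg[OF assms that] by simp
    show "f \<otimes>\<^bsub>hom_group C X Y\<^esub> g \<in> J X Y" if "f \<in> J X Y" "g \<in> J X Y" for f g
      using ideal_plus[OF assms that] by (simp add: hom_group_def)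
  qed
qed

lemma cls_eq_iff:
  assumes "\<guillemotleft>f : X \<rightarrow> Y\<guillemotright>" "\<guillemotleft>g : X \<rightarrow> Y\<guillemotright>" "X \<in> \<H>" "Y \<in> \<H>"
  shows "cls f = cls g \<longleftrightarrow> f \<boxminus> g \<in> J X Y"
proof -
  interpret G: comm_group "hom_group C X Y" using assms by (intro hom_comm_group) simp_all
  note sub = ideal_subgroup[OF assms(3,4)]
  have mem: "f \<in> carrier (hom_group C X Y)" "g \<in> carrier (hom_group C X Y)"
    using assms(1,2) by (simp_all add: hom_group_def arr_def del: arr_iff)
  have "cls f = cls g \<longleftrightarrow> f \<in> cls g"
    using G.repr_independence[OF _ mem(2) sub, of f] G.rcos_self[OF mem(1) sub] assms
    by (auto simp: cls_def)
  also have "\<dots> \<longleftrightarrow> f \<boxminus> g \<in> J X Y"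
    using subgroup.rcos_module[OF sub G.is_group mem(2,1)] assms
    by (simp add: cls_def diff_def neg_def) (simp add: hom_group_def)
  finally show ?thesis .
qed

lemma cls_self:
  assumes "\<guillemotleft>f : X \<rightarrow> Y\<guillemotright>" "X \<in> \<H>" "Y \<in> \<H>"
  shows "f \<in> cls f"
proof -
  interpret G: comm_group "hom_group C X Y" using assms by (intro hom_comm_group) simp_all
  have "f \<in> carrier (hom_group C X Y)" using assms(1) by (simp add: hom_group_def arr_def del: arr_iff)
  from G.rcos_self[OF this ideal_subgroup[OF assms(2,3)]] show ?thesis using assms by (simp add: cls_def)
qed

lemma cls_memD:
  assumes "\<guillemotleft>f : X \<rightarrow> Y\<guillemotright>" "X \<in> \<H>" "Y \<in> \<H>" "g \<in> cls f"
  shows "\<guillemotleft>g : X \<rightarrow> Y\<guillemotright>" "cls g = cls f"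
proof -
  interpret G: comm_group "hom_group C X Y" using assms by (intro hom_comm_group) simp_all
  note sub = ideal_subgroup[OF assms(2,3)]
  have f: "f \<in> carrier (hom_group C X Y)" using assms(1) by (simp add: hom_group_def arr_def del: arr_iff)
  have g: "g \<in> J X Y #>\<^bsub>hom_group C X Y\<^esub> f" using assms by (simp add: cls_def)
  show t: "\<guillemotleft>g : X \<rightarrow> Y\<guillemotright>"
    using subgroup.elemrcos_carrier[OF sub G.is_group f g] assms
    by (simp add: hom_group_def hom_iff_arr)
  show "cls g = cls f"
    using G.repr_independence[OF g f sub] t assms(1) by (simp add: cls_def)
qed

lemma Ob_quotient [simp]: "Ob \<Q> = \<H>"
  by (simp add: quotient_category_def full_subcategory_def)

lemma carrier_hom_group: "carrier (hom_group C X Y) = Hom C X Y"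
  by (simp add: hom_group_def)

lemma hom_quotient_iff:
  assumes "X \<in> \<H>" "Y \<in> \<H>"
  shows "F \<in> Hom \<Q> X Y \<longleftrightarrow> (\<exists>f. \<guillemotleft>f : X \<rightarrow> Y\<guillemotright> \<and> F = cls f)"
proof -
  have "Hom \<Q> X Y = (\<Union>f \<in> Hom C X Y. {J X Y #>\<^bsub>hom_group C X Y\<^esub> f})"
    by (simp add: quotient_category_def hom_group_full RCOSETS_def carrier_hom_group)
  then show ?thesis
    using assms by (auto simp: cls_def hom_iff_arr)
qed

lemma cls_in_hom: "\<guillemotleft>f : X \<rightarrow> Y\<guillemotright> \<Longrightarrow> X \<in> \<H> \<Longrightarrow> Y \<in> \<H> \<Longrightarrow> cls f \<in> Hom \<Q> X Y"
  using hom_quotient_iff by blast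

lemma Zero_quotient:
  assumes "X \<in> \<H>" "Y \<in> \<H>"
  shows "Zero \<Q> X Y = cls (Zero C X Y)"
proof -
  interpret G: comm_group "hom_group C X Y" using assms by (intro hom_comm_group) simp_all
  have "J X Y #>\<^bsub>hom_group C X Y\<^esub> Zero C X Y = J X Y"
    using subgroup.rcos_const[OF ideal_subgroup[OF assms] G.is_group, of "Zero C X Y"] ideal_Zero[OF assms]
    by simp
  then show ?thesis using assms by (simp add: cls_def quotient_category_def)
qed

lemma cls_eq_Zero_iff:
  assumes "\<guillemotleft>f : X \<rightarrow> Y\<guillemotright>" "X \<in> \<H>" "Y \<in> \<H>"
  shows "cls f = Zero \<Q> X Y \<longleftrightarrow> f \<in> J X Y"
  using assms cls_eq_iff[OF assms(1) _ assms(2,3), of "Zero C X Y"] by (simp add: Zero_quotient)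

lemma Idn_quotient:
  assumes "X \<in> \<H>"
  shows "Idn \<Q> X = cls (Idn C X)"
  using assms by (simp add: cls_def quotient_category_def full_subcategory_def hom_group_def)

text \<open>The \<open>Hom\<close>-groups are quotient groups, which supplies the group axioms.\<close>

lemma hom_group_quotient:
  "hom_group \<Q> X Y = hom_group C X Y Mod J X Y"
proof -
  have "Plus \<Q> = set_mult (hom_group C X Y)"
    by (intro ext) (auto simp: quotient_category_def full_subcategory_def set_mult_def hom_group_def)
  moreover have "Hom \<Q> X Y = rcosets\<^bsub>hom_group C X Y\<^esub> J X Y" "Zero \<Q> X Y = J X Y"
    by (simp_all add: quotient_category_def hom_group_full)
  ultimately show ?thesis by (simp add: hom_group_def[of \<Q>] FactGroup_def)
qed

lemma Plus_quotient:
  assumes "\<guillemotleft>f : X \<rightarrow> Y\<guillemotright>" "\<guillemotleft>g : X \<rightarrow> Y\<guillemotright>" "X \<in> \<H>" "Y \<in> \<H>"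
  shows "cls f \<boxplus>\<^bsub>\<Q>\<^esub> cls g = cls (f \<boxplus> g)"
proof -
  interpret G: comm_group "hom_group C X Y" using assms by (intro hom_comm_group) simp_all
  have N: "J X Y \<lhd> hom_group C X Y"
    by (rule G.subgroup_imp_normal[OF ideal_subgroup[OF assms(3,4)]])
  have "cls f \<boxplus>\<^bsub>\<Q>\<^esub> cls g = cls f <#>\<^bsub>hom_group C X Y\<^esub> cls g"
    by (auto simp: quotient_category_def full_subcategory_def set_mult_def hom_group_def)
  also have "\<dots> = cls (f \<boxplus> g)"
    using normal.rcos_sum[OF N, of f g] assms
    by (simp add: cls_def) (simp add: hom_group_def hom_iff_arr)
  finally show ?thesis .
qed

text \<open>
  Composition of cosets is a union over all representatives with all possible endpoints. Disjointness
  of the \<open>Hom\<close>-sets fixes the endpoints, and the ideal property makes all members of the union equal.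
\<close>

lemma Comp_quotient:
  assumes "\<guillemotleft>f : X \<rightarrow> Y\<guillemotright>" "\<guillemotleft>g : Y \<rightarrow> Z\<guillemotright>" "X \<in> \<H>" "Y \<in> \<H>" "Z \<in> \<H>"
  shows "cls g \<cdot>\<^bsub>\<Q>\<^esub> cls f = cls (g \<cdot> f)"
proof -
  let ?S = "{J X' Z' #>\<^bsub>hom_group C X' Z'\<^esub> (g' \<cdot> f') | X' Y' Z' f' g'.
    X' \<in> \<H> \<and> Y' \<in> \<H> \<and> Z' \<in> \<H> \<and> f' \<in> cls f \<inter> Hom C X' Y' \<and> g' \<in> cls g \<inter> Hom C Y' Z'}"
  have eq: "cls (g' \<cdot> f') = cls (g \<cdot> f)" if "f' \<in> cls f" "g' \<in> cls g" for f' g'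
  proof -
    note f' = cls_memD[OF assms(1,3,4) that(1)] and g' = cls_memD[OF assms(2,4,5) that(2)]
    have "f' \<boxminus> f \<in> J X Y" "g' \<boxminus> g \<in> J Y Z"
      using cls_eq_iff[OF f'(1) assms(1,3,4)] cls_eq_iff[OF g'(1) assms(2,4,5)] f' g' by simp_all
    then have "g' \<cdot> (f' \<boxminus> f) \<in> J X Z" "(g' \<boxminus> g) \<cdot> f \<in> J X Z"
      using ideal_comp_left[OF assms(3-5)] ideal_comp_right[OF assms(3-5)] assms f'(1) g'(1) by blast+
    then have "(g' \<cdot> f') \<boxminus> (g' \<cdot> f) \<in> J X Z" "(g' \<cdot> f) \<boxminus> (g \<cdot> f) \<in> J X Z"
      using assms f'(1) g'(1) by (simp_all add: comp_diff diff_comp)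
    then show ?thesis
      using cls_eq_iff[of "g' \<cdot> f'" X Z "g' \<cdot> f"] cls_eq_iff[of "g' \<cdot> f" X Z "g \<cdot> f"] assms f'(1) g'(1)
      by simp
  qed
  have "?S = {cls (g \<cdot> f)}"
  proof (intro equalityI subsetI)
    fix U assume "U \<in> ?S"
    then obtain X' Y' Z' f' g' where U: "U = J X' Z' #>\<^bsub>hom_group C X' Z'\<^esub> (g' \<cdot> f')"
        "X' \<in> \<H>" "Y' \<in> \<H>" "Z' \<in> \<H>" "f' \<in> cls f" "f' \<in> Hom C X' Y'" "g' \<in> cls g" "g' \<in> Hom C Y' Z'"
      by blast
    have "\<guillemotleft>f' : X' \<rightarrow> Y'\<guillemotright>" "\<guillemotleft>g' : Y' \<rightarrow> Z'\<guillemotright>" using U by (simp_all add: hom_iff_arr)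
    then have "U = cls (g' \<cdot> f')" unfolding U(1) by (simp add: cls_def)
    then show "U \<in> {cls (g \<cdot> f)}" using eq[OF U(5,7)] by simp
  next
    fix U assume "U \<in> {cls (g \<cdot> f)}"
    then have "U = J X Z #>\<^bsub>hom_group C X Z\<^esub> (g \<cdot> f)" using assms by (simp add: cls_def)
    moreover have "f \<in> cls f \<inter> Hom C X Y" "g \<in> cls g \<inter> Hom C Y Z"
      using cls_self assms by (simp_all add: hom_iff_arr)
    ultimately show "U \<in> ?S" using assms(3-5) by blast
  qed
  moreover have "cls g \<cdot>\<^bsub>\<Q>\<^esub> cls f = \<Union> ?S"
    by (simp add: quotient_category_def full_subcategory_def hom_group_def)
  ultimately show ?thesis by simp
qed

text \<open>The same equations with side conditions that rewriting can discharge.\<close>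

lemma Plus_cls:
  "Arr f \<Longrightarrow> Arr g \<Longrightarrow> src f = src g \<Longrightarrow> trg f = trg g \<Longrightarrow> src g \<in> \<H> \<Longrightarrow> trg g \<in> \<H> \<Longrightarrow>
    cls f \<boxplus>\<^bsub>\<Q>\<^esub> cls g = cls (f \<boxplus> g)"
  by (rule Plus_quotient[where X = "src g" and Y = "trg g"]) simp_all

lemma Comp_cls:
  "Arr f \<Longrightarrow> Arr g \<Longrightarrow> trg f = src g \<Longrightarrow> src f \<in> \<H> \<Longrightarrow> src g \<in> \<H> \<Longrightarrow> trg g \<in> \<H> \<Longrightarrow>
    cls g \<cdot>\<^bsub>\<Q>\<^esub> cls f = cls (g \<cdot> f)"
  by (rule Comp_quotient[where X = "src f" and Y = "src g" and Z = "trg g"]) simp_all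

lemma quotient_preadditive: "preadditive_category \<Q>"
proof (rule preadditive_category.intro)
  fix X Y X' Y' F
  assume XY: "X \<in> Ob \<Q>" "Y \<in> Ob \<Q>" "X' \<in> Ob \<Q>" "Y' \<in> Ob \<Q>" "F \<in> Hom \<Q> X Y" "F \<in> Hom \<Q> X' Y'"
  then obtain f f' where f: "\<guillemotleft>f : X \<rightarrow> Y\<guillemotright>" "F = cls f" "\<guillemotleft>f' : X' \<rightarrow> Y'\<guillemotright>" "F = cls f'"
    by (auto simp: hom_quotient_iff simp del: arr_iff)
  then have "f' \<in> cls f" using cls_self XY by auto
  then have "\<guillemotleft>f' : X \<rightarrow> Y\<guillemotright>" using cls_memD(1)[OF f(1)] XY by simp
  then show "X = X' \<and> Y = Y'" using f(3) by simp
next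
  fix X Y assume "X \<in> Ob \<Q>" "Y \<in> Ob \<Q>"
  then have XY: "X \<in> \<H>" "Y \<in> \<H>" by simp_all
  interpret G: comm_group "hom_group C X Y" using XY by (intro hom_comm_group) simp_all
  show "comm_group (hom_group \<Q> X Y)"
    unfolding hom_group_quotient by (rule G.abelian_FactGroup[OF ideal_subgroup[OF XY]])
next
  fix X assume "X \<in> Ob \<Q>"
  then show "Idn \<Q> X \<in> Hom \<Q> X X" by (simp add: Idn_quotient cls_in_hom)
next
  fix X Y Z F G assume "X \<in> Ob \<Q>" "Y \<in> Ob \<Q>" "Z \<in> Ob \<Q>" "F \<in> Hom \<Q> X Y" "G \<in> Hom \<Q> Y Z"
  then obtain f g where "\<guillemotleft>f : X \<rightarrow> Y\<guillemotright>" "F = cls f" "\<guillemotleft>g : Y \<rightarrow> Z\<guillemotright>" "G = cls g" "X \<in> \<H>" "Y \<in> \<H>" "Z \<in> \<H>"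
    by (auto simp: hom_quotient_iff simp del: arr_iff)
  then show "G \<cdot>\<^bsub>\<Q>\<^esub> F \<in> Hom \<Q> X Z"
    by (simp add: Comp_cls cls_in_hom)
next
  fix X Y F assume "X \<in> Ob \<Q>" "Y \<in> Ob \<Q>" "F \<in> Hom \<Q> X Y"
  then show "F \<cdot>\<^bsub>\<Q>\<^esub> Idn \<Q> X = F" "Idn \<Q> Y \<cdot>\<^bsub>\<Q>\<^esub> F = F"
    by (auto simp: hom_quotient_iff Idn_quotient Comp_cls)
next
  fix X Y Z A F G K
  assume "X \<in> Ob \<Q>" "Y \<in> Ob \<Q>" "Z \<in> Ob \<Q>" "A \<in> Ob \<Q>"
    "F \<in> Hom \<Q> X Y" "G \<in> Hom \<Q> Y Z" "K \<in> Hom \<Q> Z A"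
  then show "(K \<cdot>\<^bsub>\<Q>\<^esub> G) \<cdot>\<^bsub>\<Q>\<^esub> F = K \<cdot>\<^bsub>\<Q>\<^esub> (G \<cdot>\<^bsub>\<Q>\<^esub> F)"
    by (auto simp: hom_quotient_iff Comp_cls)
next
  fix X Y Z F F' G
  assume "X \<in> Ob \<Q>" "Y \<in> Ob \<Q>" "Z \<in> Ob \<Q>" "F \<in> Hom \<Q> X Y" "F' \<in> Hom \<Q> X Y" "G \<in> Hom \<Q> Y Z"
  then show "G \<cdot>\<^bsub>\<Q>\<^esub> (F \<boxplus>\<^bsub>\<Q>\<^esub> F') = (G \<cdot>\<^bsub>\<Q>\<^esub> F) \<boxplus>\<^bsub>\<Q>\<^esub> (G \<cdot>\<^bsub>\<Q>\<^esub> F')"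
    by (auto simp: hom_quotient_iff Comp_cls Plus_cls comp_plus_dist)
next
  fix X Y Z F G G'
  assume "X \<in> Ob \<Q>" "Y \<in> Ob \<Q>" "Z \<in> Ob \<Q>" "F \<in> Hom \<Q> X Y" "G \<in> Hom \<Q> Y Z" "G' \<in> Hom \<Q> Y Z"
  then show "(G \<boxplus>\<^bsub>\<Q>\<^esub> G') \<cdot>\<^bsub>\<Q>\<^esub> F = (G \<cdot>\<^bsub>\<Q>\<^esub> F) \<boxplus>\<^bsub>\<Q>\<^esub> (G' \<cdot>\<^bsub>\<Q>\<^esub> F)"
    by (auto simp: hom_quotient_iff Comp_cls Plus_cls plus_comp_dist)
qed


lemma arr_quotient_iff:
  "preadditive_category.arr \<Q> F X Y \<longleftrightarrow> X \<in> \<H> \<and> Y \<in> \<H> \<and> (\<exists>f. \<guillemotleft>f : X \<rightarrow> Y\<guillemotright> \<and> F = cls f)"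
  using hom_quotient_iff[of X Y F]
  by (auto simp: preadditive_category.arr_def[OF quotient_preadditive] simp del: arr_iff)

lemma arr_cls:
  "\<guillemotleft>f : X \<rightarrow> Y\<guillemotright> \<Longrightarrow> X \<in> \<H> \<Longrightarrow> Y \<in> \<H> \<Longrightarrow> preadditive_category.arr \<Q> (cls f) X Y"
  unfolding arr_quotient_iff by blast

text \<open>
  Kernels, cokernels and monics of the quotient, expressed by representatives. Factorizations
  are demanded on the nose, as triangles provide them, while uniqueness holds modulo \<open>J\<close>.
\<close>

definition kernel_mod :: "'o \<Rightarrow> 'o \<Rightarrow> 'o \<Rightarrow> 'm \<Rightarrow> 'm \<Rightarrow> bool"
  where "kernel_mod K X Y k f \<longleftrightarrow> K \<in> \<H> \<and> X \<in> \<H> \<and> Y \<in> \<H> \<and>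
    \<guillemotleft>k : K \<rightarrow> X\<guillemotright> \<and> \<guillemotleft>f : X \<rightarrow> Y\<guillemotright> \<and> f \<cdot> k \<in> J K Y \<and>
    (\<forall>A \<in> \<H>. \<forall>g. \<guillemotleft>g : A \<rightarrow> X\<guillemotright> \<and> f \<cdot> g \<in> J A Y \<longrightarrow> (\<exists>u. \<guillemotleft>u : A \<rightarrow> K\<guillemotright> \<and> k \<cdot> u = g)) \<and>
    (\<forall>A \<in> \<H>. \<forall>u. \<guillemotleft>u : A \<rightarrow> K\<guillemotright> \<and> k \<cdot> u \<in> J A X \<longrightarrow> u \<in> J A K)"

definition cokernel_mod :: "'o \<Rightarrow> 'o \<Rightarrow> 'o \<Rightarrow> 'm \<Rightarrow> 'm \<Rightarrow> bool"
  where "cokernel_mod X Y Q f c \<longleftrightarrow> X \<in> \<H> \<and> Y \<in> \<H> \<and> Q \<in> \<H> \<and>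
    \<guillemotleft>f : X \<rightarrow> Y\<guillemotright> \<and> \<guillemotleft>c : Y \<rightarrow> Q\<guillemotright> \<and> c \<cdot> f \<in> J X Q \<and>
    (\<forall>A \<in> \<H>. \<forall>g. \<guillemotleft>g : Y \<rightarrow> A\<guillemotright> \<and> g \<cdot> f \<in> J X A \<longrightarrow> (\<exists>u. \<guillemotleft>u : Q \<rightarrow> A\<guillemotright> \<and> u \<cdot> c = g)) \<and>
    (\<forall>A \<in> \<H>. \<forall>u. \<guillemotleft>u : Q \<rightarrow> A\<guillemotright> \<and> u \<cdot> c \<in> J Y A \<longrightarrow> u \<in> J Q A)"

definition monic_mod :: "'o \<Rightarrow> 'o \<Rightarrow> 'm \<Rightarrow> bool"
  where "monic_mod X Y f \<longleftrightarrow> X \<in> \<H> \<and> Y \<in> \<H> \<and> \<guillemotleft>f : X \<rightarrow> Y\<guillemotright> \<and>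
    (\<forall>A \<in> \<H>. \<forall>u. \<guillemotleft>u : A \<rightarrow> X\<guillemotright> \<and> f \<cdot> u \<in> J A Y \<longrightarrow> u \<in> J A X)"

lemma comp_cls_Zero_iff:
  assumes "\<guillemotleft>f : X \<rightarrow> Y\<guillemotright>" "\<guillemotleft>g : Y \<rightarrow> Z\<guillemotright>" "X \<in> \<H>" "Y \<in> \<H>" "Z \<in> \<H>"
  shows "cls g \<cdot>\<^bsub>\<Q>\<^esub> cls f = Zero \<Q> X Z \<longleftrightarrow> g \<cdot> f \<in> J X Z"
  using cls_eq_Zero_iff[of "g \<cdot> f" X Z] assms by (simp add: Comp_quotient[OF assms])

lemma is_kernel_quotient:
  assumes "kernel_mod K X Y k f"
  shows "is_kernel \<Q> K X Y (cls k) (cls f)"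
proof -
  have H: "K \<in> \<H>" "X \<in> \<H>" "Y \<in> \<H>" and k: "\<guillemotleft>k : K \<rightarrow> X\<guillemotright>" and f: "\<guillemotleft>f : X \<rightarrow> Y\<guillemotright>" and fk: "f \<cdot> k \<in> J K Y"
    and lift: "\<And>A g. A \<in> \<H> \<Longrightarrow> \<guillemotleft>g : A \<rightarrow> X\<guillemotright> \<Longrightarrow> f \<cdot> g \<in> J A Y \<Longrightarrow> \<exists>u. \<guillemotleft>u : A \<rightarrow> K\<guillemotright> \<and> k \<cdot> u = g"
    and monic: "\<And>A u. A \<in> \<H> \<Longrightarrow> \<guillemotleft>u : A \<rightarrow> K\<guillemotright> \<Longrightarrow> k \<cdot> u \<in> J A X \<Longrightarrow> u \<in> J A K"
    using assms unfolding kernel_mod_def by blast+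
  show ?thesis
  proof (rule preadditive_category.is_kernelI[OF quotient_preadditive arr_cls[OF k H(1,2)] arr_cls[OF f H(2,3)]])
    show "cls f \<cdot>\<^bsub>\<Q>\<^esub> cls k = Zero \<Q> K Y" using comp_cls_Zero_iff[OF k f H] fk by blast
  next
    fix A G assume "preadditive_category.arr \<Q> G A X" and G: "cls f \<cdot>\<^bsub>\<Q>\<^esub> G = Zero \<Q> A Y"
    then obtain g where g: "A \<in> \<H>" "\<guillemotleft>g : A \<rightarrow> X\<guillemotright>" "G = cls g" unfolding arr_quotient_iff by blast
    with G have "f \<cdot> g \<in> J A Y" using comp_cls_Zero_iff[OF g(2) f g(1) H(2,3)] by simp
    then obtain u where u: "\<guillemotleft>u : A \<rightarrow> K\<guillemotright>" "k \<cdot> u = g" using lift g by blast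
    then have "cls k \<cdot>\<^bsub>\<Q>\<^esub> cls u = G" unfolding Comp_quotient[OF u(1) k g(1) H(1,2)] g(3) by simp
    then show "\<exists>U. preadditive_category.arr \<Q> U A K \<and> cls k \<cdot>\<^bsub>\<Q>\<^esub> U = G"
      using arr_cls[OF u(1) g(1) H(1)] by blast
  next
    fix A U assume "preadditive_category.arr \<Q> U A K" and U: "cls k \<cdot>\<^bsub>\<Q>\<^esub> U = Zero \<Q> A X"
    then obtain u where u: "A \<in> \<H>" "\<guillemotleft>u : A \<rightarrow> K\<guillemotright>" "U = cls u" unfolding arr_quotient_iff by blast
    with U have "k \<cdot> u \<in> J A X" using comp_cls_Zero_iff[OF u(2) k u(1) H(1,2)] by simp
    then have "u \<in> J A K" using monic u by blast
    then show "U = Zero \<Q> A K" unfolding u(3) using cls_eq_Zero_iff[OF u(2,1) H(1)] by blast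
  qed
qed

lemma is_cokernel_quotient:
  assumes "cokernel_mod X Y Q f c"
  shows "is_cokernel \<Q> X Y Q (cls f) (cls c)"
proof -
  have H: "X \<in> \<H>" "Y \<in> \<H>" "Q \<in> \<H>" and f: "\<guillemotleft>f : X \<rightarrow> Y\<guillemotright>" and c: "\<guillemotleft>c : Y \<rightarrow> Q\<guillemotright>" and cf: "c \<cdot> f \<in> J X Q"
    and desc: "\<And>A g. A \<in> \<H> \<Longrightarrow> \<guillemotleft>g : Y \<rightarrow> A\<guillemotright> \<Longrightarrow> g \<cdot> f \<in> J X A \<Longrightarrow> \<exists>u. \<guillemotleft>u : Q \<rightarrow> A\<guillemotright> \<and> u \<cdot> c = g"
    and epic: "\<And>A u. A \<in> \<H> \<Longrightarrow> \<guillemotleft>u : Q \<rightarrow> A\<guillemotright> \<Longrightarrow> u \<cdot> c \<in> J Y A \<Longrightarrow> u \<in> J Q A"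
    using assms unfolding cokernel_mod_def by blast+
  show ?thesis
  proof (rule preadditive_category.is_cokernelI[OF quotient_preadditive arr_cls[OF f H(1,2)] arr_cls[OF c H(2,3)]])
    show "cls c \<cdot>\<^bsub>\<Q>\<^esub> cls f = Zero \<Q> X Q" using comp_cls_Zero_iff[OF f c H] cf by blast
  next
    fix A G assume "preadditive_category.arr \<Q> G Y A" and G: "G \<cdot>\<^bsub>\<Q>\<^esub> cls f = Zero \<Q> X A"
    then obtain g where g: "A \<in> \<H>" "\<guillemotleft>g : Y \<rightarrow> A\<guillemotright>" "G = cls g" unfolding arr_quotient_iff by blast
    with G have "g \<cdot> f \<in> J X A" using comp_cls_Zero_iff[OF f g(2) H(1,2) g(1)] by simp
    then obtain u where u: "\<guillemotleft>u : Q \<rightarrow> A\<guillemotright>" "u \<cdot> c = g" using desc g by blast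
    then have "cls u \<cdot>\<^bsub>\<Q>\<^esub> cls c = G" unfolding Comp_quotient[OF c u(1) H(2,3) g(1)] g(3) by simp
    then show "\<exists>U. preadditive_category.arr \<Q> U Q A \<and> U \<cdot>\<^bsub>\<Q>\<^esub> cls c = G"
      using arr_cls[OF u(1) H(3) g(1)] by blast
  next
    fix A U assume "preadditive_category.arr \<Q> U Q A" and U: "U \<cdot>\<^bsub>\<Q>\<^esub> cls c = Zero \<Q> Y A"
    then obtain u where u: "A \<in> \<H>" "\<guillemotleft>u : Q \<rightarrow> A\<guillemotright>" "U = cls u" unfolding arr_quotient_iff by blast
    with U have "u \<cdot> c \<in> J Y A" using comp_cls_Zero_iff[OF c u(2) H(2,3) u(1)] by simp
    then have "u \<in> J Q A" using epic u by blast
    then show "U = Zero \<Q> Q A" unfolding u(3) using cls_eq_Zero_iff[OF u(2) H(3) u(1)] by blast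
  qed
qed

lemma monic_quotient:
  assumes "monic_mod X Y f"
  shows "preadditive_category.monic \<Q> (cls f)"
proof -
  have H: "X \<in> \<H>" "Y \<in> \<H>" and f: "\<guillemotleft>f : X \<rightarrow> Y\<guillemotright>"
    and monic: "\<And>A u. A \<in> \<H> \<Longrightarrow> \<guillemotleft>u : A \<rightarrow> X\<guillemotright> \<Longrightarrow> f \<cdot> u \<in> J A Y \<Longrightarrow> u \<in> J A X"
    using assms unfolding monic_mod_def by blast+
  show ?thesis
  proof (rule preadditive_category.monicI[OF quotient_preadditive arr_cls[OF f H]])
    fix A U assume "preadditive_category.arr \<Q> U A X" and U: "cls f \<cdot>\<^bsub>\<Q>\<^esub> U = Zero \<Q> A Y"
    then obtain u where u: "A \<in> \<H>" "\<guillemotleft>u : A \<rightarrow> X\<guillemotright>" "U = cls u" unfolding arr_quotient_iff by blast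
    with U have "f \<cdot> u \<in> J A Y" using comp_cls_Zero_iff[OF u(2) f u(1) H] by simp
    then have "u \<in> J A X" using monic u by blast
    then show "U = Zero \<Q> A X" unfolding u(3) using cls_eq_Zero_iff[OF u(2,1) H(1)] by blast
  qed
qed

lemma zero_object_quotient:
  assumes "zero_object C Z" "Z \<in> \<H>"
  shows "zero_object \<Q> Z"
proof -
  have "\<exists>!F. F \<in> Hom \<Q> X Z" "\<exists>!F. F \<in> Hom \<Q> Z X" if X: "X \<in> \<H>" for X
  proof -
    have "\<exists>!f. f \<in> Hom C X Z" "\<exists>!f. f \<in> Hom C Z X"
      using assms X unfolding zero_object_def by auto
    then have "\<exists>!f. \<guillemotleft>f : X \<rightarrow> Z\<guillemotright>" "\<exists>!f. \<guillemotleft>f : Z \<rightarrow> X\<guillemotright>"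
      using assms X unfolding arr_def by auto
    then show "\<exists>!F. F \<in> Hom \<Q> X Z" "\<exists>!F. F \<in> Hom \<Q> Z X"
      unfolding hom_quotient_iff[OF X assms(2)] hom_quotient_iff[OF assms(2) X] by metis+
  qed
  then show ?thesis using assms(2) by (simp add: zero_object_def)
qed

lemma direct_sum_quotient:
  assumes "direct_sum C A B P" "A \<in> \<H>" "B \<in> \<H>" "P \<in> \<H>"
  shows "direct_sum \<Q> A B P"
proof -
  obtain i j p q where t: "\<guillemotleft>i : A \<rightarrow> P\<guillemotright>" "\<guillemotleft>j : B \<rightarrow> P\<guillemotright>" "\<guillemotleft>p : P \<rightarrow> A\<guillemotright>" "\<guillemotleft>q : P \<rightarrow> B\<guillemotright>"
    and e: "p \<cdot> i = Idn C A" "q \<cdot> j = Idn C B" "p \<cdot> j = Zero C B A" "q \<cdot> i = Zero C A B"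
      "(i \<cdot> p) \<boxplus> (j \<cdot> q) = Idn C P"
    using assms(1) unfolding direct_sum_def by (elim conjE bexE) (simp add: hom_iff_arr del: arr_iff)
  note H = assms(2-4)
  have "(cls i \<cdot>\<^bsub>\<Q>\<^esub> cls p) \<boxplus>\<^bsub>\<Q>\<^esub> (cls j \<cdot>\<^bsub>\<Q>\<^esub> cls q) = Idn \<Q> P"
    using Comp_quotient[OF t(3,1)] Comp_quotient[OF t(4,2)] Plus_quotient[of "i \<cdot> p" P P "j \<cdot> q"] t H e(5)
    by (simp add: Idn_quotient)
  moreover have "cls p \<cdot>\<^bsub>\<Q>\<^esub> cls i = Idn \<Q> A" "cls q \<cdot>\<^bsub>\<Q>\<^esub> cls j = Idn \<Q> B"
      "cls p \<cdot>\<^bsub>\<Q>\<^esub> cls j = Zero \<Q> B A" "cls q \<cdot>\<^bsub>\<Q>\<^esub> cls i = Zero \<Q> A B"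
    using Comp_quotient[OF t(1,3)] Comp_quotient[OF t(2,4)] Comp_quotient[OF t(2,3)] Comp_quotient[OF t(1,4)] H e
    by (simp_all add: Idn_quotient Zero_quotient)
  moreover have "cls i \<in> Hom \<Q> A P" "cls j \<in> Hom \<Q> B P" "cls p \<in> Hom \<Q> P A" "cls q \<in> Hom \<Q> P B"
    using t H hom_quotient_iff by blast+
  ultimately show ?thesis unfolding direct_sum_def Ob_quotient using H by blast
qed

text \<open>The criterion of the previous section, stated for representatives.\<close>

theorem quotient_quasi_abelian:
  assumes zero: "zero_object C Z" "Z \<in> \<H>"
    and sum: "\<And>A B. A \<in> \<H> \<Longrightarrow> B \<in> \<H> \<Longrightarrow> \<exists>P \<in> \<H>. direct_sum C A B P"
    and coker: "\<And>X A f. X \<in> \<H> \<Longrightarrow> A \<in> \<H> \<Longrightarrow> \<guillemotleft>f : X \<rightarrow> A\<guillemotright> \<Longrightarrow> \<exists>D c. cokernel_mod X A D f c \<and>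
      (\<forall>B \<in> \<H>. \<forall>g. \<guillemotleft>g : B \<rightarrow> D\<guillemotright> \<longrightarrow> (\<exists>R s P q a. cokernel_mod R P B s q \<and> \<guillemotleft>a : P \<rightarrow> A\<guillemotright> \<and> c \<cdot> a = g \<cdot> q))"
    and ker: "\<And>A Y f. A \<in> \<H> \<Longrightarrow> Y \<in> \<H> \<Longrightarrow> \<guillemotleft>f : A \<rightarrow> Y\<guillemotright> \<Longrightarrow> \<exists>K k. kernel_mod K A Y k f \<and>
      (\<forall>B \<in> \<H>. \<forall>g. \<guillemotleft>g : K \<rightarrow> B\<guillemotright> \<longrightarrow>
        (\<exists>P q a. monic_mod B P q \<and> \<guillemotleft>a : A \<rightarrow> P\<guillemotright> \<and> (a \<cdot> k) \<boxminus> (q \<cdot> g) \<in> J K P))"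
  shows "quasi_abelian_category \<Q>"
proof -
  interpret Q: preadditive_category \<Q> by (rule quotient_preadditive)
  have "weak_exact_squares \<Q>"
  proof unfold_locales
    show "\<exists>Z. zero_object \<Q> Z" using zero_object_quotient[OF zero] by blast
  next
    fix A B assume "A \<in> Ob \<Q>" "B \<in> Ob \<Q>"
    then show "\<exists>P. direct_sum \<Q> A B P" using sum direct_sum_quotient by (metis Ob_quotient)
  next
    fix F X A assume "Q.arr F X A"
    then obtain f where f: "X \<in> \<H>" "A \<in> \<H>" "\<guillemotleft>f : X \<rightarrow> A\<guillemotright>" "F = cls f" unfolding arr_quotient_iff by blast
    obtain D c where c: "cokernel_mod X A D f c"
      and sq: "\<And>B g. B \<in> \<H> \<Longrightarrow> \<guillemotleft>g : B \<rightarrow> D\<guillemotright> \<Longrightarrow>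
        \<exists>R s P q a. cokernel_mod R P B s q \<and> \<guillemotleft>a : P \<rightarrow> A\<guillemotright> \<and> c \<cdot> a = g \<cdot> q"
      using coker[OF f(1-3)] by blast
    have D: "D \<in> \<H>" "\<guillemotleft>c : A \<rightarrow> D\<guillemotright>" using c unfolding cokernel_mod_def by blast+
    have "\<exists>P a q. cokernel_arrow \<Q> P B q \<and> Q.arr q P B \<and> Q.arr a P A \<and> cls c \<cdot>\<^bsub>\<Q>\<^esub> a = G \<cdot>\<^bsub>\<Q>\<^esub> q"
      if G: "Q.arr G B D" for B G
    proof -
      obtain g where g: "B \<in> \<H>" "\<guillemotleft>g : B \<rightarrow> D\<guillemotright>" "G = cls g" using G unfolding arr_quotient_iff by blast
      obtain R s P q a where *: "cokernel_mod R P B s q" "\<guillemotleft>a : P \<rightarrow> A\<guillemotright>" "c \<cdot> a = g \<cdot> q" using sq[OF g(1,2)] by blast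
      have P: "P \<in> \<H>" "\<guillemotleft>q : P \<rightarrow> B\<guillemotright>" using *(1) unfolding cokernel_mod_def by blast+
      have "cls c \<cdot>\<^bsub>\<Q>\<^esub> cls a = G \<cdot>\<^bsub>\<Q>\<^esub> cls q"
        unfolding g(3) Comp_quotient[OF *(2) D(2) P(1) f(2) D(1)] Comp_quotient[OF P(2) g(2) P(1) g(1) D(1)] *(3) ..
      moreover have "cokernel_arrow \<Q> P B (cls q)"
        using is_cokernel_quotient[OF *(1)] unfolding cokernel_arrow_def by blast
      ultimately show ?thesis using arr_cls[OF P(2,1) g(1)] arr_cls[OF *(2) P(1) f(2)] by blast
    qed
    then show "\<exists>D c. is_cokernel \<Q> X A D F c \<and> (\<forall>B g. Q.arr g B D \<longrightarrow>
        (\<exists>P a q. cokernel_arrow \<Q> P B q \<and> Q.arr q P B \<and> Q.arr a P A \<and> c \<cdot>\<^bsub>\<Q>\<^esub> a = g \<cdot>\<^bsub>\<Q>\<^esub> q))"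
      using is_cokernel_quotient[OF c] unfolding f(4) by blast
  next
    fix F A Y assume "Q.arr F A Y"
    then obtain f where f: "A \<in> \<H>" "Y \<in> \<H>" "\<guillemotleft>f : A \<rightarrow> Y\<guillemotright>" "F = cls f" unfolding arr_quotient_iff by blast
    obtain K k where k: "kernel_mod K A Y k f"
      and sq: "\<And>B g. B \<in> \<H> \<Longrightarrow> \<guillemotleft>g : K \<rightarrow> B\<guillemotright> \<Longrightarrow>
        \<exists>P q a. monic_mod B P q \<and> \<guillemotleft>a : A \<rightarrow> P\<guillemotright> \<and> (a \<cdot> k) \<boxminus> (q \<cdot> g) \<in> J K P"
      using ker[OF f(1-3)] by blast
    have K: "K \<in> \<H>" "\<guillemotleft>k : K \<rightarrow> A\<guillemotright>" using k unfolding kernel_mod_def by blast+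
    have "\<exists>P a q. Q.monic q \<and> Q.arr q B P \<and> Q.arr a A P \<and> a \<cdot>\<^bsub>\<Q>\<^esub> cls k = q \<cdot>\<^bsub>\<Q>\<^esub> G"
      if G: "Q.arr G K B" for B G
    proof -
      obtain g where g: "B \<in> \<H>" "\<guillemotleft>g : K \<rightarrow> B\<guillemotright>" "G = cls g" using G unfolding arr_quotient_iff by blast
      obtain P q a where *: "monic_mod B P q" "\<guillemotleft>a : A \<rightarrow> P\<guillemotright>" "(a \<cdot> k) \<boxminus> (q \<cdot> g) \<in> J K P" using sq[OF g(1,2)] by blast
      have P: "P \<in> \<H>" "\<guillemotleft>q : B \<rightarrow> P\<guillemotright>" using *(1) unfolding monic_mod_def by blast+
      have "cls (a \<cdot> k) = cls (q \<cdot> g)"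
        using cls_eq_iff[of "a \<cdot> k" K P "q \<cdot> g"] *(2,3) K P g(2) by simp
      then have "cls a \<cdot>\<^bsub>\<Q>\<^esub> cls k = cls q \<cdot>\<^bsub>\<Q>\<^esub> G"
        unfolding g(3) Comp_quotient[OF K(2) *(2) K(1) f(1) P(1)] Comp_quotient[OF g(2) P(2) K(1) g(1) P(1)] .
      then show ?thesis using monic_quotient[OF *(1)] arr_cls[OF P(2) g(1) P(1)] arr_cls[OF *(2) f(1) P(1)] by blast
    qed
    then show "\<exists>K k. is_kernel \<Q> K A Y k F \<and> (\<forall>B g. Q.arr g K B \<longrightarrow>
        (\<exists>P a q. Q.monic q \<and> Q.arr q B P \<and> Q.arr a A P \<and> a \<cdot>\<^bsub>\<Q>\<^esub> k = q \<cdot>\<^bsub>\<Q>\<^esub> g))"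
      using is_kernel_quotient[OF k] unfolding f(4) by blast
  qed
  then show ?thesis by (rule weak_exact_squares.quasi_abelian)
qed

end

section \<open>Exact quadruples\<close>

text \<open>
  The sequence \<open>X \<rightarrow> Y \<rightarrow> Z \<rightarrow> W\<close> should be thought of as a triangle with \<open>W = \<Sigma>X\<close>, its maps taken up to
  sign. Displaying \<open>W\<close> as an object in its own right makes the notion self-dual: the reversed
  sequence \<open>W \<rightarrow> Z \<rightarrow> Y \<rightarrow> X\<close> is of the same kind in the opposite category. Of the octahedral axiom only the
  triangle formed by the cones of \<open>g1\<close>, \<open>g2 \<cdot> g1\<close> and \<open>g2\<close> is kept; the suspension itself survives
  only in \<open>quad_ends\<close>.
\<close>

locale exact_quadruples = additive_category C
  for C :: "('o, 'm, 'x) precat_scheme" (structure) +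
  fixes quad :: "'o \<Rightarrow> 'o \<Rightarrow> 'o \<Rightarrow> 'o \<Rightarrow> 'm \<Rightarrow> 'm \<Rightarrow> 'm \<Rightarrow> bool"
  assumes quad_arr: "quad X Y Z W f g h \<Longrightarrow> \<guillemotleft>f : X \<rightarrow> Y\<guillemotright> \<and> \<guillemotleft>g : Y \<rightarrow> Z\<guillemotright> \<and> \<guillemotleft>h : Z \<rightarrow> W\<guillemotright>"
    and quad_Zero: "quad X Y Z W f g h \<Longrightarrow> g \<cdot> f = Zero C X Z \<and> h \<cdot> g = Zero C Y W"
    and quad_lift: "quad X Y Z W f g h \<Longrightarrow> \<guillemotleft>u : A \<rightarrow> Y\<guillemotright> \<Longrightarrow> g \<cdot> u = Zero C A Z \<Longrightarrow> \<exists>v. \<guillemotleft>v : A \<rightarrow> X\<guillemotright> \<and> f \<cdot> v = u"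
    and quad_desc: "quad X Y Z W f g h \<Longrightarrow> \<guillemotleft>u : Z \<rightarrow> A\<guillemotright> \<Longrightarrow> u \<cdot> g = Zero C Y A \<Longrightarrow> \<exists>v. \<guillemotleft>v : W \<rightarrow> A\<guillemotright> \<and> v \<cdot> h = u"
    and quad_ex: "\<guillemotleft>g : Y \<rightarrow> Z\<guillemotright> \<Longrightarrow> \<exists>X W f h. quad X Y Z W f g h"
    and quad_rotate: "quad X Y Z W f g h \<Longrightarrow> \<exists>V k. quad Y Z W V g h k"
    and quad_unrotate: "quad X Y Z W f g h \<Longrightarrow> \<exists>V k. quad V X Y Z k f g"
    and quad_ends: "quad X Y Z W f g h \<Longrightarrow> quad X' Y' Z' W' f' g' h' \<Longrightarrow> X = X' \<longleftrightarrow> W = W'"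
    and quad_cones: "quad X1 Y Z W1 f1 g1 h1 \<Longrightarrow> quad X2 Z Z' W2 f2 g2 h2 \<Longrightarrow> quad X3 Y Z' W3 f3 (g2 \<cdot> g1) h3 \<Longrightarrow>
      \<exists>f g h. quad X2 W1 W3 W2 f g h"
begin

lemma quad_lift_third: 
  assumes "quad X Y Z W f g h" "\<guillemotleft>u : A \<rightarrow> Z\<guillemotright>" "h \<cdot> u = Zero C A W"
  shows "\<exists>v. \<guillemotleft>v : A \<rightarrow> Y\<guillemotright> \<and> g \<cdot> v = u"
proof -
  obtain V k where "quad Y Z W V g h k" using quad_rotate[OF assms(1)] by blast
  then show ?thesis using assms(2,3) by (rule quad_lift)
qed

lemma quad_desc_second:
  assumes "quad X Y Z W f g h" "\<guillemotleft>u : Y \<rightarrow> A\<guillemotright>" "u \<cdot> f = Zero C X A"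
  shows "\<exists>v. \<guillemotleft>v : Z \<rightarrow> A\<guillemotright> \<and> v \<cdot> g = u"
proof -
  obtain V k where "quad V X Y Z k f g" using quad_unrotate[OF assms(1)] by blast
  then show ?thesis using assms(2,3) by (rule quad_desc)
qed

lemma quad_ex_first:
  assumes "\<guillemotleft>f : X \<rightarrow> Y\<guillemotright>"
  shows "\<exists>Z W g h. quad X Y Z W f g h"
  using quad_ex[OF assms] quad_rotate by blast

lemma quad_ex_last:
  assumes "\<guillemotleft>h : Z \<rightarrow> W\<guillemotright>"
  shows "\<exists>X Y f g. quad X Y Z W f g h"
  using quad_ex[OF assms] quad_unrotate by blast

text \<open>
  The dual of \<open>quad_cones\<close>: rotating the triangle of cones back twice gives the triangle of fibres.
\<close>

lemma quad_fibres:
  assumes q1: "quad X1 Y Z W1 f1 g1 h1" and q2: "quad X2 Z Z' W2 f2 g2 h2"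
    and q3: "quad X3 Y Z' W3 f3 (g2 \<cdot> g1) h3"
  shows "\<exists>f g h. quad X1 X3 X2 W1 f g h"
proof -
  obtain f g h where "quad X2 W1 W3 W2 f g h" using quad_cones[OF q1 q2 q3] by blast
  then obtain V k where r: "quad V X2 W1 W3 k f g" using quad_unrotate by blast
  then have "V = X3" using quad_ends[OF r q3] by simp
  then obtain V' k' where r': "quad V' X3 X2 W1 k' k f" using quad_unrotate[OF r] by blast
  then have "V' = X1" using quad_ends[OF r' q1] by simp
  with r' show ?thesis by blast
qed

end

section \<open>Twin pairs of orthogonal classes\<close>

text \<open>
  For a twin cotorsion pair \<open>((\<S>, \<T>), (\<U>, \<V>))\<close> take \<open>\<P> = \<Sigma>\<inverse>\<S>\<close> and \<open>\<N> = \<Sigma>\<V>\<close>. Then both pairs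
  \<open>(\<P>, \<T>)\<close> and \<open>(\<U>, \<N>)\<close> are characterized by vanishing of \<open>Hom\<close>, and the conditions \<open>\<S> \<subseteq> \<U>\<close>
  and \<open>\<V> \<subseteq> \<T>\<close> read \<open>P_end\<close> and \<open>N_end\<close>. Duality exchanges \<open>\<P>\<close> with \<open>\<N>\<close> and \<open>\<T>\<close> with \<open>\<U>\<close>.
\<close>

locale twin_classes = exact_quadruples C quad
  for C :: "('o, 'm, 'x) precat_scheme" (structure)
    and quad :: "'o \<Rightarrow> 'o \<Rightarrow> 'o \<Rightarrow> 'o \<Rightarrow> 'm \<Rightarrow> 'm \<Rightarrow> 'm \<Rightarrow> bool" +
  fixes \<P> \<T> \<U> \<N> :: "'o set"
  assumes classes_Ob: "\<P> \<subseteq> Ob C" "\<T> \<subseteq> Ob C" "\<U> \<subseteq> Ob C" "\<N> \<subseteq> Ob C"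
    and PT_Zero: "p \<in> \<P> \<Longrightarrow> t \<in> \<T> \<Longrightarrow> \<guillemotleft>f : p \<rightarrow> t\<guillemotright> \<Longrightarrow> f = Zero C p t"
    and UN_Zero: "u \<in> \<U> \<Longrightarrow> n \<in> \<N> \<Longrightarrow> \<guillemotleft>f : u \<rightarrow> n\<guillemotright> \<Longrightarrow> f = Zero C u n"
    and PT_ex: "M \<in> Ob C \<Longrightarrow> \<exists>p \<in> \<P>. \<exists>t \<in> \<T>. \<exists>W f g h. quad p M t W f g h"
    and UN_ex: "M \<in> Ob C \<Longrightarrow> \<exists>u \<in> \<U>. \<exists>n \<in> \<N>. \<exists>W f g h. quad u M n W f g h"
    and P_orth: "M \<in> Ob C \<Longrightarrow> (\<And>t f. t \<in> \<T> \<Longrightarrow> \<guillemotleft>f : M \<rightarrow> t\<guillemotright> \<Longrightarrow> f = Zero C M t) \<Longrightarrow> M \<in> \<P>"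
    and T_orth: "M \<in> Ob C \<Longrightarrow> (\<And>p f. p \<in> \<P> \<Longrightarrow> \<guillemotleft>f : p \<rightarrow> M\<guillemotright> \<Longrightarrow> f = Zero C p M) \<Longrightarrow> M \<in> \<T>"
    and U_orth: "M \<in> Ob C \<Longrightarrow> (\<And>n f. n \<in> \<N> \<Longrightarrow> \<guillemotleft>f : M \<rightarrow> n\<guillemotright> \<Longrightarrow> f = Zero C M n) \<Longrightarrow> M \<in> \<U>"
    and N_orth: "M \<in> Ob C \<Longrightarrow> (\<And>u f. u \<in> \<U> \<Longrightarrow> \<guillemotleft>f : u \<rightarrow> M\<guillemotright> \<Longrightarrow> f = Zero C u M) \<Longrightarrow> M \<in> \<N>"
    and P_end: "quad X Y Z W f g h \<Longrightarrow> X \<in> \<P> \<Longrightarrow> W \<in> \<U>"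
    and N_end: "quad X Y Z W f g h \<Longrightarrow> W \<in> \<N> \<Longrightarrow> X \<in> \<T>"

locale nested_twin_classes = twin_classes C quad \<P> \<T> \<U> \<N>
  for C :: "('o, 'm, 'x) precat_scheme" (structure)
    and quad :: "'o \<Rightarrow> 'o \<Rightarrow> 'o \<Rightarrow> 'o \<Rightarrow> 'm \<Rightarrow> 'm \<Rightarrow> 'm \<Rightarrow> bool" and \<P> \<T> \<U> \<N> +
  assumes UT: "\<U> \<subseteq> \<T>"
begin

definition \<H> :: "'o set"
  where "\<H> = {M \<in> Ob C. \<exists>p \<in> \<P>. \<exists>u \<in> \<U>. \<exists>W f g h. quad p M u W f g h}"

abbreviation J :: "'o \<Rightarrow> 'o \<Rightarrow> 'm set"
  where "J \<equiv> factor_ideal C \<U>"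

lemma class_Ob [simp]:
  "X \<in> \<P> \<Longrightarrow> X \<in> Ob C" "X \<in> \<T> \<Longrightarrow> X \<in> Ob C" "X \<in> \<U> \<Longrightarrow> X \<in> Ob C" "X \<in> \<N> \<Longrightarrow> X \<in> Ob C" "X \<in> \<H> \<Longrightarrow> X \<in> Ob C"
  using classes_Ob by (auto simp: \<H>_def)

lemma PU_Zero:
  assumes "p \<in> \<P>" "u \<in> \<U>" "\<guillemotleft>f : p \<rightarrow> u\<guillemotright>"
  shows "f = Zero C p u"
  using PT_Zero[OF assms(1) _ assms(3)] assms(2) UT by blast

lemma J_iff:
  assumes "X \<in> Ob C" "Y \<in> Ob C"
  shows "f \<in> J X Y \<longleftrightarrow> (\<exists>u \<in> \<U>. \<exists>a b. \<guillemotleft>a : X \<rightarrow> u\<guillemotright> \<and> \<guillemotleft>b : u \<rightarrow> Y\<guillemotright> \<and> f = b \<cdot> a)"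
proof
  assume "f \<in> J X Y"
  then obtain u a b where "u \<in> \<U>" "a \<in> Hom C X u" "b \<in> Hom C u Y" "f = b \<cdot> a"
    unfolding factor_ideal_def by blast
  then show "\<exists>u \<in> \<U>. \<exists>a b. \<guillemotleft>a : X \<rightarrow> u\<guillemotright> \<and> \<guillemotleft>b : u \<rightarrow> Y\<guillemotright> \<and> f = b \<cdot> a"
    using assms class_Ob(3) unfolding arr_def by blast
next
  assume "\<exists>u \<in> \<U>. \<exists>a b. \<guillemotleft>a : X \<rightarrow> u\<guillemotright> \<and> \<guillemotleft>b : u \<rightarrow> Y\<guillemotright> \<and> f = b \<cdot> a"
  then obtain u a b where *: "u \<in> \<U>" "\<guillemotleft>a : X \<rightarrow> u\<guillemotright>" "\<guillemotleft>b : u \<rightarrow> Y\<guillemotright>" "f = b \<cdot> a" by blast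
  then have "f \<in> Hom C X Y" using assms by (simp add: hom_iff_arr)
  moreover have "a \<in> Hom C X u" "b \<in> Hom C u Y" using *(2,3) unfolding arr_def by blast+
  ultimately show "f \<in> J X Y" using *(1,4) unfolding factor_ideal_def by blast
qed

lemma JI:
  assumes "u \<in> \<U>" "\<guillemotleft>a : X \<rightarrow> u\<guillemotright>" "\<guillemotleft>b : u \<rightarrow> Y\<guillemotright>"
  shows "b \<cdot> a \<in> J X Y"
proof -
  have "X \<in> Ob C" "Y \<in> Ob C" using assms by simp_all
  then show ?thesis unfolding J_iff[OF \<open>X \<in> Ob C\<close> \<open>Y \<in> Ob C\<close>] using assms by blast
qed

lemma JE:
  assumes "f \<in> J X Y" "X \<in> Ob C" "Y \<in> Ob C"
  obtains u a b where "u \<in> \<U>" "\<guillemotleft>a : X \<rightarrow> u\<guillemotright>" "\<guillemotleft>b : u \<rightarrow> Y\<guillemotright>" "f = b \<cdot> a"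
  using assms(1) unfolding J_iff[OF assms(2,3)] by blast

lemma J_arr:
  assumes "X \<in> Ob C" "Y \<in> Ob C" "f \<in> J X Y"
  shows "\<guillemotleft>f : X \<rightarrow> Y\<guillemotright>"
proof -
  obtain u a b where "\<guillemotleft>a : X \<rightarrow> u\<guillemotright>" "\<guillemotleft>b : u \<rightarrow> Y\<guillemotright>" "f = b \<cdot> a" by (rule JE[OF assms(3,1,2)])
  then show ?thesis by simp
qed

text \<open>
  The map \<open>i : u \<rightarrow> Y\<close> is a right \<open>\<U>\<close>-approximation, since maps from \<open>\<U>\<close> to its cone \<open>n\<close> vanish.
  Membership in \<open>J\<close> thereby becomes a linear condition, from which closure under sums is evident.
\<close>

lemma J_iff_comp_Zero:
  assumes q: "quad u Y n W i y h" and "u \<in> \<U>" "n \<in> \<N>" and f: "\<guillemotleft>f : X \<rightarrow> Y\<guillemotright>"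
  shows "f \<in> J X Y \<longleftrightarrow> y \<cdot> f = Zero C X n"
proof
  have t: "\<guillemotleft>i : u \<rightarrow> Y\<guillemotright>" "\<guillemotleft>y : Y \<rightarrow> n\<guillemotright>" using quad_arr[OF q] by blast+
  assume fJ: "f \<in> J X Y"
  have Ob: "X \<in> Ob C" "Y \<in> Ob C" using f by simp_all
  obtain u' a b where ab: "u' \<in> \<U>" "\<guillemotleft>a : X \<rightarrow> u'\<guillemotright>" "\<guillemotleft>b : u' \<rightarrow> Y\<guillemotright>" "f = b \<cdot> a" by (rule JE[OF fJ Ob])
  have "y \<cdot> b = Zero C u' n" by (rule UN_Zero[OF ab(1) assms(3)]) (use t ab in simp)
  moreover have "y \<cdot> f = (y \<cdot> b) \<cdot> a" unfolding ab(4) using t ab(2,3) by simp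
  ultimately show "y \<cdot> f = Zero C X n" using ab(2) assms(3) by simp
next
  assume "y \<cdot> f = Zero C X n"
  then obtain v where "\<guillemotleft>v : X \<rightarrow> u\<guillemotright>" "i \<cdot> v = f" using quad_lift[OF q f] by blast
  then show "f \<in> J X Y" using JI[OF assms(2), of v X i Y] quad_arr[OF q] by simp
qed

lemma J_Zero:
  assumes "X \<in> Ob C" "Y \<in> Ob C"
  shows "Zero C X Y \<in> J X Y"
proof -
  obtain u n W f g h where q: "u \<in> \<U>" "n \<in> \<N>" "quad u Y n W f g h" using UN_ex[OF assms(2)] by blast
  have "\<guillemotleft>Zero C X Y : X \<rightarrow> Y\<guillemotright>" using assms by simp
  from J_iff_comp_Zero[OF q(3,1,2) this] show ?thesis using quad_arr[OF q(3)] assms by simp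
qed

lemma J_diff:
  assumes "X \<in> Ob C" "Y \<in> Ob C" "f \<in> J X Y" "g \<in> J X Y"
  shows "f \<boxminus> g \<in> J X Y"
proof -
  obtain u n W i y h where q: "u \<in> \<U>" "n \<in> \<N>" "quad u Y n W i y h" using UN_ex[OF assms(2)] by blast
  note test = J_iff_comp_Zero[OF q(3,1,2)]
  have t: "\<guillemotleft>f : X \<rightarrow> Y\<guillemotright>" "\<guillemotleft>g : X \<rightarrow> Y\<guillemotright>" "\<guillemotleft>y : Y \<rightarrow> n\<guillemotright>"
    using J_arr assms quad_arr[OF q(3)] by blast+
  have "y \<cdot> f = Zero C X n" "y \<cdot> g = Zero C X n" using test[OF t(1)] test[OF t(2)] assms by blast+
  then have "y \<cdot> (f \<boxminus> g) = Zero C X n" using t by (simp add: comp_diff)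
  moreover have "\<guillemotleft>f \<boxminus> g : X \<rightarrow> Y\<guillemotright>" using t by simp
  ultimately show ?thesis using test by blast
qed

lemma J_comp_left:
  assumes "f \<in> J X Y" "\<guillemotleft>g : Y \<rightarrow> Z\<guillemotright>" "X \<in> Ob C"
  shows "g \<cdot> f \<in> J X Z"
proof -
  have "Y \<in> Ob C" using assms by simp
  then obtain u a b where ab: "u \<in> \<U>" "\<guillemotleft>a : X \<rightarrow> u\<guillemotright>" "\<guillemotleft>b : u \<rightarrow> Y\<guillemotright>" "f = b \<cdot> a"
    by (rule JE[OF assms(1,3)])
  then show ?thesis using JI[OF ab(1,2), of "g \<cdot> b" Z] assms by simp
qed

lemma J_comp_right:
  assumes "g \<in> J Y Z" "\<guillemotleft>f : X \<rightarrow> Y\<guillemotright>" "Z \<in> Ob C"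
  shows "g \<cdot> f \<in> J X Z"
proof -
  have "Y \<in> Ob C" using assms by simp
  then obtain u a b where ab: "u \<in> \<U>" "\<guillemotleft>a : Y \<rightarrow> u\<guillemotright>" "\<guillemotleft>b : u \<rightarrow> Z\<guillemotright>" "g = b \<cdot> a"
    by (rule JE[OF assms(1) _ assms(3)])
  then show ?thesis using JI[OF ab(1), of "a \<cdot> f" X b Z] assms by simp
qed

sublocale H: ideal_on_subcategory C \<H> J
proof unfold_locales
  show "\<H> \<subseteq> Ob C" using class_Ob(5) by blast
next
  fix X Y Z f g assume H: "X \<in> \<H>" "Y \<in> \<H>" "Z \<in> \<H>"
  show "g \<cdot> f \<in> J X Z" if "f \<in> J X Y" "\<guillemotleft>g : Y \<rightarrow> Z\<guillemotright>" by (rule J_comp_left[OF that class_Ob(5)[OF H(1)]])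
  show "g \<cdot> f \<in> J X Z" if "\<guillemotleft>f : X \<rightarrow> Y\<guillemotright>" "g \<in> J Y Z" by (rule J_comp_right[OF that(2,1) class_Ob(5)[OF H(3)]])
next
  fix X Y f g assume H: "X \<in> \<H>" "Y \<in> \<H>"
  note Ob = class_Ob(5)[OF H(1)] class_Ob(5)[OF H(2)]
  show "Zero C X Y \<in> J X Y" by (rule J_Zero[OF Ob])
  show "\<guillemotleft>f : X \<rightarrow> Y\<guillemotright>" if "f \<in> J X Y" by (rule J_arr[OF Ob that])
  show "f \<boxminus> g \<in> J X Y" if "f \<in> J X Y" "g \<in> J X Y" by (rule J_diff[OF Ob that])
qed

text \<open>
  \<open>\<H>\<close> consists of the objects \<open>M\<close> on which a map to \<open>\<N>\<close> vanishes as soon as it kills all maps from \<open>\<P>\<close>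
  to \<open>M\<close>. In this form \<open>\<H>\<close> is visibly stable under direct sums and under cones of maps from \<open>\<P>\<close>.
\<close>

lemma H_orthogonalD:
  assumes M: "M \<in> \<H>" and n: "n \<in> \<N>" and h: "\<guillemotleft>h : M \<rightarrow> n\<guillemotright>"
    and kill: "\<And>p g. p \<in> \<P> \<Longrightarrow> \<guillemotleft>g : p \<rightarrow> M\<guillemotright> \<Longrightarrow> h \<cdot> g = Zero C p n"
  shows "h = Zero C M n"
proof -
  obtain p u W i c d where q: "p \<in> \<P>" "u \<in> \<U>" "quad p M u W i c d" using M unfolding \<H>_def by blast
  have t: "\<guillemotleft>i : p \<rightarrow> M\<guillemotright>" "\<guillemotleft>c : M \<rightarrow> u\<guillemotright>" using quad_arr[OF q(3)] by blast+
  obtain v where v: "\<guillemotleft>v : u \<rightarrow> n\<guillemotright>" "v \<cdot> c = h" using quad_desc_second[OF q(3) h kill[OF q(1) t(1)]] by blast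
  have "v = Zero C u n" by (rule UN_Zero[OF q(2) n v(1)])
  then have "h = Zero C u n \<cdot> c" using v(2) by simp
  then show ?thesis using t n by simp
qed

text \<open>
  Present \<open>M\<close> as \<open>p \<rightarrow> M \<rightarrow> t \<rightarrow> s\<close>. Maps \<open>t \<rightarrow> n\<close> restrict to maps \<open>M \<rightarrow> n\<close> that kill \<open>\<P>\<close>, hence to zero, so they
  factor through \<open>s \<in> \<U>\<close> and vanish. Thus \<open>t \<in> \<U>\<close>.
\<close>

lemma H_orthogonalI:
  assumes M: "M \<in> Ob C"
    and kill: "\<And>n h. n \<in> \<N> \<Longrightarrow> \<guillemotleft>h : M \<rightarrow> n\<guillemotright> \<Longrightarrow>
      (\<And>p g. p \<in> \<P> \<Longrightarrow> \<guillemotleft>g : p \<rightarrow> M\<guillemotright> \<Longrightarrow> h \<cdot> g = Zero C p n) \<Longrightarrow> h = Zero C M n"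
  shows "M \<in> \<H>"
proof -
  obtain p t s i c d where q: "p \<in> \<P>" "t \<in> \<T>" "quad p M t s i c d" using PT_ex[OF M] by blast
  have ty: "\<guillemotleft>c : M \<rightarrow> t\<guillemotright>" "\<guillemotleft>d : t \<rightarrow> s\<guillemotright>" using quad_arr[OF q(3)] by blast+
  have "t \<in> \<U>"
  proof (rule U_orth)
    fix n m assume n: "n \<in> \<N>" and m: "\<guillemotleft>m : t \<rightarrow> n\<guillemotright>"
    have "m \<cdot> c = Zero C M n"
    proof (rule kill[OF n])
      fix p' g assume g: "p' \<in> \<P>" "\<guillemotleft>g : p' \<rightarrow> M\<guillemotright>"
      have "c \<cdot> g = Zero C p' t" by (rule PT_Zero[OF g(1) q(2)]) (use ty g in simp)
      then show "(m \<cdot> c) \<cdot> g = Zero C p' n" using m ty(1) g by simp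
    qed (use m ty in simp)
    then obtain v where v: "\<guillemotleft>v : s \<rightarrow> n\<guillemotright>" "v \<cdot> d = m" using quad_desc[OF q(3) m] by blast
    have "v = Zero C s n" using UN_Zero[OF P_end[OF q(3,1)] n v(1)] .
    then have "m = Zero C s n \<cdot> d" using v(2) by simp
    then show "m = Zero C t n" using ty n by simp
  qed (use ty in simp)
  then show ?thesis unfolding \<H>_def using M q by blast
qed

lemma P_in_H: "p \<in> \<P> \<Longrightarrow> p \<in> \<H>"
proof (rule H_orthogonalI)
  fix n h assume p: "p \<in> \<P>" "\<guillemotleft>h : p \<rightarrow> n\<guillemotright>" and *: "\<And>p' g. p' \<in> \<P> \<Longrightarrow> \<guillemotleft>g : p' \<rightarrow> p\<guillemotright> \<Longrightarrow> h \<cdot> g = Zero C p' n"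
  from *[OF p(1), of "Idn C p"] show "h = Zero C p n" using p by simp
qed simp

lemma zero_object_in_H:
  assumes "zero_object C Z"
  shows "Z \<in> \<H>"
proof (rule H_orthogonalI)
  show Z: "Z \<in> Ob C" using assms by (simp add: zero_object_def)
  fix n h assume n: "n \<in> \<N>" "\<guillemotleft>h : Z \<rightarrow> n\<guillemotright>"
  have "\<exists>!f. f \<in> Hom C Z n" using assms n unfolding zero_object_def by simp
  moreover have "h \<in> Hom C Z n" "Zero C Z n \<in> Hom C Z n" using Z n by (simp_all add: hom_iff_arr)
  ultimately show "h = Zero C Z n" by blast
qed

lemma direct_sum_in_H:
  assumes "direct_sum C A B M" "A \<in> \<H>" "B \<in> \<H>"
  shows "M \<in> \<H>"
proof (rule H_orthogonalI)
  show M: "M \<in> Ob C" using assms(1) by (simp add: direct_sum_def)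
  obtain i j p q where t: "\<guillemotleft>i : A \<rightarrow> M\<guillemotright>" "\<guillemotleft>j : B \<rightarrow> M\<guillemotright>" "\<guillemotleft>p : M \<rightarrow> A\<guillemotright>" "\<guillemotleft>q : M \<rightarrow> B\<guillemotright>"
    and e: "(i \<cdot> p) \<boxplus> (j \<cdot> q) = Idn C M"
    using assms(1) unfolding direct_sum_def by (elim conjE bexE) (simp add: hom_iff_arr del: arr_iff)
  fix n h assume n: "n \<in> \<N>" and h: "\<guillemotleft>h : M \<rightarrow> n\<guillemotright>" and *: "\<And>p' g. p' \<in> \<P> \<Longrightarrow> \<guillemotleft>g : p' \<rightarrow> M\<guillemotright> \<Longrightarrow> h \<cdot> g = Zero C p' n"
  have zero: "h \<cdot> k = Zero C D n" if D: "D \<in> \<H>" and k: "\<guillemotleft>k : D \<rightarrow> M\<guillemotright>" for D k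
  proof (rule H_orthogonalD[OF D n])
    fix p' g assume g: "p' \<in> \<P>" "\<guillemotleft>g : p' \<rightarrow> D\<guillemotright>"
    then show "(h \<cdot> k) \<cdot> g = Zero C p' n" using *[OF g(1), of "k \<cdot> g"] h k by simp
  qed (use h k in simp)
  have "h = h \<cdot> ((i \<cdot> p) \<boxplus> (j \<cdot> q))" unfolding e using h by simp
  also have "\<dots> = ((h \<cdot> i) \<cdot> p) \<boxplus> ((h \<cdot> j) \<cdot> q)" using h t by (simp add: comp_plus_dist)
  also have "\<dots> = Zero C M n" unfolding zero[OF assms(2) t(1)] zero[OF assms(3) t(2)] using t n by simp
  finally show "h = Zero C M n" .
qed

lemma cone_in_H:
  assumes q: "quad p Y Q s i c d" and p: "p \<in> \<P>" and Y: "Y \<in> \<H>"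
  shows "Q \<in> \<H>"
proof (rule H_orthogonalI)
  have t: "\<guillemotleft>i : p \<rightarrow> Y\<guillemotright>" "\<guillemotleft>c : Y \<rightarrow> Q\<guillemotright>" "\<guillemotleft>d : Q \<rightarrow> s\<guillemotright>" using quad_arr[OF q] by blast+
  show "Q \<in> Ob C" using t by simp
  fix n h assume n: "n \<in> \<N>" and h: "\<guillemotleft>h : Q \<rightarrow> n\<guillemotright>" and *: "\<And>p' g. p' \<in> \<P> \<Longrightarrow> \<guillemotleft>g : p' \<rightarrow> Q\<guillemotright> \<Longrightarrow> h \<cdot> g = Zero C p' n"
  have "h \<cdot> c = Zero C Y n"
  proof (rule H_orthogonalD[OF Y n])
    fix p' g assume "p' \<in> \<P>" "\<guillemotleft>g : p' \<rightarrow> Y\<guillemotright>"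
    then show "(h \<cdot> c) \<cdot> g = Zero C p' n" using *[of p' "c \<cdot> g"] h t by simp
  qed (use h t in simp)
  then obtain v where v: "\<guillemotleft>v : s \<rightarrow> n\<guillemotright>" "v \<cdot> d = h" using quad_desc[OF q h] by blast
  have "v = Zero C s n" using UN_Zero[OF P_end[OF q p] n v(1)] .
  then have "h = Zero C s n \<cdot> d" using v(2) by simp
  then show "h = Zero C Q n" using t n by simp
qed

lemma P_extension:
  assumes q: "quad p F p' W f g h" and "p \<in> \<P>" "p' \<in> \<P>"
  shows "F \<in> \<P>"
proof (rule P_orth)
  have ty: "\<guillemotleft>f : p \<rightarrow> F\<guillemotright>" "\<guillemotleft>g : F \<rightarrow> p'\<guillemotright>" using quad_arr[OF q] by blast+
  then show "F \<in> Ob C" by simp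
  fix t e assume t: "t \<in> \<T>" and e: "\<guillemotleft>e : F \<rightarrow> t\<guillemotright>"
  have "e \<cdot> f = Zero C p t" by (rule PT_Zero[OF assms(2) t]) (use e ty in simp)
  then obtain v where v: "\<guillemotleft>v : p' \<rightarrow> t\<guillemotright>" "v \<cdot> g = e" using quad_desc_second[OF q e] by blast
  have "v = Zero C p' t" by (rule PT_Zero[OF assms(3) t v(1)])
  then have "e = Zero C p' t \<cdot> g" using v(2) by simp
  then show "e = Zero C F t" using ty t by simp
qed

lemma N_extension:
  assumes q: "quad X n' M n f g h" and "n \<in> \<N>" "n' \<in> \<N>"
  shows "M \<in> \<N>"
proof (rule N_orth)
  have ty: "\<guillemotleft>g : n' \<rightarrow> M\<guillemotright>" "\<guillemotleft>h : M \<rightarrow> n\<guillemotright>" using quad_arr[OF q] by blast+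
  then show "M \<in> Ob C" by simp
  fix u e assume u: "u \<in> \<U>" and e: "\<guillemotleft>e : u \<rightarrow> M\<guillemotright>"
  have "h \<cdot> e = Zero C u n" by (rule UN_Zero[OF u assms(2)]) (use e ty in simp)
  then obtain v where v: "\<guillemotleft>v : u \<rightarrow> n'\<guillemotright>" "g \<cdot> v = e" using quad_lift_third[OF q e] by blast
  have "v = Zero C u n'" by (rule UN_Zero[OF u assms(3) v(1)])
  then have "e = g \<cdot> Zero C u n'" using v(2) by simp
  then show "e = Zero C u M" using ty u by simp
qed

text \<open>
  If \<open>p1 \<rightarrow> B \<rightarrow> u\<close> presents \<open>B\<close>, the fibre of \<open>P \<rightarrow> B \<rightarrow> u\<close> is an extension of \<open>p1\<close> by \<open>p\<close>, hence in \<open>\<P>\<close>.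
\<close>

lemma extension_in_H:
  assumes q: "quad p P B s i c d" and p: "p \<in> \<P>" and B: "B \<in> \<H>"
  shows "P \<in> \<H>"
proof -
  obtain p1 u W i1 c1 d1 where q1: "p1 \<in> \<P>" "u \<in> \<U>" "quad p1 B u W i1 c1 d1" using B unfolding \<H>_def by blast
  have ty: "\<guillemotleft>c : P \<rightarrow> B\<guillemotright>" "\<guillemotleft>c1 : B \<rightarrow> u\<guillemotright>" using quad_arr[OF q] quad_arr[OF q1(3)] by blast+
  then have cc: "\<guillemotleft>c1 \<cdot> c : P \<rightarrow> u\<guillemotright>" by simp
  obtain F V f h where q2: "quad F P u V f (c1 \<cdot> c) h" using quad_ex[OF cc] by blast
  obtain f' g' h' where "quad p F p1 s f' g' h'" using quad_fibres[OF q q1(3) q2] by blast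
  then have "F \<in> \<P>" using P_extension p q1(1) by blast
  moreover have "P \<in> Ob C" using ty by simp
  ultimately show ?thesis unfolding \<H>_def using q2 q1(2) by blast
qed

text \<open>
  If \<open>t \<cdot> c\<close> factors through \<open>u \<in> \<U>\<close>, its first factor kills \<open>p\<close> and therefore extends along \<open>c\<close>. After
  subtracting the resulting element of \<open>J\<close>, \<open>t \<cdot> c = 0\<close> and \<open>t\<close> factors through \<open>s \<in> \<U>\<close>.
\<close>

lemma P_deflation_epic:
  assumes q: "quad p Y Q s i c d" and p: "p \<in> \<P>" and t: "\<guillemotleft>t : Q \<rightarrow> A\<guillemotright>" and tc: "t \<cdot> c \<in> J Y A"
  shows "t \<in> J Q A"
proof -
  have ty: "\<guillemotleft>i : p \<rightarrow> Y\<guillemotright>" "\<guillemotleft>c : Y \<rightarrow> Q\<guillemotright>" "\<guillemotleft>d : Q \<rightarrow> s\<guillemotright>" using quad_arr[OF q] by blast+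
  have Ob: "Y \<in> Ob C" "A \<in> Ob C" "Q \<in> Ob C" using ty t by simp_all
  obtain u a b where ab: "u \<in> \<U>" "\<guillemotleft>a : Y \<rightarrow> u\<guillemotright>" "\<guillemotleft>b : u \<rightarrow> A\<guillemotright>" "t \<cdot> c = b \<cdot> a" by (rule JE[OF tc Ob(1,2)])
  have "a \<cdot> i = Zero C p u" by (rule PU_Zero[OF p ab(1)]) (use ty ab in simp)
  then obtain a' where a': "\<guillemotleft>a' : Q \<rightarrow> u\<guillemotright>" "a' \<cdot> c = a" using quad_desc_second[OF q ab(2)] by blast
  have "(t \<boxminus> (b \<cdot> a')) \<cdot> c = (t \<cdot> c) \<boxminus> (b \<cdot> (a' \<cdot> c))"
    using t ab(3) a'(1) ty(2) by (simp add: diff_comp)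
  also have "\<dots> = Zero C Y A" unfolding ab(4) a'(2) using ab(2,3) by simp
  finally have "(t \<boxminus> (b \<cdot> a')) \<cdot> c = Zero C Y A" .
  moreover have ty': "\<guillemotleft>t \<boxminus> (b \<cdot> a') : Q \<rightarrow> A\<guillemotright>" using t ab(3) a'(1) by simp
  ultimately obtain e where e: "\<guillemotleft>e : s \<rightarrow> A\<guillemotright>" "e \<cdot> d = t \<boxminus> (b \<cdot> a')" using quad_desc[OF q] by blast
  have "t \<boxminus> (b \<cdot> a') \<in> J Q A" using JI[OF P_end[OF q p] ty(3) e(1)] unfolding e(2) .
  moreover have "neg (b \<cdot> a') \<in> J Q A"
    using J_diff[OF Ob(3,2) J_Zero[OF Ob(3,2)] JI[OF ab(1) a'(1) ab(3)]] a'(1) ab(3) by (simp add: diff_def)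
  ultimately have "(t \<boxminus> (b \<cdot> a')) \<boxminus> neg (b \<cdot> a') \<in> J Q A" by (rule J_diff[OF Ob(3,2)])
  then show ?thesis using t a'(1) ab(3) by (simp add: diff_def plus_assoc)
qed

lemma cokernel_mod_cone:
  assumes q: "quad p Y Q s i c d" and p: "p \<in> \<P>" and Y: "Y \<in> \<H>"
    and f: "X \<in> \<H>" "\<guillemotleft>f : X \<rightarrow> Y\<guillemotright>" "c \<cdot> f \<in> J X Q"
    and fi: "\<And>A g. \<guillemotleft>g : Y \<rightarrow> A\<guillemotright> \<Longrightarrow> g \<cdot> f \<in> J X A \<Longrightarrow> g \<cdot> i = Zero C p A"
  shows "H.cokernel_mod X Y Q f c"
proof -
  have ty: "\<guillemotleft>c : Y \<rightarrow> Q\<guillemotright>" using quad_arr[OF q] by blast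
  have "\<exists>u. \<guillemotleft>u : Q \<rightarrow> A\<guillemotright> \<and> u \<cdot> c = g" if "\<guillemotleft>g : Y \<rightarrow> A\<guillemotright> \<and> g \<cdot> f \<in> J X A" for A g
    using quad_desc_second[OF q _ fi] that by blast
  moreover have "u \<in> J Q A" if "\<guillemotleft>u : Q \<rightarrow> A\<guillemotright> \<and> u \<cdot> c \<in> J Y A" for A u
    using P_deflation_epic[OF q p] that by blast
  ultimately show ?thesis unfolding H.cokernel_mod_def using Y f ty cone_in_H[OF q p Y] by blast
qed

text \<open>
  The cokernel of \<open>f\<close> is the cone of \<open>f \<cdot> i\<close>, where \<open>i : p \<rightarrow> X\<close> is the \<open>\<P>\<close>-part of \<open>X\<close>: the rest of \<open>X\<close> lies in
  \<open>\<U>\<close> and is invisible. To move \<open>c : A \<rightarrow> D\<close> along \<open>g : B \<rightarrow> D\<close>, take the fibre of \<open>B \<rightarrow> D \<rightarrow> \<Sigma>p\<close>.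
\<close>

lemma ex_cokernel_mod:
  assumes X: "X \<in> \<H>" and A: "A \<in> \<H>" and f: "\<guillemotleft>f : X \<rightarrow> A\<guillemotright>"
  shows "\<exists>D c. H.cokernel_mod X A D f c \<and>
    (\<forall>B \<in> \<H>. \<forall>g. \<guillemotleft>g : B \<rightarrow> D\<guillemotright> \<longrightarrow> (\<exists>R s P q a. H.cokernel_mod R P B s q \<and> \<guillemotleft>a : P \<rightarrow> A\<guillemotright> \<and> c \<cdot> a = g \<cdot> q))"
proof -
  obtain p u s i w z where q: "p \<in> \<P>" "u \<in> \<U>" "quad p X u s i w z" using X unfolding \<H>_def by blast
  have ty: "\<guillemotleft>i : p \<rightarrow> X\<guillemotright>" "\<guillemotleft>w : X \<rightarrow> u\<guillemotright>" using quad_arr[OF q(3)] by blast+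
  have fi: "\<guillemotleft>f \<cdot> i : p \<rightarrow> A\<guillemotright>" using ty f by simp
  obtain D s' c d where q': "quad p A D s' (f \<cdot> i) c d" using quad_ex_first[OF fi] by blast
  have ty': "\<guillemotleft>c : A \<rightarrow> D\<guillemotright>" "\<guillemotleft>d : D \<rightarrow> s'\<guillemotright>" using quad_arr[OF q'] by blast+
  have "H.cokernel_mod X A D f c"
  proof (rule cokernel_mod_cone[OF q' q(1) A X f])
    have "(c \<cdot> f) \<cdot> i = Zero C p D" using quad_Zero[OF q'] ty ty' f by simp
    then obtain e where e: "\<guillemotleft>e : u \<rightarrow> D\<guillemotright>" "e \<cdot> w = c \<cdot> f" using quad_desc_second[OF q(3), of "c \<cdot> f" D] f ty' by auto
    show "c \<cdot> f \<in> J X D" using JI[OF q(2) ty(2) e(1)] unfolding e(2) .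
  next
    fix Z g assume g: "\<guillemotleft>g : A \<rightarrow> Z\<guillemotright>" "g \<cdot> f \<in> J X Z"
    have Ob: "X \<in> Ob C" "Z \<in> Ob C" using ty g by simp_all
    obtain u' a b where ab: "u' \<in> \<U>" "\<guillemotleft>a : X \<rightarrow> u'\<guillemotright>" "\<guillemotleft>b : u' \<rightarrow> Z\<guillemotright>" "g \<cdot> f = b \<cdot> a" by (rule JE[OF g(2) Ob])
    have ai: "a \<cdot> i = Zero C p u'" by (rule PU_Zero[OF q(1) ab(1)]) (use ty ab in simp)
    have "g \<cdot> (f \<cdot> i) = (g \<cdot> f) \<cdot> i" using g f ty by simp
    also have "\<dots> = b \<cdot> (a \<cdot> i)" unfolding ab(4) using ab(2,3) ty by simp
    finally show "g \<cdot> (f \<cdot> i) = Zero C p Z" unfolding ai using ab(3) ty by simp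
  qed
  moreover have "\<exists>R s P q a. H.cokernel_mod R P B s q \<and> \<guillemotleft>a : P \<rightarrow> A\<guillemotright> \<and> c \<cdot> a = g \<cdot> q"
    if B: "B \<in> \<H>" and g: "\<guillemotleft>g : B \<rightarrow> D\<guillemotright>" for B g
  proof -
    have dg: "\<guillemotleft>d \<cdot> g : B \<rightarrow> s'\<guillemotright>" using g ty' by simp
    obtain p2 P j k where q2: "quad p2 P B s' j k (d \<cdot> g)" using quad_ex_last[OF dg] by blast
    have p2: "p2 \<in> \<P>" using quad_ends[OF q2 q'] q(1) by blast
    have ty2: "\<guillemotleft>j : p2 \<rightarrow> P\<guillemotright>" "\<guillemotleft>k : P \<rightarrow> B\<guillemotright>" using quad_arr[OF q2] by blast+
    have "H.cokernel_mod p2 P B j k"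
    proof (rule cokernel_mod_cone[OF q2 p2 extension_in_H[OF q2 p2 B] P_in_H[OF p2] ty2(1)])
      have "k \<cdot> j = Zero C p2 B" using quad_Zero[OF q2] by blast
      then show "k \<cdot> j \<in> J p2 B" using J_Zero[of p2 B] ty2 by simp
    next
      fix Z g assume g: "\<guillemotleft>g : P \<rightarrow> Z\<guillemotright>" "g \<cdot> j \<in> J p2 Z"
      have Ob: "p2 \<in> Ob C" "Z \<in> Ob C" using ty2 g by simp_all
      obtain u' a b where ab: "u' \<in> \<U>" "\<guillemotleft>a : p2 \<rightarrow> u'\<guillemotright>" "\<guillemotleft>b : u' \<rightarrow> Z\<guillemotright>" "g \<cdot> j = b \<cdot> a" by (rule JE[OF g(2) Ob])
      show "g \<cdot> j = Zero C p2 Z" unfolding ab(4) PU_Zero[OF p2 ab(1,2)] using ab(2,3) by simp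
    qed
    moreover have "d \<cdot> (g \<cdot> k) = Zero C P s'" using quad_Zero[OF q2] g ty' ty2 by simp
    then obtain a where "\<guillemotleft>a : P \<rightarrow> A\<guillemotright>" "c \<cdot> a = g \<cdot> k"
      using quad_lift_third[OF q', of "g \<cdot> k" P] g ty2 by auto
    ultimately show ?thesis by blast
  qed
  ultimately show ?thesis by blast
qed

text \<open>
  If \<open>k \<cdot> u\<close> factors through \<open>w \<in> \<U>\<close>, its second factor lifts along \<open>k\<close> since maps from \<open>\<U>\<close> to \<open>n\<close> vanish.
  After subtracting the resulting element of \<open>J\<close>, \<open>u\<close> factors through \<open>v \<in> \<T>\<close>; and a map from \<open>A \<in> \<H>\<close> to
  \<open>\<T>\<close> kills the \<open>\<P>\<close>-part of \<open>A\<close>, so it factors through \<open>\<U>\<close>.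
\<close>

lemma N_inflation_monic:
  assumes q: "quad v K X n m k x" and n: "n \<in> \<N>" and A: "A \<in> \<H>" and u: "\<guillemotleft>u : A \<rightarrow> K\<guillemotright>" and ku: "k \<cdot> u \<in> J A X"
  shows "u \<in> J A K"
proof -
  have ty: "\<guillemotleft>m : v \<rightarrow> K\<guillemotright>" "\<guillemotleft>k : K \<rightarrow> X\<guillemotright>" "\<guillemotleft>x : X \<rightarrow> n\<guillemotright>" using quad_arr[OF q] by blast+
  have Ob: "A \<in> Ob C" "X \<in> Ob C" "K \<in> Ob C" using ty u by simp_all
  obtain w a b where ab: "w \<in> \<U>" "\<guillemotleft>a : A \<rightarrow> w\<guillemotright>" "\<guillemotleft>b : w \<rightarrow> X\<guillemotright>" "k \<cdot> u = b \<cdot> a" by (rule JE[OF ku Ob(1,2)])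
  have "x \<cdot> b = Zero C w n" by (rule UN_Zero[OF ab(1) n]) (use ty ab in simp)
  then obtain b' where b': "\<guillemotleft>b' : w \<rightarrow> K\<guillemotright>" "k \<cdot> b' = b" using quad_lift_third[OF q ab(3)] by blast
  have "k \<cdot> (u \<boxminus> (b' \<cdot> a)) = (k \<cdot> u) \<boxminus> ((k \<cdot> b') \<cdot> a)"
    using u ab(2) b'(1) ty(2) by (simp add: comp_diff)
  also have "\<dots> = Zero C A X" unfolding ab(4) b'(2) using ab(2,3) by simp
  finally have "k \<cdot> (u \<boxminus> (b' \<cdot> a)) = Zero C A X" .
  moreover have ty': "\<guillemotleft>u \<boxminus> (b' \<cdot> a) : A \<rightarrow> K\<guillemotright>" using u ab(2) b'(1) by simp
  ultimately obtain r where r: "\<guillemotleft>r : A \<rightarrow> v\<guillemotright>" "m \<cdot> r = u \<boxminus> (b' \<cdot> a)" using quad_lift[OF q] by blast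
  obtain p u1 s i c d where q1: "p \<in> \<P>" "u1 \<in> \<U>" "quad p A u1 s i c d" using A unfolding \<H>_def by blast
  have ty1: "\<guillemotleft>i : p \<rightarrow> A\<guillemotright>" "\<guillemotleft>c : A \<rightarrow> u1\<guillemotright>" using quad_arr[OF q1(3)] by blast+
  have "r \<cdot> i = Zero C p v" by (rule PT_Zero[OF q1(1) N_end[OF q n]]) (use ty1 r in simp)
  then obtain r' where r': "\<guillemotleft>r' : u1 \<rightarrow> v\<guillemotright>" "r' \<cdot> c = r" using quad_desc_second[OF q1(3) r(1)] by blast
  have "(m \<cdot> r') \<cdot> c = u \<boxminus> (b' \<cdot> a)" unfolding r(2)[symmetric] r'(2)[symmetric] using ty(1) ty1 r'(1) by simp
  then have "u \<boxminus> (b' \<cdot> a) \<in> J A K" using JI[OF q1(2) ty1(2), of "m \<cdot> r'" K] ty(1) r'(1) by simp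
  moreover have "neg (b' \<cdot> a) \<in> J A K"
    using J_diff[OF Ob(1,3) J_Zero[OF Ob(1,3)] JI[OF ab(1,2) b'(1)]] b'(1) ab(2) by (simp add: diff_def)
  ultimately have "(u \<boxminus> (b' \<cdot> a)) \<boxminus> neg (b' \<cdot> a) \<in> J A K" by (rule J_diff[OF Ob(1,3)])
  then show ?thesis using u b'(1) ab(2) by (simp add: diff_def plus_assoc)
qed

text \<open>
  Start from \<open>p \<rightarrow> K \<rightarrow> t\<close> and replace \<open>t\<close> by its \<open>\<U>\<close>-approximation: \<open>L\<close> is the fibre of \<open>K \<rightarrow> t \<rightarrow> n\<close>, and the
  triangle of fibres shows \<open>L \<in> \<P> * \<U>\<close>. Maps from \<open>\<H>\<close> to \<open>K\<close> lift to \<open>L\<close> because in \<open>t\<close> they factor through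
  \<open>\<U>\<close>, so that they vanish in \<open>n\<close>.
\<close>

lemma coreflection:
  assumes K: "K \<in> Ob C"
  obtains v L n m k x where "L \<in> \<H>" "n \<in> \<N>" "quad v L K n m k x"
    "\<And>A g. A \<in> \<H> \<Longrightarrow> \<guillemotleft>g : A \<rightarrow> K\<guillemotright> \<Longrightarrow> \<exists>g'. \<guillemotleft>g' : A \<rightarrow> L\<guillemotright> \<and> k \<cdot> g' = g"
proof -
  obtain p t s i c d where q: "p \<in> \<P>" "t \<in> \<T>" "quad p K t s i c d" using PT_ex[OF K] by blast
  have ty: "\<guillemotleft>c : K \<rightarrow> t\<guillemotright>" using quad_arr[OF q(3)] by blast
  obtain u n w j y e where q': "u \<in> \<U>" "n \<in> \<N>" "quad u t n w j y e" using UN_ex[of t] q(2) class_Ob(2) by blast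
  have ty': "\<guillemotleft>y : t \<rightarrow> n\<guillemotright>" using quad_arr[OF q'(3)] by blast
  have yc: "\<guillemotleft>y \<cdot> c : K \<rightarrow> n\<guillemotright>" using ty ty' by simp
  obtain v L m k where q2: "quad v L K n m k (y \<cdot> c)" using quad_ex_last[OF yc] by blast
  obtain V z where q3: "quad L K n V k (y \<cdot> c) z" using quad_rotate[OF q2] by blast
  obtain f g h where "quad p L u s f g h" using quad_fibres[OF q(3) q'(3) q3] by blast
  moreover have "L \<in> Ob C" using quad_arr[OF q3] by simp
  ultimately have L: "L \<in> \<H>" unfolding \<H>_def using q(1) q'(1) by blast
  have "\<exists>g'. \<guillemotleft>g' : A \<rightarrow> L\<guillemotright> \<and> k \<cdot> g' = g" if A: "A \<in> \<H>" and g: "\<guillemotleft>g : A \<rightarrow> K\<guillemotright>" for A g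
  proof -
    obtain p1 u1 s1 i1 c1 d1 where q1: "p1 \<in> \<P>" "u1 \<in> \<U>" "quad p1 A u1 s1 i1 c1 d1" using A unfolding \<H>_def by blast
    have ty1: "\<guillemotleft>i1 : p1 \<rightarrow> A\<guillemotright>" "\<guillemotleft>c1 : A \<rightarrow> u1\<guillemotright>" using quad_arr[OF q1(3)] by blast+
    have cg: "\<guillemotleft>c \<cdot> g : A \<rightarrow> t\<guillemotright>" using ty g by simp
    have "(c \<cdot> g) \<cdot> i1 = Zero C p1 t" by (rule PT_Zero[OF q1(1) q(2)]) (use ty1 cg ty g in simp)
    then obtain r where r: "\<guillemotleft>r : u1 \<rightarrow> t\<guillemotright>" "r \<cdot> c1 = c \<cdot> g" using quad_desc_second[OF q1(3) cg] by blast
    have yr: "y \<cdot> r = Zero C u1 n" by (rule UN_Zero[OF q1(2) q'(2)]) (use r ty' in simp)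
    have "(y \<cdot> c) \<cdot> g = y \<cdot> (c \<cdot> g)" using ty ty' g by simp
    also have "\<dots> = (y \<cdot> r) \<cdot> c1" unfolding r(2)[symmetric] using ty' r(1) ty1 by simp
    also have "\<dots> = Zero C A n" unfolding yr using ty1 ty' by simp
    finally show ?thesis by (rule quad_lift_third[OF q2 g])
  qed
  with that[OF L q'(2) q2] show thesis by blast
qed

text \<open>
  Here \<open>y : Y \<rightarrow> n\<close> detects maps in \<open>J\<close>, so the fibre \<open>l : M \<rightarrow> A\<close> of \<open>y \<cdot> f\<close> has the universal property of the
  kernel except that \<open>M\<close> may lie outside \<open>\<H>\<close>; its coreflection \<open>K\<close> repairs this. The composite \<open>K \<rightarrow> A\<close> still
  has cone in \<open>\<N>\<close>, as an extension of two such cones. For the weak pushout along \<open>g : K \<rightarrow> B\<close> the cone \<open>E\<close> of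
  \<open>v2 \<rightarrow> K \<rightarrow> B\<close> is coreflected in the same way; the square commutes after mapping to \<open>E\<close>, hence modulo \<open>J\<close>.
\<close>

lemma ex_kernel_mod:
  assumes A: "A \<in> \<H>" and Y: "Y \<in> \<H>" and f: "\<guillemotleft>f : A \<rightarrow> Y\<guillemotright>"
  shows "\<exists>K k. H.kernel_mod K A Y k f \<and>
    (\<forall>B \<in> \<H>. \<forall>g. \<guillemotleft>g : K \<rightarrow> B\<guillemotright> \<longrightarrow>
      (\<exists>P q a. H.monic_mod B P q \<and> \<guillemotleft>a : A \<rightarrow> P\<guillemotright> \<and> (a \<cdot> k) \<boxminus> (q \<cdot> g) \<in> J K P))"
proof -
  obtain u n w j y e where q: "u \<in> \<U>" "n \<in> \<N>" "quad u Y n w j y e" using UN_ex[of Y] Y class_Ob(5) by blast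
  have ty: "\<guillemotleft>y : Y \<rightarrow> n\<guillemotright>" using quad_arr[OF q(3)] by blast
  have yf: "\<guillemotleft>y \<cdot> f : A \<rightarrow> n\<guillemotright>" using ty f by simp
  obtain v M m l where q1: "quad v M A n m l (y \<cdot> f)" using quad_ex_last[OF yf] by blast
  have ty1: "\<guillemotleft>l : M \<rightarrow> A\<guillemotright>" using quad_arr[OF q1] by blast
  have M: "M \<in> Ob C" using ty1 by simp
  obtain v' K n' m' r x' where K: "K \<in> \<H>" "n' \<in> \<N>" and q2: "quad v' K M n' m' r x'"
    and cor: "\<And>Z g. Z \<in> \<H> \<Longrightarrow> \<guillemotleft>g : Z \<rightarrow> M\<guillemotright> \<Longrightarrow> \<exists>g'. \<guillemotleft>g' : Z \<rightarrow> K\<guillemotright> \<and> r \<cdot> g' = g"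
    by (rule coreflection[OF M]) blast
  have ty2: "\<guillemotleft>r : K \<rightarrow> M\<guillemotright>" using quad_arr[OF q2] by blast
  have lr: "\<guillemotleft>l \<cdot> r : K \<rightarrow> A\<guillemotright>" using ty1 ty2 by simp
  obtain v2 n2 m2 x2 where q3: "quad v2 K A n2 m2 (l \<cdot> r) x2" using quad_ex[OF lr] by blast
  obtain f' g' h' where "quad v n' n2 n f' g' h'" using quad_cones[OF q2 q1 q3] by blast
  then have n2: "n2 \<in> \<N>" using N_extension q(2) K(2) by blast
  have "H.kernel_mod K A Y (l \<cdot> r) f"
  proof -
    have "((y \<cdot> f) \<cdot> l) \<cdot> r = Zero C K n" using quad_Zero[OF q1] ty2 yf by simp
    then have "y \<cdot> (f \<cdot> (l \<cdot> r)) = Zero C K n" using ty f ty1 ty2 by simp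
    then have 1: "f \<cdot> (l \<cdot> r) \<in> J K Y" using J_iff_comp_Zero[OF q(3,1,2), of "f \<cdot> (l \<cdot> r)" K] f lr by simp
    have 2: "\<exists>t. \<guillemotleft>t : Z \<rightarrow> K\<guillemotright> \<and> (l \<cdot> r) \<cdot> t = g" if Z: "Z \<in> \<H>" "\<guillemotleft>g : Z \<rightarrow> A\<guillemotright> \<and> f \<cdot> g \<in> J Z Y" for Z g
    proof -
      have g: "\<guillemotleft>g : Z \<rightarrow> A\<guillemotright>" "\<guillemotleft>f \<cdot> g : Z \<rightarrow> Y\<guillemotright>" using Z(2) f by simp_all
      have "(y \<cdot> f) \<cdot> g = Zero C Z n" using J_iff_comp_Zero[OF q(3,1,2) g(2)] Z(2) ty f g(1) by simp
      then obtain t where t: "\<guillemotleft>t : Z \<rightarrow> M\<guillemotright>" "l \<cdot> t = g" using quad_lift_third[OF q1 g(1)] by blast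
      obtain t' where t': "\<guillemotleft>t' : Z \<rightarrow> K\<guillemotright>" "r \<cdot> t' = t" using cor[OF Z(1) t(1)] by blast
      have "(l \<cdot> r) \<cdot> t' = g" unfolding t(2)[symmetric] t'(2)[symmetric] using ty1 ty2 t'(1) by simp
      then show ?thesis using t'(1) by blast
    qed
    have 3: "t \<in> J Z K" if "Z \<in> \<H>" "\<guillemotleft>t : Z \<rightarrow> K\<guillemotright> \<and> (l \<cdot> r) \<cdot> t \<in> J Z A" for Z t
      using N_inflation_monic[OF q3 n2 that(1)] that(2) by blast
    show ?thesis unfolding H.kernel_mod_def using K(1) A Y lr f 1 2 3 by blast
  qed
  moreover have "\<exists>P q a. H.monic_mod B P q \<and> \<guillemotleft>a : A \<rightarrow> P\<guillemotright> \<and> (a \<cdot> (l \<cdot> r)) \<boxminus> (q \<cdot> g) \<in> J K P"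
    if B: "B \<in> \<H>" and g: "\<guillemotleft>g : K \<rightarrow> B\<guillemotright>" for B g
  proof -
    have ty3: "\<guillemotleft>m2 : v2 \<rightarrow> K\<guillemotright>" using quad_arr[OF q3] by blast
    then have gm: "\<guillemotleft>g \<cdot> m2 : v2 \<rightarrow> B\<guillemotright>" using g by simp
    obtain E n3 b z where q4: "quad v2 B E n3 (g \<cdot> m2) b z" using quad_ex_first[OF gm] by blast
    have n3: "n3 \<in> \<N>" using quad_ends[OF q4 q3] n2 by blast
    have ty4: "\<guillemotleft>b : B \<rightarrow> E\<guillemotright>" using quad_arr[OF q4] by blast
    have E: "E \<in> Ob C" using ty4 by simp
    have bg: "\<guillemotleft>b \<cdot> g : K \<rightarrow> E\<guillemotright>" using ty4 g by simp
    have "(b \<cdot> g) \<cdot> m2 = Zero C v2 E" using quad_Zero[OF q4] ty4 g ty3 by simp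
    then obtain a where a: "\<guillemotleft>a : A \<rightarrow> E\<guillemotright>" "a \<cdot> (l \<cdot> r) = b \<cdot> g" using quad_desc_second[OF q3 bg] by blast
    obtain v5 P n5 m5 o5 x5 where P: "P \<in> \<H>" "n5 \<in> \<N>" and q5: "quad v5 P E n5 m5 o5 x5"
      and cor': "\<And>Z g. Z \<in> \<H> \<Longrightarrow> \<guillemotleft>g : Z \<rightarrow> E\<guillemotright> \<Longrightarrow> \<exists>g'. \<guillemotleft>g' : Z \<rightarrow> P\<guillemotright> \<and> o5 \<cdot> g' = g"
      by (rule coreflection[OF E]) blast
    have ty5: "\<guillemotleft>o5 : P \<rightarrow> E\<guillemotright>" using quad_arr[OF q5] by blast
    obtain b' where b': "\<guillemotleft>b' : B \<rightarrow> P\<guillemotright>" "o5 \<cdot> b' = b" using cor'[OF B ty4] by blast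
    obtain a' where a': "\<guillemotleft>a' : A \<rightarrow> P\<guillemotright>" "o5 \<cdot> a' = a" using cor'[OF A a(1)] by blast
    have "t \<in> J Z B" if Z: "Z \<in> \<H>" "\<guillemotleft>t : Z \<rightarrow> B\<guillemotright> \<and> b' \<cdot> t \<in> J Z P" for Z t
    proof -
      have t: "\<guillemotleft>t : Z \<rightarrow> B\<guillemotright>" using Z(2) by blast
      have "o5 \<cdot> (b' \<cdot> t) \<in> J Z E" using J_comp_left[OF _ ty5] Z class_Ob(5) by blast
      moreover have "o5 \<cdot> (b' \<cdot> t) = b \<cdot> t" unfolding b'(2)[symmetric] using ty5 b'(1) t by simp
      ultimately show ?thesis using N_inflation_monic[OF q4 n3 Z(1) t] by simp
    qed
    then have "H.monic_mod B P b'" unfolding H.monic_mod_def using B P(1) b'(1) by blast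
    moreover have "(a' \<cdot> (l \<cdot> r)) \<boxminus> (b' \<cdot> g) \<in> J K P"
    proof (rule N_inflation_monic[OF q5 P(2) K(1)])
      show "\<guillemotleft>(a' \<cdot> (l \<cdot> r)) \<boxminus> (b' \<cdot> g) : K \<rightarrow> P\<guillemotright>" using a'(1) lr b'(1) g by simp
      have "o5 \<cdot> ((a' \<cdot> (l \<cdot> r)) \<boxminus> (b' \<cdot> g)) = ((o5 \<cdot> a') \<cdot> (l \<cdot> r)) \<boxminus> ((o5 \<cdot> b') \<cdot> g)"
        using a'(1) lr b'(1) g ty5 by (simp add: comp_diff)
      also have "\<dots> = Zero C K E" unfolding a'(2) b'(2) a(2) using bg by simp
      finally show "o5 \<cdot> ((a' \<cdot> (l \<cdot> r)) \<boxminus> (b' \<cdot> g)) \<in> J K E" using J_Zero[of K E] bg by simp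
    qed
    ultimately show ?thesis using a'(1) by blast
  qed
  ultimately show ?thesis by blast
qed

theorem heart_quasi_abelian: "quasi_abelian_category (quotient_category (full_subcategory C \<H>) J)"
proof -
  obtain Z where Z: "zero_object C Z" using ex_zero_object by blast
  show ?thesis
  proof (rule H.quotient_quasi_abelian[OF Z zero_object_in_H[OF Z] _ ex_cokernel_mod ex_kernel_mod])
    fix A B assume "A \<in> \<H>" "B \<in> \<H>"
    then show "\<exists>P \<in> \<H>. direct_sum C A B P"
      using ex_direct_sum[of A B] direct_sum_in_H class_Ob(5) by blast
  qed
qed

end

section \<open>Opposite categories\<close>

definition op_category :: "('o, 'm, 'x) precat_scheme \<Rightarrow> ('o, 'm) precat"
  where "op_category C = \<lparr>Ob = Ob C, Hom = (\<lambda>X Y. Hom C Y X), Comp = (\<lambda>g f. f \<cdot>\<^bsub>C\<^esub> g), Idn = Idn C,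
    Zero = (\<lambda>X Y. Zero C Y X), Plus = Plus C\<rparr>"

lemma op_category_simps [simp]:
  "Ob (op_category C) = Ob C" "Hom (op_category C) X Y = Hom C Y X"
  "g \<cdot>\<^bsub>op_category C\<^esub> f = f \<cdot>\<^bsub>C\<^esub> g" "Idn (op_category C) = Idn C"
  "Zero (op_category C) X Y = Zero C Y X" "Plus (op_category C) = Plus C"
  by (simp_all add: op_category_def)

lemma op_op_category: "op_category (op_category C) = C" for C :: "('o, 'm) precat"
  by (simp add: op_category_def)

lemma hom_group_op: "hom_group (op_category C) X Y = hom_group C Y X"
  by (simp add: hom_group_def)

lemma preadditive_op:
  assumes "preadditive_category C"
  shows "preadditive_category (op_category C)"
proof -
  interpret preadditive_category C by fact
  show ?thesis
  proof (rule preadditive_category.intro)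
    fix X Y Z A f g h assume "X \<in> Ob (op_category C)" "Y \<in> Ob (op_category C)" "Z \<in> Ob (op_category C)"
      "A \<in> Ob (op_category C)" "f \<in> Hom (op_category C) X Y" "g \<in> Hom (op_category C) Y Z" "h \<in> Hom (op_category C) Z A"
    then show "(h \<cdot>\<^bsub>op_category C\<^esub> g) \<cdot>\<^bsub>op_category C\<^esub> f = h \<cdot>\<^bsub>op_category C\<^esub> (g \<cdot>\<^bsub>op_category C\<^esub> f)"
      using comp_assoc[of A Z Y X h g f] by simp
  next
    fix X Y X' Y' f assume "X \<in> Ob (op_category C)" "Y \<in> Ob (op_category C)" "X' \<in> Ob (op_category C)"
      "Y' \<in> Ob (op_category C)" "f \<in> Hom (op_category C) X Y" "f \<in> Hom (op_category C) X' Y'"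
    then show "X = X' \<and> Y = Y'" using hom_disjoint[of Y X Y' X' f] by simp
  qed (auto simp: hom_group_op idn_in_hom comp_in_hom comp_idn idn_comp hom_comm_group comp_plus plus_comp)
qed

lemma arr_op:
  assumes "preadditive_category C"
  shows "preadditive_category.arr (op_category C) f X Y \<longleftrightarrow> preadditive_category.arr C f Y X"
  using preadditive_category.arr_def[OF assms] preadditive_category.arr_def[OF preadditive_op[OF assms]] by auto

lemma zero_object_op: "zero_object (op_category C) Z \<longleftrightarrow> zero_object C Z"
  by (auto simp: zero_object_def)

lemma direct_sum_op:
  assumes "direct_sum C A B P"
  shows "direct_sum (op_category C) A B P"
proof -
  obtain i j p q where "i \<in> Hom C A P" "j \<in> Hom C B P" "p \<in> Hom C P A" "q \<in> Hom C P B"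
    "p \<cdot>\<^bsub>C\<^esub> i = Idn C A" "q \<cdot>\<^bsub>C\<^esub> j = Idn C B" "p \<cdot>\<^bsub>C\<^esub> j = Zero C B A" "q \<cdot>\<^bsub>C\<^esub> i = Zero C A B"
    "(i \<cdot>\<^bsub>C\<^esub> p) \<boxplus>\<^bsub>C\<^esub> (j \<cdot>\<^bsub>C\<^esub> q) = Idn C P" and "A \<in> Ob C" "B \<in> Ob C" "P \<in> Ob C"
    using assms unfolding direct_sum_def by blast
  then show ?thesis
    unfolding direct_sum_def op_category_simps
    by (intro conjI bexI[of _ p] bexI[of _ q] bexI[of _ i] bexI[of _ j]) assumption+
qed

lemma additive_op:
  assumes "additive_category C"
  shows "additive_category (op_category C)"
proof -
  interpret additive_category C by fact
  show ?thesis
  proof (rule additive_category.intro[OF preadditive_op[OF preadditive_category_axioms]], rule additive_category_axioms.intro)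
    show "\<exists>Z. zero_object (op_category C) Z" unfolding zero_object_op by (rule ex_zero_object)
    show "\<exists>P. direct_sum (op_category C) A B P" if "A \<in> Ob (op_category C)" "B \<in> Ob (op_category C)" for A B
      using ex_direct_sum[of A B] direct_sum_op that by fastforce
  qed
qed

lemma is_kernel_op: "is_kernel (op_category C) K X Y k f \<longleftrightarrow> is_cokernel C Y X K f k"
  unfolding is_kernel_def is_cokernel_def op_category_simps by (rule iffI; elim conjE; intro conjI; assumption)

lemma is_cokernel_op: "is_cokernel (op_category C) X Y Q f c \<longleftrightarrow> is_kernel C Q Y X c f"
  unfolding is_kernel_def is_cokernel_def op_category_simps by (rule iffI; elim conjE; intro conjI; assumption)

lemma kernel_arrow_op: "kernel_arrow (op_category C) K X k \<longleftrightarrow> cokernel_arrow C X K k"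
  and cokernel_arrow_op: "cokernel_arrow (op_category C) Y Q c \<longleftrightarrow> kernel_arrow C Q Y c"
  unfolding kernel_arrow_def cokernel_arrow_def is_kernel_op is_cokernel_op by (rule refl)+

lemma is_pullback_op: "is_pullback (op_category C) P A B D p q f g \<Longrightarrow> is_pushout C D A B P f g p q"
  unfolding is_pullback_def is_pushout_def op_category_simps by (elim conjE, intro conjI; assumption)

lemma is_pushout_op: "is_pushout (op_category C) D A B P f g p q \<Longrightarrow> is_pullback C P A B D p q f g"
  unfolding is_pullback_def is_pushout_def op_category_simps by (elim conjE, intro conjI; assumption)

lemma quasi_abelian_op:
  assumes "quasi_abelian_category C"
  shows "quasi_abelian_category (op_category C)"
proof -
  interpret quasi_abelian_category C by fact
  have "preabelian_category (op_category C)"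
  proof (rule preabelian_category.intro[OF additive_op[OF additive_category_axioms]], rule preabelian_category_axioms.intro)
    fix X Y f assume "X \<in> Ob (op_category C)" "Y \<in> Ob (op_category C)" "f \<in> Hom (op_category C) X Y"
    then show "\<exists>K k. is_kernel (op_category C) K X Y k f" "\<exists>Q c. is_cokernel (op_category C) X Y Q f c"
      unfolding is_kernel_op is_cokernel_op using ex_kernel[of Y X f] ex_cokernel[of Y X f] by simp_all
  qed
  then show ?thesis
  proof (rule quasi_abelian_category.intro, intro quasi_abelian_category_axioms.intro)
    fix P A B D p q f g
    assume pb: "is_pullback (op_category C) P A B D p q f g" and c: "cokernel_arrow (op_category C) A D f"
    show "cokernel_arrow (op_category C) P B q"
      using kernels_stable_under_pushout[OF is_pullback_op[OF pb]] c unfolding cokernel_arrow_op by blast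
  next
    fix D A B P f g p q
    assume po: "is_pushout (op_category C) D A B P f g p q" and k: "kernel_arrow (op_category C) D A f"
    show "kernel_arrow (op_category C) B P q"
      using cokernels_stable_under_pullback[OF is_pushout_op[OF po]] k unfolding kernel_arrow_op by blast
  qed
qed

lemma factor_ideal_op: "factor_ideal (op_category C) \<W> X Y = factor_ideal C \<W> Y X"
  unfolding factor_ideal_def op_category_simps by blast

text \<open>
  An equality of categories, not merely an equivalence: both sides have the same cosets as arrows.
\<close>

lemma quotient_op:
  fixes C :: "('o, 'm, 'x) precat_scheme"
  shows "quotient_category (full_subcategory (op_category C) \<X>) (factor_ideal (op_category C) \<W>) =
    op_category (quotient_category (full_subcategory C \<X>) (factor_ideal C \<W>))"
proof -
  have comp: "(\<exists>X Y Z f g. U = R X Z f g \<and> X \<in> \<X> \<and> Y \<in> \<X> \<and> Z \<in> \<X> \<and> P Y X f \<and> Q Z Y g) \<longleftrightarrow>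
      (\<exists>X Y Z g f. U = R Z X f g \<and> X \<in> \<X> \<and> Y \<in> \<X> \<and> Z \<in> \<X> \<and> Q X Y g \<and> P Y Z f)"
    for U and R :: "'o \<Rightarrow> 'o \<Rightarrow> 'm \<Rightarrow> 'm \<Rightarrow> 'm set" and P Q
    by metis
  show ?thesis (is "?L = ?R")
  proof (rule precat.equality)
    have "G \<cdot>\<^bsub>?L\<^esub> F = G \<cdot>\<^bsub>?R\<^esub> F" for G F
      unfolding quotient_category_def hom_group_full hom_group_op factor_ideal_op
      by (simp add: full_subcategory_def del: Int_iff) (rule arg_cong[where f = Union], rule Collect_cong, rule comp)
    then show "Comp ?L = Comp ?R" by (intro ext)
  qed (unfold quotient_category_def hom_group_full hom_group_op factor_ideal_op, simp_all add: full_subcategory_def op_category_def)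
qed

section \<open>Duality for exact quadruples\<close>

lemma (in exact_quadruples) exact_quadruples_op:
  "exact_quadruples (op_category C) (\<lambda>X Y Z W f g h. quad W Z Y X h g f)"
proof -
  note pre = preadditive_category_axioms
  show ?thesis
  proof (rule exact_quadruples.intro[OF additive_op[OF additive_category_axioms]], rule exact_quadruples_axioms.intro,
      unfold arr_op[OF pre] op_category_simps)
    fix X Y Z W f g h assume q: "quad W Z Y X h g f"
    show "\<guillemotleft>f : Y \<rightarrow> X\<guillemotright> \<and> \<guillemotleft>g : Z \<rightarrow> Y\<guillemotright> \<and> \<guillemotleft>h : W \<rightarrow> Z\<guillemotright>" using quad_arr[OF q] by blast
    show "f \<cdot> g = Zero C Z X \<and> g \<cdot> h = Zero C W Y" using quad_Zero[OF q] by blast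
    show "\<exists>v. \<guillemotleft>v : X \<rightarrow> A\<guillemotright> \<and> v \<cdot> f = u" if "\<guillemotleft>u : Y \<rightarrow> A\<guillemotright>" "u \<cdot> g = Zero C Z A" for u A
      by (rule quad_desc[OF q that])
    show "\<exists>v. \<guillemotleft>v : A \<rightarrow> W\<guillemotright> \<and> h \<cdot> v = u" if "\<guillemotleft>u : A \<rightarrow> Z\<guillemotright>" "g \<cdot> u = Zero C A Y" for u A
      by (rule quad_lift[OF q that])
    show "\<exists>V k. quad V W Z Y k h g" by (rule quad_unrotate[OF q])
    show "\<exists>V k. quad Z Y X V g f k" by (rule quad_rotate[OF q])
    fix X' Y' Z' W' f' g' h' assume "quad W' Z' Y' X' h' g' f'"
    from quad_ends[OF q this] show "X = X' \<longleftrightarrow> W = W'" by blast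
  next
    fix Y Z g assume "\<guillemotleft>g : Z \<rightarrow> Y\<guillemotright>"
    then show "\<exists>X W f h. quad W Z Y X h g f" using quad_ex by blast
  next
    fix X1 Y Z W1 f1 g1 h1 X2 Z' W2 f2 g2 h2 X3 W3 f3 h3
    assume "quad W1 Z Y X1 h1 g1 f1" "quad W2 Z' Z X2 h2 g2 f2" "quad W3 Z' Y X3 h3 (g1 \<cdot> g2) f3"
    from quad_fibres[OF this(2,1,3)] show "\<exists>f g h. quad W2 W3 W1 X2 h g f" by blast
  qed
qed

lemma (in twin_classes) twin_classes_op:
  "twin_classes (op_category C) (\<lambda>X Y Z W f g h. quad W Z Y X h g f) \<N> \<U> \<T> \<P>"
proof -
  note pre = preadditive_category_axioms
  show ?thesis
  proof (rule twin_classes.intro[OF exact_quadruples_op], rule twin_classes_axioms.intro,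
      unfold arr_op[OF pre] op_category_simps)
    show "\<N> \<subseteq> Ob C" "\<U> \<subseteq> Ob C" "\<T> \<subseteq> Ob C" "\<P> \<subseteq> Ob C" by (rule classes_Ob)+
    show "f = Zero C t p" if "p \<in> \<N>" "t \<in> \<U>" "\<guillemotleft>f : t \<rightarrow> p\<guillemotright>" for p t f by (rule UN_Zero[OF that(2,1,3)])
    show "f = Zero C n u" if "u \<in> \<T>" "n \<in> \<P>" "\<guillemotleft>f : n \<rightarrow> u\<guillemotright>" for u n f by (rule PT_Zero[OF that(2,1,3)])
  next
    fix M assume M: "M \<in> Ob C"
    obtain u n W f g h where "u \<in> \<U>" "n \<in> \<N>" and q: "quad u M n W f g h" using UN_ex[OF M] by blast
    moreover obtain V k where "quad V u M n k f g" using quad_unrotate[OF q] by blast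
    ultimately show "\<exists>p \<in> \<N>. \<exists>t \<in> \<U>. \<exists>W f g h. quad W t M p h g f" by blast
    obtain p t W f g h where "p \<in> \<P>" "t \<in> \<T>" and q: "quad p M t W f g h" using PT_ex[OF M] by blast
    moreover obtain V k where "quad V p M t k f g" using quad_unrotate[OF q] by blast
    ultimately show "\<exists>u \<in> \<T>. \<exists>n \<in> \<P>. \<exists>W f g h. quad W n M u h g f" by blast
    show "M \<in> \<N>" if "\<And>t f. t \<in> \<U> \<Longrightarrow> \<guillemotleft>f : t \<rightarrow> M\<guillemotright> \<Longrightarrow> f = Zero C t M" by (rule N_orth[OF M that])
    show "M \<in> \<U>" if "\<And>p f. p \<in> \<N> \<Longrightarrow> \<guillemotleft>f : M \<rightarrow> p\<guillemotright> \<Longrightarrow> f = Zero C M p" by (rule U_orth[OF M that])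
    show "M \<in> \<T>" if "\<And>n f. n \<in> \<P> \<Longrightarrow> \<guillemotleft>f : n \<rightarrow> M\<guillemotright> \<Longrightarrow> f = Zero C n M" by (rule T_orth[OF M that])
    show "M \<in> \<P>" if "\<And>u f. u \<in> \<T> \<Longrightarrow> \<guillemotleft>f : M \<rightarrow> u\<guillemotright> \<Longrightarrow> f = Zero C M u" by (rule P_orth[OF M that])
  next
    fix X Y Z W f g h assume q: "quad W Z Y X h g f"
    show "W \<in> \<T>" if "X \<in> \<N>" by (rule N_end[OF q that])
    show "X \<in> \<U>" if "W \<in> \<P>" by (rule P_end[OF q that])
  qed
qed

section \<open>Triangles as exact quadruples\<close>

context triangulated_category
begin

lemma S_Ob [simp]: "X \<in> Ob C \<Longrightarrow> SOb C X \<in> Ob C"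
  using S_bij_ob by (auto simp: bij_betw_def)

lemma S_Ob_inj: "X \<in> Ob C \<Longrightarrow> Y \<in> Ob C \<Longrightarrow> SOb C X = SOb C Y \<longleftrightarrow> X = Y"
  using S_bij_ob by (auto simp: bij_betw_def inj_on_def)

lemma S_Ob_surj:
  assumes "Y \<in> Ob C"
  obtains X where "X \<in> Ob C" "SOb C X = Y"
proof -
  have "Y \<in> SOb C ` Ob C" using S_bij_ob assms by (simp add: bij_betw_def)
  then show thesis using that by blast
qed

lemma S_arr:
  assumes "\<guillemotleft>f : X \<rightarrow> Y\<guillemotright>"
  shows "\<guillemotleft>SArr C f : SOb C X \<rightarrow> SOb C Y\<guillemotright>"
proof -
  have XY: "X \<in> Ob C" "Y \<in> Ob C" using assms by simp_all
  have "SArr C f \<in> Hom C (SOb C X) (SOb C Y)"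
    using S_bij_hom[OF XY] assms unfolding arr_def bij_betw_def by blast
  then show ?thesis using XY by (simp add: hom_iff_arr)
qed

lemma S_type [simp]:
  assumes "Arr f"
  shows "Arr (SArr C f)" "src (SArr C f) = SOb C (src f)" "trg (SArr C f) = SOb C (trg f)"
  using S_arr[of f "src f" "trg f"] assms by simp_all

lemma S_inj:
  assumes "\<guillemotleft>f : X \<rightarrow> Y\<guillemotright>" "\<guillemotleft>g : X \<rightarrow> Y\<guillemotright>" "SArr C f = SArr C g"
  shows "f = g"
  using S_bij_hom[of X Y] assms unfolding bij_betw_def inj_on_def arr_def by blast

lemma S_surj:
  assumes "\<guillemotleft>g : SOb C X \<rightarrow> SOb C Y\<guillemotright>" "X \<in> Ob C" "Y \<in> Ob C"
  obtains f where "\<guillemotleft>f : X \<rightarrow> Y\<guillemotright>" "SArr C f = g"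
proof -
  have "g \<in> SArr C ` Hom C X Y"
    using S_bij_hom[OF assms(2,3)] assms(1) unfolding bij_betw_def arr_def by simp
  then show thesis using that assms(2,3) unfolding arr_def by blast
qed

lemma S_Comp:
  assumes "Arr f" "Arr g" "trg f = src g"
  shows "SArr C (g \<cdot> f) = SArr C g \<cdot> SArr C f"
  using S_comp[of "src f" "src g" "trg g" f g] Arr_hom[OF assms(1)] Arr_hom[OF assms(2)] assms by simp

lemma S_Plus:
  assumes "Arr f" "Arr g" "src f = src g" "trg f = trg g"
  shows "SArr C (f \<boxplus> g) = SArr C f \<boxplus> SArr C g"
  using S_plus[of "src g" "trg g" f g] Arr_hom[OF assms(1)] Arr_hom[OF assms(2)] assms by simp

lemma S_Zero:
  assumes "X \<in> Ob C" "Y \<in> Ob C"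
  shows "SArr C (Zero C X Y) = Zero C (SOb C X) (SOb C Y)"
proof -
  have "SArr C (Zero C X Y) \<boxplus> SArr C (Zero C X Y) = SArr C (Zero C X Y)"
    using S_Plus[of "Zero C X Y" "Zero C X Y"] assms by simp
  from plus_self_zero[OF _ this] show ?thesis using assms by simp
qed

lemma triangle_arr:
  assumes "triangle C X Y Z f g h"
  shows "\<guillemotleft>f : X \<rightarrow> Y\<guillemotright>" "\<guillemotleft>g : Y \<rightarrow> Z\<guillemotright>" "\<guillemotleft>h : Z \<rightarrow> SOb C X\<guillemotright>"
  using assms S_Ob unfolding triangle_def arr_def by blast+

lemma triangle_rotate_iff:
  assumes "\<guillemotleft>f : X \<rightarrow> Y\<guillemotright>" "\<guillemotleft>g : Y \<rightarrow> Z\<guillemotright>" "\<guillemotleft>h : Z \<rightarrow> SOb C X\<guillemotright>"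
  shows "triangle C X Y Z f g h \<longleftrightarrow> triangle C Y Z (SOb C X) g h (neg (SArr C f))"
proof -
  have "neg (SArr C f) = inv\<^bsub>hom_group C (SOb C X) (SOb C Y)\<^esub> (SArr C f)"
    using S_arr[OF assms(1)] by (simp add: neg_def)
  then show ?thesis using triangle_rotate[of X Y Z f g h] assms unfolding arr_def by simp
qed

lemma is_iso_Idn:
  assumes "X \<in> Ob C"
  shows "is_iso C X X (Idn C X)"
  unfolding is_iso_def using assms idn_in_hom[OF assms] by (intro conjI bexI[of _ "Idn C X"]) simp_all

lemma is_iso_neg_Idn:
  assumes "X \<in> Ob C"
  shows "is_iso C X X (neg (Idn C X))"
proof -
  have "neg (Idn C X) \<in> Hom C X X" using assms by (simp add: hom_iff_arr)
  then show ?thesis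
    unfolding is_iso_def using assms by (intro conjI bexI[of _ "neg (Idn C X)"]) (simp_all add: neg_comp comp_neg)
qed

text \<open>Changing two signs is an isomorphism of triangles; a single sign can only be moved.\<close>

lemma triangle_neg:
  assumes t: "triangle C X Y Z f g h"
  shows "triangle C X Y Z f (neg g) (neg h)"
proof -
  note ty = triangle_arr[OF t]
  have Ob: "X \<in> Ob C" "Y \<in> Ob C" "Z \<in> Ob C" using ty by simp_all
  show ?thesis
  proof (rule triangle_iso[OF t Ob])
    show "f \<in> Hom C X Y" "neg g \<in> Hom C Y Z" "neg h \<in> Hom C Z (SOb C X)"
      using ty by (simp_all add: hom_iff_arr)
    show "is_iso C X X (Idn C X)" "is_iso C Y Y (Idn C Y)" "is_iso C Z Z (neg (Idn C Z))"
      using Ob is_iso_Idn is_iso_neg_Idn by blast+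
    show "f \<cdot> Idn C X = Idn C Y \<cdot> f" "neg g \<cdot> Idn C Y = neg (Idn C Z) \<cdot> g"
      "neg h \<cdot> neg (Idn C Z) = SArr C (Idn C X) \<cdot> h"
      using ty by (simp_all add: neg_comp comp_neg S_idn)
  qed
qed

lemma triangle_comp_Zero:
  assumes t: "triangle C X Y Z f g h"
  shows "g \<cdot> f = Zero C X Z"
proof -
  note ty = triangle_arr[OF t]
  obtain Z0 where Z0: "zero_object C Z0" using ex_zero_object by blast
  then have Z0_Ob: "Z0 \<in> Ob C" by (simp add: zero_object_def)
  have X: "X \<in> Ob C" using ty by simp
  obtain c where c: "c \<in> Hom C Z0 Z" "g \<cdot> f = c \<cdot> Zero C X Z0"
    using triangle_morphism[OF triangle_idn[OF X Z0] t idn_in_hom[OF X], of f] ty unfolding arr_def by blast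
  have "\<guillemotleft>c : Z0 \<rightarrow> Z\<guillemotright>" using c(1) Z0_Ob ty by (simp add: hom_iff_arr)
  then show ?thesis unfolding c(2) using X by simp
qed

text \<open>
  Both exactness statements compare the triangle with one that contains an identity of \<open>A\<close> and a
  zero object, by the axiom on morphisms of triangles.
\<close>

lemma triangle_lift:
  assumes t: "triangle C X Y Z f g h" and u: "\<guillemotleft>u : A \<rightarrow> Y\<guillemotright>" "g \<cdot> u = Zero C A Z"
  shows "\<exists>v. \<guillemotleft>v : A \<rightarrow> X\<guillemotright> \<and> f \<cdot> v = u"
proof -
  note ty = triangle_arr[OF t]
  obtain Z0 where Z0: "zero_object C Z0" using ex_zero_object by blast
  have Ob: "Z0 \<in> Ob C" "A \<in> Ob C" "X \<in> Ob C" using Z0 u ty by (simp_all add: zero_object_def)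
  have tA: "triangle C A Z0 (SOb C A) (Zero C A Z0) (Zero C Z0 (SOb C A)) (neg (Idn C (SOb C A)))"
    using triangle_idn[OF Ob(2) Z0] triangle_rotate_iff[of "Idn C A" A A "Zero C A Z0" Z0 "Zero C Z0 (SOb C A)"] Ob
    by (simp add: S_idn)
  have tY: "triangle C Y Z (SOb C X) g h (neg (SArr C f))" using triangle_rotate_iff[OF ty] t by blast
  have "u \<in> Hom C A Y" "Zero C Z0 Z \<in> Hom C Z0 Z" "g \<cdot> u = Zero C Z0 Z \<cdot> Zero C A Z0"
    using u Ob ty by (simp_all add: hom_iff_arr)
  then obtain c where c: "c \<in> Hom C (SOb C A) (SOb C X)" "neg (SArr C f) \<cdot> c = SArr C u \<cdot> neg (Idn C (SOb C A))"
    using triangle_morphism[OF tA tY] by blast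
  have c': "\<guillemotleft>c : SOb C A \<rightarrow> SOb C X\<guillemotright>" using c(1) Ob by (simp add: hom_iff_arr)
  obtain v where v: "\<guillemotleft>v : A \<rightarrow> X\<guillemotright>" "SArr C v = c" by (rule S_surj[OF c' Ob(2,3)])
  have "neg (SArr C (f \<cdot> v)) = neg (SArr C u)"
    using c(2) unfolding v(2)[symmetric] using u(1) ty v(1) by (simp add: neg_comp comp_neg S_Comp)
  from arg_cong[OF this, of neg] have "SArr C (f \<cdot> v) = SArr C u" using u(1) ty v(1) by simp
  then have "f \<cdot> v = u" using S_inj[of "f \<cdot> v" A Y u] u(1) ty v(1) by simp
  then show ?thesis using v(1) by blast
qed

lemma triangle_desc:
  assumes t: "triangle C X Y Z f g h" and u: "\<guillemotleft>u : Y \<rightarrow> A\<guillemotright>" "u \<cdot> f = Zero C X A"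
  shows "\<exists>v. \<guillemotleft>v : Z \<rightarrow> A\<guillemotright> \<and> v \<cdot> g = u"
proof -
  note ty = triangle_arr[OF t]
  obtain Z1 where Z1: "zero_object C Z1" using ex_zero_object by blast
  have Z1_Ob: "Z1 \<in> Ob C" using Z1 by (simp add: zero_object_def)
  obtain Z0 where Z0: "Z0 \<in> Ob C" "SOb C Z0 = Z1" by (rule S_Ob_surj[OF Z1_Ob])
  have Ob: "A \<in> Ob C" "X \<in> Ob C" using u ty by simp_all
  have "\<exists>!f. f \<in> Hom C Z1 (SOb C A)" using Z1 S_Ob[OF Ob(1)] unfolding zero_object_def by blast
  moreover have "Zero C Z1 (SOb C A) \<in> Hom C Z1 (SOb C A)" "neg (SArr C (Zero C Z0 A)) \<in> Hom C Z1 (SOb C A)"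
    using Z1_Ob Z0 Ob by (simp_all add: hom_iff_arr)
  ultimately have "Zero C Z1 (SOb C A) = neg (SArr C (Zero C Z0 A))" by blast
  then have tA: "triangle C Z0 A A (Zero C Z0 A) (Idn C A) (Zero C A Z1)"
    using triangle_rotate_iff[of "Zero C Z0 A" Z0 A "Idn C A" A "Zero C A Z1"] triangle_idn[OF Ob(1) Z1] Z0 Ob Z1_Ob
    by simp
  have "Zero C X Z0 \<in> Hom C X Z0" "u \<in> Hom C Y A" "Zero C Z0 A \<cdot> Zero C X Z0 = u \<cdot> f"
    using u Ob ty Z0 by (simp_all add: hom_iff_arr)
  then obtain v where v: "v \<in> Hom C Z A" "Idn C A \<cdot> u = v \<cdot> g"
    using triangle_morphism[OF t tA] by blast
  have "\<guillemotleft>v : Z \<rightarrow> A\<guillemotright>" using v(1) ty Ob by (simp add: hom_iff_arr)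
  then show ?thesis using v(2) u(1) by auto
qed

text \<open>
  The sign of the last map is left open, since rotation produces the map \<open>- \<Sigma>f\<close>. Together with
  \<open>triangle_neg\<close> this makes the notion stable under rotation in both directions.
\<close>

definition quad :: "'o \<Rightarrow> 'o \<Rightarrow> 'o \<Rightarrow> 'o \<Rightarrow> 'm \<Rightarrow> 'm \<Rightarrow> 'm \<Rightarrow> bool"
  where "quad X Y Z W f g h \<longleftrightarrow> W = SOb C X \<and> \<guillemotleft>h : Z \<rightarrow> W\<guillemotright> \<and>
    (triangle C X Y Z f g h \<or> triangle C X Y Z f g (neg h))"

lemma quadI: "triangle C X Y Z f g h \<Longrightarrow> quad X Y Z (SOb C X) f g h"
  using triangle_arr unfolding quad_def by blast

lemma quad_triangle:
  assumes "quad X Y Z W f g h"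
  obtains h' where "triangle C X Y Z f g h'" "h' = h \<or> h' = neg h" "W = SOb C X" "\<guillemotleft>h : Z \<rightarrow> W\<guillemotright>"
  using assms unfolding quad_def by blast

lemma quad_rotated_triangle:
  assumes q: "quad X Y Z W f g h"
  obtains k where "triangle C Y Z W g h k"
proof -
  obtain h' where h': "triangle C X Y Z f g h'" "h' = h \<or> h' = neg h" "W = SOb C X" "\<guillemotleft>h : Z \<rightarrow> W\<guillemotright>"
    by (rule quad_triangle[OF q])
  have t: "triangle C Y Z W g h' (neg (SArr C f))" using triangle_rotate_iff[OF triangle_arr[OF h'(1)]] h'(1,3) by simp
  show thesis
  proof (cases "h' = h")
    case True
    then show thesis using t that by blast
  next
    case False
    then have "neg h' = h" using h'(2,4) by auto
    then show thesis using triangle_neg[OF t] that by metis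
  qed
qed

lemma quad_unrotated:
  assumes q: "quad X Y Z W f g h"
  shows "\<exists>V k. quad V X Y Z k f g"
proof -
  obtain h' where h': "triangle C X Y Z f g h'" by (rule quad_triangle[OF q])
  note ty = triangle_arr[OF h']
  have Ob: "Z \<in> Ob C" "X \<in> Ob C" using ty by simp_all
  obtain V where V: "V \<in> Ob C" "SOb C V = Z" by (rule S_Ob_surj[OF Ob(1)])
  have nh: "\<guillemotleft>neg h' : SOb C V \<rightarrow> SOb C X\<guillemotright>" using ty V by simp
  obtain k where k: "\<guillemotleft>k : V \<rightarrow> X\<guillemotright>" "SArr C k = neg h'" by (rule S_surj[OF nh V(1) Ob(2)])
  have "triangle C V X Y k f g"
    using triangle_rotate_iff[of k V X f Y g] k ty V h' by simp
  from quadI[OF this] show ?thesis unfolding V(2) by blast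
qed

lemma exact_quadruples: "exact_quadruples C quad"
proof (unfold_locales)
  fix X Y Z W f g h assume q: "quad X Y Z W f g h"
  obtain h' where h': "triangle C X Y Z f g h'" "h' = h \<or> h' = neg h" "W = SOb C X" "\<guillemotleft>h : Z \<rightarrow> W\<guillemotright>"
    by (rule quad_triangle[OF q])
  obtain k where k: "triangle C Y Z W g h k" by (rule quad_rotated_triangle[OF q])
  show "\<guillemotleft>f : X \<rightarrow> Y\<guillemotright> \<and> \<guillemotleft>g : Y \<rightarrow> Z\<guillemotright> \<and> \<guillemotleft>h : Z \<rightarrow> W\<guillemotright>"
    using triangle_arr[OF h'(1)] h'(4) by blast
  show "g \<cdot> f = Zero C X Z \<and> h \<cdot> g = Zero C Y W"
    using triangle_comp_Zero[OF h'(1)] triangle_comp_Zero[OF k] by blast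
  show "\<exists>v. \<guillemotleft>v : A \<rightarrow> X\<guillemotright> \<and> f \<cdot> v = u" if "\<guillemotleft>u : A \<rightarrow> Y\<guillemotright>" "g \<cdot> u = Zero C A Z" for u A
    by (rule triangle_lift[OF h'(1) that])
  show "\<exists>v. \<guillemotleft>v : W \<rightarrow> A\<guillemotright> \<and> v \<cdot> h = u" if "\<guillemotleft>u : Z \<rightarrow> A\<guillemotright>" "u \<cdot> g = Zero C Y A" for u A
    by (rule triangle_desc[OF k that])
  show "\<exists>V k. quad Y Z W V g h k" using quadI[OF k] by blast
  show "\<exists>V k. quad V X Y Z k f g" by (rule quad_unrotated[OF q])
  fix X' Y' Z' W' f' g' h' assume q': "quad X' Y' Z' W' f' g' h'"
  have "W = SOb C X" "W' = SOb C X'" using q q' unfolding quad_def by blast+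
  moreover have "X \<in> Ob C" "X' \<in> Ob C" using q q' unfolding quad_def triangle_def by blast+
  ultimately show "X = X' \<longleftrightarrow> W = W'" using S_Ob_inj by simp
next
  fix Y Z g assume g: "\<guillemotleft>g : Y \<rightarrow> Z\<guillemotright>"
  have "Y \<in> Ob C" "Z \<in> Ob C" "g \<in> Hom C Y Z" using g unfolding arr_def by blast+
  then obtain A a b where "triangle C Y Z A g a b" using triangle_ex by blast
  from quad_unrotated[OF quadI[OF this]] show "\<exists>X W f h. quad X Y Z W f g h" by blast
next
  fix X1 Y Z W1 f1 g1 h1 X2 Z' W2 f2 g2 h2 X3 W3 f3 h3
  assume q: "quad X1 Y Z W1 f1 g1 h1" "quad X2 Z Z' W2 f2 g2 h2" "quad X3 Y Z' W3 f3 (g2 \<cdot> g1) h3"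
  obtain k1 where k1: "triangle C Y Z W1 g1 h1 k1" by (rule quad_rotated_triangle[OF q(1)])
  obtain k2 where k2: "triangle C Z Z' W2 g2 h2 k2" by (rule quad_rotated_triangle[OF q(2)])
  obtain k3 where k3: "triangle C Y Z' W3 (g2 \<cdot> g1) h3 k3" by (rule quad_rotated_triangle[OF q(3)])
  obtain u v w where "triangle C W1 W3 W2 u v w" using octahedral[OF k1 k2 k3] by blast
  then obtain V k where r: "quad V W1 W3 W2 k u v" using quad_unrotated quadI by blast
  have "W2 = SOb C V" "W2 = SOb C X2" using r q(2) unfolding quad_def by blast+
  moreover have "V \<in> Ob C" "X2 \<in> Ob C" using r q(2) unfolding quad_def triangle_def by blast+
  ultimately have "V = X2" using S_Ob_inj by simp
  then show "\<exists>f g h. quad X2 W1 W3 W2 f g h" using r by blast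
qed

text \<open>
  A complement of the retract is the fibre \<open>B\<close> of \<open>f : P \<rightarrow> M\<close>. The remaining map \<open>h : M \<rightarrow> \<Sigma>B\<close> vanishes because \<open>f\<close>
  is split epic, and then \<open>k : B \<rightarrow> P\<close> is monic, which allows the biproduct equations to be checked after
  composition with \<open>k\<close>.
\<close>

lemma retract_direct_sum:
  assumes v: "\<guillemotleft>v : M \<rightarrow> P\<guillemotright>" and f: "\<guillemotleft>f : P \<rightarrow> M\<guillemotright>" and fv: "f \<cdot> v = Idn C M"
  obtains B where "direct_sum C M B P"
proof -
  interpret exact_quadruples C quad by (rule exact_quadruples)
  have Ob: "M \<in> Ob C" "P \<in> Ob C" using v by simp_all
  obtain B W k h where q: "quad B P M W k f h" using quad_ex[OF f] by blast
  have ty: "\<guillemotleft>k : B \<rightarrow> P\<guillemotright>" "\<guillemotleft>h : M \<rightarrow> W\<guillemotright>" using quad_arr[OF q] by blast+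
  have fk: "f \<cdot> k = Zero C B M" and hf: "h \<cdot> f = Zero C P W" using quad_Zero[OF q] by blast+
  have "h = h \<cdot> (f \<cdot> v)" unfolding fv using ty by simp
  also have "\<dots> = (h \<cdot> f) \<cdot> v" using ty f v by simp
  finally have h: "h = Zero C M W" unfolding hf using ty v by simp
  have W: "W \<in> Ob C" using ty by simp
  \<comment> \<open>\<open>k\<close> is monic, because \<open>h = 0\<close>\<close>
  have k_monic: "x = Zero C A B" if x: "\<guillemotleft>x : A \<rightarrow> B\<guillemotright>" "k \<cdot> x = Zero C A P" for A x
  proof -
    obtain h' where h': "triangle C B P M k f h'" "h' = h \<or> h' = neg h" "W = SOb C B"
      by (rule quad_triangle[OF q])
    note ty' = triangle_arr[OF h'(1)]
    have "h' = Zero C M W" using h'(2) Ob(1) W unfolding h by auto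
    then have t: "triangle C P M (SOb C B) f (Zero C M (SOb C B)) (neg (SArr C k))"
      using triangle_rotate_iff[OF ty'] h'(1,3) by simp
    then have r: "triangle C M (SOb C B) (SOb C P) (Zero C M (SOb C B)) (neg (SArr C k)) (neg (SArr C f))"
      using triangle_rotate_iff[OF triangle_arr[OF t]] by blast
    have "neg (SArr C k) \<cdot> SArr C x = neg (SArr C (k \<cdot> x))"
      using x(1) ty by (simp add: neg_comp S_Comp)
    also have "\<dots> = Zero C (SOb C A) (SOb C P)" unfolding x(2) using x(1) Ob by (simp add: S_Zero)
    finally obtain y where "\<guillemotleft>y : SOb C A \<rightarrow> M\<guillemotright>" "Zero C M (SOb C B) \<cdot> y = SArr C x"
      using triangle_lift[OF r S_arr[OF x(1)]] by blast
    then have "SArr C x = Zero C (SOb C A) (SOb C B)" using x(1) by auto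
    then have "SArr C x = SArr C (Zero C A B)" using x(1) by (simp add: S_Zero)
    then show ?thesis using S_inj[of x A B "Zero C A B"] x(1) by simp
  qed
  have 1: "\<guillemotleft>Idn C P \<boxminus> (v \<cdot> f) : P \<rightarrow> P\<guillemotright>" using v f by simp
  have "f \<cdot> (Idn C P \<boxminus> (v \<cdot> f)) = f \<boxminus> ((f \<cdot> v) \<cdot> f)" using v f by (simp add: comp_diff)
  then have "f \<cdot> (Idn C P \<boxminus> (v \<cdot> f)) = Zero C P M" unfolding fv using f by simp
  then obtain r where r: "\<guillemotleft>r : P \<rightarrow> B\<guillemotright>" "k \<cdot> r = Idn C P \<boxminus> (v \<cdot> f)" using quad_lift[OF q 1] by blast
  have "k \<cdot> ((r \<cdot> k) \<boxminus> Idn C B) = ((k \<cdot> r) \<cdot> k) \<boxminus> k" using r(1) ty by (simp add: comp_diff)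
  also have "(k \<cdot> r) \<cdot> k = k \<boxminus> (v \<cdot> (f \<cdot> k))" unfolding r(2) using v f ty by (simp add: diff_comp)
  also have "\<dots> = k" unfolding fk using v ty by simp
  finally have "k \<cdot> ((r \<cdot> k) \<boxminus> Idn C B) = Zero C B P" using ty by simp
  then have "(r \<cdot> k) \<boxminus> Idn C B = Zero C B B" using r(1) ty by (intro k_monic[of _ B]) simp_all
  then have rk: "r \<cdot> k = Idn C B" using r(1) ty by simp
  have "k \<cdot> (r \<cdot> v) = (k \<cdot> r) \<cdot> v" using r(1) ty v by simp
  also have "\<dots> = v \<boxminus> (v \<cdot> (f \<cdot> v))" unfolding r(2) using v f by (simp add: diff_comp)
  also have "\<dots> = Zero C M P" unfolding fv using v by simp
  finally have rv: "r \<cdot> v = Zero C M B" using r(1) v by (intro k_monic[of _ M]) simp_all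
  have "(v \<cdot> f) \<boxplus> (k \<cdot> r) = (k \<cdot> r) \<boxplus> (v \<cdot> f)" by (rule plus_comm) (use v f ty r(1) in simp_all)
  also have "\<dots> = Idn C P" unfolding r(2) using v f by simp
  finally have sum: "(v \<cdot> f) \<boxplus> (k \<cdot> r) = Idn C P" .
  have hom: "v \<in> Hom C M P" "f \<in> Hom C P M" "k \<in> Hom C B P" "r \<in> Hom C P B" "B \<in> Ob C"
    using v f ty(1) r(1) unfolding arr_def by blast+
  have "direct_sum C M B P"
    unfolding direct_sum_def
    by (intro conjI bexI[of _ v] bexI[of _ k] bexI[of _ f] bexI[of _ r]) (rule Ob hom fv rk fk rv sum)+
  then show thesis by (rule that)
qed

end

section \<open>Hearts of twin cotorsion pairs\<close>

context triangulated_category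
begin

sublocale exact_quadruples C quad
  by (rule exact_quadruples)

lemma cotorsion_Ob:
  assumes "cotorsion_pair C \<U> \<V>"
  shows "u \<in> \<U> \<Longrightarrow> u \<in> Ob C" "v \<in> \<V> \<Longrightarrow> v \<in> Ob C"
  using assms unfolding cotorsion_pair_def additive_subcategory_def by blast+

lemma Ext1_Zero:
  assumes "Ext1_vanishes C \<U> \<V>" "u \<in> \<U>" "v \<in> \<V>" "\<guillemotleft>f : u \<rightarrow> SOb C v\<guillemotright>"
  shows "f = Zero C u (SOb C v)"
  using assms unfolding Ext1_vanishes_def arr_def by blast

lemma cotorsion_quad:
  assumes "cotorsion_pair C \<U> \<V>" "M \<in> Ob C"
  shows "\<exists>u \<in> \<U>. \<exists>n \<in> SOb C ` \<V>. \<exists>W f g h. quad u M n W f g h"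
proof -
  have "M \<in> star C \<U> (SOb C ` \<V>)" using assms unfolding cotorsion_pair_def by blast
  then show ?thesis unfolding star_def using quadI by blast
qed

text \<open>
  In \<open>u \<rightarrow> M \<rightarrow> n\<close> the second map vanishes, so \<open>M\<close> is a retract, hence a direct summand, of \<open>u\<close>.
  The next lemma is dual.
\<close>

lemma cotorsion_left_orth:
  assumes cp: "cotorsion_pair C \<U> \<V>" and M: "M \<in> Ob C"
    and orth: "\<And>n f. n \<in> SOb C ` \<V> \<Longrightarrow> \<guillemotleft>f : M \<rightarrow> n\<guillemotright> \<Longrightarrow> f = Zero C M n"
  shows "M \<in> \<U>"
proof -
  obtain u n W f g h where *: "u \<in> \<U>" "n \<in> SOb C ` \<V>" "quad u M n W f g h" using cotorsion_quad[OF cp M] by blast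
  have ty: "\<guillemotleft>f : u \<rightarrow> M\<guillemotright>" "\<guillemotleft>g : M \<rightarrow> n\<guillemotright>" using quad_arr[OF *(3)] by blast+
  have "g \<cdot> Idn C M = Zero C M n" using orth[OF *(2) ty(2)] ty by simp
  then obtain v where v: "\<guillemotleft>v : M \<rightarrow> u\<guillemotright>" "f \<cdot> v = Idn C M" using quad_lift[OF *(3), of "Idn C M" M] M by auto
  obtain B where "direct_sum C M B u" by (rule retract_direct_sum[OF v(1) ty(1) v(2)])
  then show ?thesis using cp *(1) unfolding cotorsion_pair_def summand_closed_def by blast
qed

lemma cotorsion_right_orth:
  assumes cp: "cotorsion_pair C \<U> \<V>" and M: "M \<in> Ob C"
    and orth: "\<And>u f. u \<in> \<U> \<Longrightarrow> \<guillemotleft>f : u \<rightarrow> M\<guillemotright> \<Longrightarrow> f = Zero C u M"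
  shows "M \<in> SOb C ` \<V>"
proof -
  obtain u n W f g h where *: "u \<in> \<U>" "n \<in> SOb C ` \<V>" "quad u M n W f g h" using cotorsion_quad[OF cp M] by blast
  have ty: "\<guillemotleft>f : u \<rightarrow> M\<guillemotright>" "\<guillemotleft>g : M \<rightarrow> n\<guillemotright>" using quad_arr[OF *(3)] by blast+
  have "Idn C M \<cdot> f = Zero C u M" using orth[OF *(1) ty(1)] ty by simp
  then obtain r where r: "\<guillemotleft>r : n \<rightarrow> M\<guillemotright>" "r \<cdot> g = Idn C M" using quad_desc_second[OF *(3), of "Idn C M" M] M by auto
  \<comment> \<open>desuspend the retraction, since summands are only controlled in \<open>\<V>\<close>\<close>
  obtain n' where n': "n' \<in> \<V>" "n = SOb C n'" using *(2) by blast
  obtain M' where M': "M' \<in> Ob C" "SOb C M' = M" by (rule S_Ob_surj[OF M])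
  have n'_Ob: "n' \<in> Ob C" by (rule cotorsion_Ob(2)[OF cp n'(1)])
  obtain g' where g': "\<guillemotleft>g' : M' \<rightarrow> n'\<guillemotright>" "SArr C g' = g" using S_surj[of g M' n'] ty(2) M' n' n'_Ob by auto
  obtain r' where r': "\<guillemotleft>r' : n' \<rightarrow> M'\<guillemotright>" "SArr C r' = r" using S_surj[of r n' M'] r(1) M' n' n'_Ob by auto
  have "SArr C (r' \<cdot> g') = SArr C (Idn C M')" using g' r' r(2) M' by (simp add: S_Comp S_idn)
  then have "r' \<cdot> g' = Idn C M'" using S_inj[of "r' \<cdot> g'" M' M' "Idn C M'"] g'(1) r'(1) by simp
  then obtain B where "direct_sum C M' B n'" by (rule retract_direct_sum[OF g'(1) r'(1)])
  then have "M' \<in> \<V>" using cp n'(1) unfolding cotorsion_pair_def summand_closed_def by blast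
  then show ?thesis using M'(2) by blast
qed

text \<open>
  The first cotorsion pair enters in the desuspended form \<open>(\<Sigma>\<inverse>\<S>, \<T>)\<close>; the same four properties
  are obtained from those of \<open>(\<S>, \<Sigma>\<T>)\<close> since \<open>\<Sigma>\<close> is an automorphism.
\<close>

lemma desuspended_Zero:
  assumes ext: "Ext1_vanishes C \<S> \<T>" and p: "p \<in> desuspension C \<S>" and t: "t \<in> \<T>" and f: "\<guillemotleft>f : p \<rightarrow> t\<guillemotright>"
  shows "f = Zero C p t"
proof -
  have "SArr C f = Zero C (SOb C p) (SOb C t)"
    using p by (intro Ext1_Zero[OF ext _ t S_arr[OF f]]) (simp add: desuspension_def)
  then have "SArr C f = SArr C (Zero C p t)" using f by (simp add: S_Zero)
  then show ?thesis using S_inj[OF f, of "Zero C p t"] f by simp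
qed

lemma desuspended_quad:
  assumes cp: "cotorsion_pair C \<S> \<T>" and M: "M \<in> Ob C"
  shows "\<exists>p \<in> desuspension C \<S>. \<exists>t \<in> \<T>. \<exists>W f g h. quad p M t W f g h"
proof -
  obtain s t W f g h where *: "s \<in> \<S>" "t \<in> \<T>" "quad s (SOb C M) (SOb C t) W f g h"
    using cotorsion_quad[OF cp S_Ob[OF M]] by blast
  obtain V1 k1 where 1: "quad V1 s (SOb C M) (SOb C t) k1 f g" using quad_unrotate[OF *(3)] by blast
  obtain V2 k2 where 2: "quad V2 V1 s (SOb C M) k2 k1 f" using quad_unrotate[OF 1] by blast
  obtain V3 k3 where 3: "quad V3 V2 V1 s k3 k2 k1" using quad_unrotate[OF 2] by blast
  have Ob: "V1 \<in> Ob C" "V2 \<in> Ob C" "V3 \<in> Ob C" using 1 2 3 unfolding quad_def triangle_def by blast+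
  have "SOb C V1 = SOb C t" "SOb C V2 = SOb C M" and V3: "SOb C V3 = s" using 1 2 3 unfolding quad_def by simp_all
  then have "V1 = t" "V2 = M" using S_Ob_inj Ob M cotorsion_Ob(2)[OF cp *(2)] by blast+
  moreover have "V3 \<in> desuspension C \<S>" using V3 Ob *(1) by (simp add: desuspension_def)
  ultimately show ?thesis using 3 *(2) by blast
qed

lemma desuspended_left_orth:
  assumes cp: "cotorsion_pair C \<S> \<T>" and M: "M \<in> Ob C"
    and orth: "\<And>t f. t \<in> \<T> \<Longrightarrow> \<guillemotleft>f : M \<rightarrow> t\<guillemotright> \<Longrightarrow> f = Zero C M t"
  shows "M \<in> desuspension C \<S>"
proof -
  have "SOb C M \<in> \<S>"
  proof (rule cotorsion_left_orth[OF cp S_Ob[OF M]])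
    fix n g assume "n \<in> SOb C ` \<T>" and g: "\<guillemotleft>g : SOb C M \<rightarrow> n\<guillemotright>"
    then obtain t where t: "t \<in> \<T>" "n = SOb C t" by blast
    have tOb: "t \<in> Ob C" by (rule cotorsion_Ob(2)[OF cp t(1)])
    obtain f where f: "\<guillemotleft>f : M \<rightarrow> t\<guillemotright>" "SArr C f = g" using S_surj[of g M t] g t(2) M tOb by auto
    have "f = Zero C M t" by (rule orth[OF t(1) f(1)])
    then show "g = Zero C (SOb C M) n" using f(2) t(2) M tOb by (auto simp: S_Zero)
  qed
  then show ?thesis using M by (simp add: desuspension_def)
qed

lemma desuspended_right_orth:
  assumes cp: "cotorsion_pair C \<S> \<T>" and M: "M \<in> Ob C"
    and orth: "\<And>p f. p \<in> desuspension C \<S> \<Longrightarrow> \<guillemotleft>f : p \<rightarrow> M\<guillemotright> \<Longrightarrow> f = Zero C p M"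
  shows "M \<in> \<T>"
proof -
  have "SOb C M \<in> SOb C ` \<T>"
  proof (rule cotorsion_right_orth[OF cp S_Ob[OF M]])
    fix s g assume s: "s \<in> \<S>" and g: "\<guillemotleft>g : s \<rightarrow> SOb C M\<guillemotright>"
    have sOb: "s \<in> Ob C" by (rule cotorsion_Ob(1)[OF cp s])
    obtain p where p: "p \<in> Ob C" "SOb C p = s" by (rule S_Ob_surj[OF sOb])
    have pS: "p \<in> desuspension C \<S>" using p s by (simp add: desuspension_def)
    obtain f where f: "\<guillemotleft>f : p \<rightarrow> M\<guillemotright>" "SArr C f = g" using S_surj[of g p M] g p M by auto
    have "f = Zero C p M" by (rule orth[OF pS f(1)])
    then show "g = Zero C s (SOb C M)" using f(2) p M by (auto simp: S_Zero)
  qed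
  then obtain t where t: "t \<in> \<T>" "SOb C M = SOb C t" by blast
  then have "M = t" using S_Ob_inj[OF M cotorsion_Ob(2)[OF cp t(1)]] by simp
  then show ?thesis using t(1) by simp
qed

lemma twin_classes:
  assumes "twin_cotorsion_pair C \<S> \<T> \<U> \<V>"
  shows "twin_classes C quad (desuspension C \<S>) \<T> \<U> (SOb C ` \<V>)"
proof -
  have ST: "cotorsion_pair C \<S> \<T>" and UV: "cotorsion_pair C \<U> \<V>" and SV: "Ext1_vanishes C \<S> \<V>"
    using assms unfolding twin_cotorsion_pair_def by blast+
  have extST: "Ext1_vanishes C \<S> \<T>" and extUV: "Ext1_vanishes C \<U> \<V>"
    using ST UV unfolding cotorsion_pair_def by blast+
  show ?thesis
  proof unfold_locales
    show "desuspension C \<S> \<subseteq> Ob C" "\<T> \<subseteq> Ob C" "\<U> \<subseteq> Ob C" "SOb C ` \<V> \<subseteq> Ob C"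
      using cotorsion_Ob[OF ST] cotorsion_Ob[OF UV] S_Ob by (auto simp: desuspension_def)
    show "f = Zero C p t" if "p \<in> desuspension C \<S>" "t \<in> \<T>" "\<guillemotleft>f : p \<rightarrow> t\<guillemotright>" for p t f
      by (rule desuspended_Zero[OF extST that])
    show "f = Zero C u n" if "u \<in> \<U>" "n \<in> SOb C ` \<V>" "\<guillemotleft>f : u \<rightarrow> n\<guillemotright>" for u n f
      using that by (auto intro: Ext1_Zero[OF extUV] simp del: arr_iff)
  next
    fix M assume M: "M \<in> Ob C"
    show "\<exists>p \<in> desuspension C \<S>. \<exists>t \<in> \<T>. \<exists>W f g h. quad p M t W f g h" by (rule desuspended_quad[OF ST M])
    show "\<exists>u \<in> \<U>. \<exists>n \<in> SOb C ` \<V>. \<exists>W f g h. quad u M n W f g h" by (rule cotorsion_quad[OF UV M])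
    show "M \<in> desuspension C \<S>" if "\<And>t f. t \<in> \<T> \<Longrightarrow> \<guillemotleft>f : M \<rightarrow> t\<guillemotright> \<Longrightarrow> f = Zero C M t"
      by (rule desuspended_left_orth[OF ST M that])
    show "M \<in> \<T>" if "\<And>p f. p \<in> desuspension C \<S> \<Longrightarrow> \<guillemotleft>f : p \<rightarrow> M\<guillemotright> \<Longrightarrow> f = Zero C p M"
      by (rule desuspended_right_orth[OF ST M that])
    show "M \<in> \<U>" if "\<And>n f. n \<in> SOb C ` \<V> \<Longrightarrow> \<guillemotleft>f : M \<rightarrow> n\<guillemotright> \<Longrightarrow> f = Zero C M n"
      by (rule cotorsion_left_orth[OF UV M that])
    show "M \<in> SOb C ` \<V>" if "\<And>u f. u \<in> \<U> \<Longrightarrow> \<guillemotleft>f : u \<rightarrow> M\<guillemotright> \<Longrightarrow> f = Zero C u M"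
      by (rule cotorsion_right_orth[OF UV M that])
  next
    fix X Y Z W f g h assume q: "quad X Y Z W f g h"
    have W: "W = SOb C X" using q unfolding quad_def by blast
    have X: "X \<in> Ob C" using quad_arr[OF q] by simp
    show "W \<in> \<U>" if "X \<in> desuspension C \<S>"
    proof (rule cotorsion_left_orth[OF UV])
      show "W \<in> Ob C" using W X by simp
      have "W \<in> \<S>" using that unfolding W desuspension_def by simp
      then show "f = Zero C W n" if "n \<in> SOb C ` \<V>" "\<guillemotleft>f : W \<rightarrow> n\<guillemotright>" for n f
        using that by (auto intro: Ext1_Zero[OF SV] simp del: arr_iff)
    qed
    show "X \<in> \<T>" if WN: "W \<in> SOb C ` \<V>"
    proof (rule desuspended_right_orth[OF ST X])
      obtain v where v: "W = SOb C v" "v \<in> \<V>" using WN by (rule imageE)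
      have "X = v" using v(1) W S_Ob_inj[OF X cotorsion_Ob(2)[OF UV v(2)]] by metis
      with v(2) have XV: "X \<in> \<V>" by simp
      show "f = Zero C p X" if "p \<in> desuspension C \<S>" "\<guillemotleft>f : p \<rightarrow> X\<guillemotright>" for p f
        by (rule desuspended_Zero[OF SV that(1) XV that(2)])
    qed
  qed
qed

lemma star_quad:
  "M \<in> star C \<X> \<Y> \<longleftrightarrow> (\<exists>X \<in> \<X>. \<exists>Y \<in> \<Y>. \<exists>W f g h. quad X M Y W f g h)"
proof
  assume "M \<in> star C \<X> \<Y>"
  then obtain X Y f g h where "X \<in> \<X>" "Y \<in> \<Y>" "triangle C X M Y f g h" unfolding star_def by blast
  then show "\<exists>X \<in> \<X>. \<exists>Y \<in> \<Y>. \<exists>W f g h. quad X M Y W f g h" using quadI by blast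
next
  assume "\<exists>X \<in> \<X>. \<exists>Y \<in> \<Y>. \<exists>W f g h. quad X M Y W f g h"
  then obtain X Y W f g h where *: "X \<in> \<X>" "Y \<in> \<Y>" "quad X M Y W f g h" by blast
  obtain h' where "triangle C X M Y f g h'" by (rule quad_triangle[OF *(3)])
  then show "M \<in> star C \<X> \<Y>" unfolding star_def using *(1,2) by blast
qed

end

theorem corollary3p5:
  fixes C :: "('o, 'm) tricat"
    and \<S> \<T> \<U> \<V> :: "'o set"
  assumes "triangulated_category C"
    and "twin_cotorsion_pair C \<S> \<T> \<U> \<V>"
    and "\<U> \<subseteq> \<T> \<or> \<T> \<subseteq> \<U>"
  shows "quasi_abelian_category (heart C \<S> \<T> \<U> \<V>)"
proof -
  interpret triangulated_category C by fact
  interpret twin: twin_classes C quad "desuspension C \<S>" \<T> \<U> "SOb C ` \<V>"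
    by (rule twin_classes[OF assms(2)])
  have star_Ob: "M \<in> Ob C" if "M \<in> star C \<X> \<Y>" for M \<X> \<Y>
    using that unfolding star_def triangle_def by blast
  show ?thesis
  proof (cases "\<U> \<subseteq> \<T>")
    case True
    \<comment> \<open>here \<open>\<C>\<^sup>+ = \<U> * \<Sigma>\<V>\<close> is the whole category, so only \<open>\<C>\<^sup>-\<close> restricts the heart\<close>
    interpret nested_twin_classes C quad "desuspension C \<S>" \<T> \<U> "SOb C ` \<V>"
      by unfold_locales (rule True)
    have W: "twin_W \<T> \<U> = \<U>" using True by (auto simp: twin_W_def)
    have "M \<in> twin_H C \<S> \<T> \<U> \<V> \<longleftrightarrow> M \<in> \<H>" for M
    proof
      assume "M \<in> twin_H C \<S> \<T> \<U> \<V>"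
      then have M: "M \<in> star C (desuspension C \<S>) \<U>" unfolding twin_H_def twin_minus_def W by (rule IntD1)
      show "M \<in> \<H>"
        using M[unfolded star_quad] star_Ob[OF M] unfolding \<H>_def by simp
    next
      assume "M \<in> \<H>"
      then have M: "M \<in> Ob C" "\<exists>p \<in> desuspension C \<S>. \<exists>u \<in> \<U>. \<exists>W f g h. quad p M u W f g h"
        unfolding \<H>_def by simp_all
      show "M \<in> twin_H C \<S> \<T> \<U> \<V>"
        unfolding twin_H_def twin_minus_def twin_plus_def W Int_iff
          star_quad
        using M(2) twin.UN_ex[OF M(1)] by (rule conjI)
    qed
    then have "twin_H C \<S> \<T> \<U> \<V> = \<H>" by blast
    then show ?thesis using heart_quasi_abelian unfolding heart_def W by simp
  next
    case False
    then have TU: "\<T> \<subseteq> \<U>" using assms(3) by blast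
    \<comment> \<open>dually \<open>\<C>\<^sup>- = \<Sigma>\<inverse>\<S> * \<T>\<close> is the whole category, and \<open>\<T> * \<Sigma>\<V>\<close> is \<open>\<Sigma>\<V> * \<T>\<close> in the opposite one\<close>
    interpret op: nested_twin_classes "op_category C" "\<lambda>X Y Z W f g h. quad W Z Y X h g f"
      "SOb C ` \<V>" \<U> \<T> "desuspension C \<S>"
      by (rule nested_twin_classes.intro[OF twin.twin_classes_op]) (unfold_locales, rule TU)
    have W: "twin_W \<T> \<U> = \<T>" using TU by (auto simp: twin_W_def)
    have "M \<in> twin_H C \<S> \<T> \<U> \<V> \<longleftrightarrow> M \<in> op.\<H>" for M
    proof
      assume "M \<in> twin_H C \<S> \<T> \<U> \<V>"
      then have plus: "M \<in> star C \<T> (SOb C ` \<V>)" unfolding twin_H_def twin_plus_def W by (rule IntD2)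
      then obtain t n V f g h where *: "t \<in> \<T>" "n \<in> SOb C ` \<V>" "quad t M n V f g h"
        unfolding star_quad by blast
      obtain V' k where "quad V' t M n k f g" using quad_unrotate[OF *(3)] by blast
      then show "M \<in> op.\<H>" unfolding op.\<H>_def op_category_simps using *(1,2) star_Ob[OF plus] by blast
    next
      assume "M \<in> op.\<H>"
      then obtain n t V f g h where *: "n \<in> SOb C ` \<V>" "t \<in> \<T>" "quad V t M n h g f" and M: "M \<in> Ob C"
        unfolding op.\<H>_def op_category_simps by blast
      obtain V' k where "quad t M n V' g f k" using quad_rotate[OF *(3)] by blast
      then have "M \<in> twin_plus C \<T> \<U> \<V>"
        unfolding twin_plus_def W star_quad using *(1,2) by blast
      moreover have "M \<in> twin_minus C \<S> \<T> \<U>"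
        unfolding twin_minus_def W star_quad by (rule twin.PT_ex[OF M])
      ultimately show "M \<in> twin_H C \<S> \<T> \<U> \<V>" unfolding twin_H_def by blast
    qed
    then have H: "twin_H C \<S> \<T> \<U> \<V> = op.\<H>" by blast
    have "quasi_abelian_category (op_category (heart C \<S> \<T> \<U> \<V>))"
      using op.heart_quasi_abelian unfolding heart_def W H quotient_op .
    from quasi_abelian_op[OF this] show ?thesis unfolding op_op_category .
  qed
qed

end
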